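(* Let $M$ be a smooth $n$-dimensional manifold and let $(g_t,H_t,\phi_t)$ be a solution to generalized Ricci flow on $M$, where $\phi_t$ is a solution of the associated dilaton flow. Then $$\square R^{H,\phi} = 2\,\bigl|\mathrm{Rc}^{H,\phi}\bigr|^2 ,$$ where $\square = \frac{\partial}{\partial t}-\Delta_{g_t}$ and $R^{H,\phi}$, $\mathrm{Rc}^{H,\phi}$ are computed from $(g_t,H_t,\phi_t)$ at each time $t$.
   Context: Conventions: for a tensor or differential form $T$ of rank $k$, inner products and norms are full tensor contractions, e.g. $|T|^2 = T_{i_1\dots i_k}T^{i_1\dots i_k}$ (no factor $1/k!$). $\mathrm{Rc}$ and $R$ are the Ricci tensor and scalar curvature of $g$; $\Delta$ is the Laplacian $\mathrm{tr}_g\nabla^2$ on functions; $d^*_g$ is the codifferential, $(d_g^*H)_{jk}=-\nabla^iH_{ijk}$; $i_X$ is interior product; $H^2(X,Y)=\langle i_XH,i_YH\rangle$. Generalized Ricci flow: a one-parameter family of Riemannian metrics $g_t$ and closed three-forms $H_t=H_0+db_t$ satisfying $\frac{\partial}{\partial t}g=-2\mathrm{Rc}+\frac12H^2$ and $\frac{\partial}{\partial t}b=-d^*_gH$. Dilaton flow: a one-parameter family of smooth functions $\phi_t$ with $\square\phi=\frac16|H|^2$. A triple $(g_t,H_t,\phi_t)$ is called a solution of generalized Ricci flow if $(g_t,H_t)$ solves generalized Ricci flow and $\phi_t$ solves the associated dilaton flow. For a Riemannian metric $g$, closed three-form $H$ and function $\phi$: $$\mathrm{Rc}^{H,\phi}=\mathrm{Rc}-\tfrac14H^2+\nabla^2\phi-\tfrac12\bigl(d^*_gH+i_{\nabla\phi}H\bigr),\qquad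 R^{H,\phi}=R-\tfrac1{12}|H|^2+2\Delta\phi-|\nabla\phi|^2 .$$ ($\mathrm{Rc}^{H,\phi}$ is a 2-tensor with a symmetric and a skew-symmetric part.) *)

theory Defs
  imports "HOL-Analysis.Analysis"
begin

section \<open>Smooth manifolds\<close>

primrec Ck_on :: "nat \<Rightarrow> 'e set \<Rightarrow> ('e::euclidean_space \<Rightarrow> 'f::real_normed_vector) \<Rightarrow> bool" where
  "Ck_on 0 S f \<longleftrightarrow> continuous_on S f"
| "Ck_on (Suc k) S f \<longleftrightarrow>
     (\<forall>x\<in>S. f differentiable (at x)) \<and> (\<forall>v. Ck_on k S (\<lambda>x. frechet_derivative f (at x) v))"

text \<open>\<open>Ck_on\<close> is only meaningful on open sets.  On an arbitrary set \<open>S\<close> (below also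
  \<open>I \<times> V\<close> for a time interval \<open>I\<close> that may contain its end points), smoothness
  means that there are smooth extensions locally.\<close>

definition smooth_on :: "'e set \<Rightarrow> ('e::euclidean_space \<Rightarrow> 'f::real_normed_vector) \<Rightarrow> bool" where
  "smooth_on S f \<longleftrightarrow> (\<forall>x\<in>S. \<exists>W F. open W \<and> x \<in> W \<and> (\<forall>k. Ck_on k W F) \<and> (\<forall>y\<in>S \<inter> W. F y = f y))"

text \<open>A chart \<open>(U, x)\<close> consists of its domain and its coordinate map; the dimension
  is \<open>CARD('n)\<close>.\<close>

type_synonym ('a, 'n) chart = "'a set \<times> ('a \<Rightarrow> real ^ 'n)"

abbreviation cdom :: "('a, 'n) chart \<Rightarrow> 'a set" where
  "cdom c \<equiv> fst c"

abbreviation cmap :: "('a, 'n) chart \<Rightarrow> 'a \<Rightarrow> real ^ 'n" where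
  "cmap c \<equiv> snd c"

definition cinv :: "('a, 'n) chart \<Rightarrow> real ^ 'n \<Rightarrow> 'a" where
  "cinv c = inv_into (cdom c) (cmap c)"

definition is_chart :: "'a topology \<Rightarrow> ('a, 'n::finite) chart \<Rightarrow> bool" where
  "is_chart M c \<longleftrightarrow> openin M (cdom c) \<and> open (cmap c ` cdom c) \<and>
     homeomorphic_map (subtopology M (cdom c)) (top_of_set (cmap c ` cdom c)) (cmap c)"

definition smooth_manifold :: "'a topology \<Rightarrow> ('a, 'n::finite) chart set \<Rightarrow> bool" where
  "smooth_manifold M A \<longleftrightarrow>
     Hausdorff_space M \<and> second_countable M \<and>
     (\<forall>c\<in>A. is_chart M c) \<and> (\<Union>c\<in>A. cdom c) = topspace M \<and>
     (\<forall>c\<in>A. \<forall>d\<in>A. smooth_on (cmap c ` (cdom c \<inter> cdom d)) (cmap d \<circ> cinv c))"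


section \<open>Tangent vectors and tensor fields\<close>

definition smooth_near :: "'a topology \<Rightarrow> ('a, 'n::finite) chart set \<Rightarrow> 'a \<Rightarrow> ('a \<Rightarrow> real) \<Rightarrow> bool" where
  "smooth_near M A p f \<longleftrightarrow>
     (\<exists>W. openin M W \<and> p \<in> W \<and> (\<forall>c\<in>A. smooth_on (cmap c ` (cdom c \<inter> W)) (f \<circ> cinv c)))"

text \<open>Tangent vectors at \<open>p\<close> are the derivations at \<open>p\<close> of the functions that are smooth
  near \<open>p\<close>.  The value on all other functions is fixed to be \<open>0\<close>, so that a tangent vector
  is determined as a HOL function.  Locality (dependence on the germ only) follows by applying
  the Leibniz rule to indicator functions of neighbourhoods of \<open>p\<close>.\<close>

type_synonym 'a tvec = "('a \<Rightarrow> real) \<Rightarrow> real"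

definition tangent_space :: "'a topology \<Rightarrow> ('a, 'n::finite) chart set \<Rightarrow> 'a \<Rightarrow> 'a tvec set" where
  "tangent_space M A p = {X.
     (\<forall>f. \<not> smooth_near M A p f \<longrightarrow> X f = 0) \<and>
     (\<forall>f h. smooth_near M A p f \<longrightarrow> smooth_near M A p h \<longrightarrow>
        (\<forall>a b. X (\<lambda>q. a * f q + b * h q) = a * X f + b * X h) \<and>
        X (\<lambda>q. f q * h q) = f p * X h + h p * X f)}"

definition coord_deriv :: "('a, 'n::finite) chart \<Rightarrow> 'n \<Rightarrow> ('a \<Rightarrow> real) \<Rightarrow> 'a \<Rightarrow> real" where
  "coord_deriv c i f p = frechet_derivative (f \<circ> cinv c) (at (cmap c p)) (axis i 1)"

definition coord_vec ::
    "'a topology \<Rightarrow> ('a, 'n::finite) chart set \<Rightarrow> ('a, 'n) chart \<Rightarrow> 'n \<Rightarrow> 'a \<Rightarrow> 'a tvec" where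
  "coord_vec M A c i p = (\<lambda>f. if smooth_near M A p f then coord_deriv c i f p else 0)"

type_synonym 'a tensor2 = "'a \<Rightarrow> 'a tvec \<Rightarrow> 'a tvec \<Rightarrow> real"
type_synonym 'a tensor3 = "'a \<Rightarrow> 'a tvec \<Rightarrow> 'a tvec \<Rightarrow> 'a tvec \<Rightarrow> real"

definition comp2 ::
    "'a topology \<Rightarrow> ('a, 'n::finite) chart set \<Rightarrow> ('a, 'n) chart \<Rightarrow> 'a tensor2 \<Rightarrow> 'n \<Rightarrow> 'n \<Rightarrow> 'a \<Rightarrow> real" where
  "comp2 M A c T i j p = T p (coord_vec M A c i p) (coord_vec M A c j p)"

definition comp3 ::
    "'a topology \<Rightarrow> ('a, 'n::finite) chart set \<Rightarrow> ('a, 'n) chart \<Rightarrow> 'a tensor3 \<Rightarrow> 'n \<Rightarrow> 'n \<Rightarrow> 'n \<Rightarrow> 'a \<Rightarrow> real" where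
  "comp3 M A c T i j k p = T p (coord_vec M A c i p) (coord_vec M A c j p) (coord_vec M A c k p)"

definition smooth_fun :: "('a, 'n::finite) chart \<Rightarrow> ('a \<Rightarrow> real) \<Rightarrow> bool" where
  "smooth_fun c u \<longleftrightarrow> smooth_on (cmap c ` cdom c) (u \<circ> cinv c)"

definition smooth_family :: "real set \<Rightarrow> ('a, 'n::finite) chart \<Rightarrow> (real \<Rightarrow> 'a \<Rightarrow> real) \<Rightarrow> bool" where
  "smooth_family I c u \<longleftrightarrow> smooth_on (I \<times> cmap c ` cdom c) (\<lambda>(t, y). u t (cinv c y))"

definition Riemannian_metric :: "'a topology \<Rightarrow> ('a, 'n::finite) chart set \<Rightarrow> 'a tensor2 \<Rightarrow> bool" where
  "Riemannian_metric M A g \<longleftrightarrow>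
     (\<forall>p\<in>topspace M.
        (\<forall>X\<in>tangent_space M A p. \<forall>Y\<in>tangent_space M A p. g p X Y = g p Y X) \<and>
        (\<forall>X\<in>tangent_space M A p. \<forall>Y\<in>tangent_space M A p. \<forall>Z\<in>tangent_space M A p. \<forall>a b.
           g p (\<lambda>f. a * X f + b * Y f) Z = a * g p X Z + b * g p Y Z) \<and>
        (\<forall>X\<in>tangent_space M A p. X \<noteq> (\<lambda>f. 0) \<longrightarrow> g p X X > 0)) \<and>
     (\<forall>c\<in>A. \<forall>i j. smooth_fun c (comp2 M A c g i j))"

definition two_form :: "'a topology \<Rightarrow> ('a, 'n::finite) chart set \<Rightarrow> 'a tensor2 \<Rightarrow> bool" where
  "two_form M A b \<longleftrightarrow>
     (\<forall>p\<in>topspace M.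
        (\<forall>X\<in>tangent_space M A p. \<forall>Y\<in>tangent_space M A p. b p X Y = - b p Y X) \<and>
        (\<forall>X\<in>tangent_space M A p. \<forall>Y\<in>tangent_space M A p. \<forall>Z\<in>tangent_space M A p. \<forall>r s.
           b p (\<lambda>f. r * X f + s * Y f) Z = r * b p X Z + s * b p Y Z)) \<and>
     (\<forall>c\<in>A. \<forall>i j. smooth_fun c (comp2 M A c b i j))"

definition three_form :: "'a topology \<Rightarrow> ('a, 'n::finite) chart set \<Rightarrow> 'a tensor3 \<Rightarrow> bool" where
  "three_form M A H \<longleftrightarrow>
     (\<forall>p\<in>topspace M.
        (\<forall>X\<in>tangent_space M A p. \<forall>Y\<in>tangent_space M A p. \<forall>Z\<in>tangent_space M A p.
           H p X Y Z = - H p Y X Z \<and> H p X Y Z = - H p X Z Y) \<and>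
        (\<forall>X\<in>tangent_space M A p. \<forall>Y\<in>tangent_space M A p.
         \<forall>Z\<in>tangent_space M A p. \<forall>V\<in>tangent_space M A p. \<forall>r s.
           H p (\<lambda>f. r * X f + s * Y f) Z V = r * H p X Z V + s * H p Y Z V)) \<and>
     (\<forall>c\<in>A. \<forall>i j k. smooth_fun c (comp3 M A c H i j k))"


section \<open>Tensor calculus in a chart\<close>

text \<open>In this section \<open>G\<close>, \<open>T\<close>, \<open>b\<close>, \<open>H\<close> are the component functions, on the domain of the
  chart \<open>c\<close>, of the metric and of covariant tensor fields.  Inner products are full tensor
  contractions, without combinatorial factors.  Tensorial identities on the manifold are stated as
  identities of components in every chart of the atlas, and identities of scalars as identities of
  their coordinate expressions in every chart.\<close>

definition d_two :: "('a, 'n::finite) chart \<Rightarrow> ('n \<Rightarrow> 'n \<Rightarrow> 'a \<Rightarrow> real) \<Rightarrow> 'n \<Rightarrow> 'n \<Rightarrow> 'n \<Rightarrow> 'a \<Rightarrow> real" where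
  "d_two c b i j k p = coord_deriv c i (b j k) p - coord_deriv c j (b i k) p + coord_deriv c k (b i j) p"

definition d_three ::
    "('a, 'n::finite) chart \<Rightarrow> ('n \<Rightarrow> 'n \<Rightarrow> 'n \<Rightarrow> 'a \<Rightarrow> real) \<Rightarrow> 'n \<Rightarrow> 'n \<Rightarrow> 'n \<Rightarrow> 'n \<Rightarrow> 'a \<Rightarrow> real" where
  "d_three c H i j k l p =
     coord_deriv c i (H j k l) p - coord_deriv c j (H i k l) p + coord_deriv c k (H i j l) p - coord_deriv c l (H i j k) p"

definition ginv :: "('n::finite \<Rightarrow> 'n \<Rightarrow> 'a \<Rightarrow> real) \<Rightarrow> 'n \<Rightarrow> 'n \<Rightarrow> 'a \<Rightarrow> real" where
  "ginv G i j p = matrix_inv (\<chi> k l. G k l p) $ i $ j"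

text \<open>\<open>Christoffel c G k i j\<close> is \<open>\<Gamma>\<^sup>k\<^sub>i\<^sub>j\<close>.\<close>

definition Christoffel :: "('a, 'n::finite) chart \<Rightarrow> ('n \<Rightarrow> 'n \<Rightarrow> 'a \<Rightarrow> real) \<Rightarrow> 'n \<Rightarrow> 'n \<Rightarrow> 'n \<Rightarrow> 'a \<Rightarrow> real" where
  "Christoffel c G k i j p =
     (\<Sum>l\<in>UNIV. ginv G k l p * (coord_deriv c i (G j l) p + coord_deriv c j (G i l) p - coord_deriv c l (G i j) p)) / 2"

text \<open>\<open>Riem c G l i j k\<close> is the coefficient of \<open>\<partial>\<^sub>l\<close> in
  \<open>R(\<partial>\<^sub>i,\<partial>\<^sub>j)\<partial>\<^sub>k = \<nabla>\<^sub>i\<nabla>\<^sub>j\<partial>\<^sub>k - \<nabla>\<^sub>j\<nabla>\<^sub>i\<partial>\<^sub>k\<close>; with this sign the trace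
  below is positive on round spheres.\<close>

definition Riem ::
    "('a, 'n::finite) chart \<Rightarrow> ('n \<Rightarrow> 'n \<Rightarrow> 'a \<Rightarrow> real) \<Rightarrow> 'n \<Rightarrow> 'n \<Rightarrow> 'n \<Rightarrow> 'n \<Rightarrow> 'a \<Rightarrow> real" where
  "Riem c G l i j k p =
     coord_deriv c i (Christoffel c G l j k) p - coord_deriv c j (Christoffel c G l i k) p
     + (\<Sum>m\<in>UNIV. Christoffel c G l i m p * Christoffel c G m j k p - Christoffel c G l j m p * Christoffel c G m i k p)"

definition Ric :: "('a, 'n::finite) chart \<Rightarrow> ('n \<Rightarrow> 'n \<Rightarrow> 'a \<Rightarrow> real) \<Rightarrow> 'n \<Rightarrow> 'n \<Rightarrow> 'a \<Rightarrow> real" where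
  "Ric c G j k p = (\<Sum>i\<in>UNIV. Riem c G i i j k p)"

definition trace2 :: "('n::finite \<Rightarrow> 'n \<Rightarrow> 'a \<Rightarrow> real) \<Rightarrow> ('n \<Rightarrow> 'n \<Rightarrow> 'a \<Rightarrow> real) \<Rightarrow> 'a \<Rightarrow> real" where
  "trace2 G T p = (\<Sum>i\<in>UNIV. \<Sum>j\<in>UNIV. ginv G i j p * T i j p)"

definition scal :: "('a, 'n::finite) chart \<Rightarrow> ('n \<Rightarrow> 'n \<Rightarrow> 'a \<Rightarrow> real) \<Rightarrow> 'a \<Rightarrow> real" where
  "scal c G = trace2 G (Ric c G)"

definition Hess ::
    "('a, 'n::finite) chart \<Rightarrow> ('n \<Rightarrow> 'n \<Rightarrow> 'a \<Rightarrow> real) \<Rightarrow> ('a \<Rightarrow> real) \<Rightarrow> 'n \<Rightarrow> 'n \<Rightarrow> 'a \<Rightarrow> real" where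
  "Hess c G u i j p = coord_deriv c i (coord_deriv c j u) p - (\<Sum>k\<in>UNIV. Christoffel c G k i j p * coord_deriv c k u p)"

definition laplacian ::
    "('a, 'n::finite) chart \<Rightarrow> ('n \<Rightarrow> 'n \<Rightarrow> 'a \<Rightarrow> real) \<Rightarrow> ('a \<Rightarrow> real) \<Rightarrow> 'a \<Rightarrow> real" where
  "laplacian c G u = trace2 G (Hess c G u)"

definition grad ::
    "('a, 'n::finite) chart \<Rightarrow> ('n \<Rightarrow> 'n \<Rightarrow> 'a \<Rightarrow> real) \<Rightarrow> ('a \<Rightarrow> real) \<Rightarrow> 'n \<Rightarrow> 'a \<Rightarrow> real" where
  "grad c G u i p = (\<Sum>j\<in>UNIV. ginv G i j p * coord_deriv c j u p)"

definition grad_normsq ::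
    "('a, 'n::finite) chart \<Rightarrow> ('n \<Rightarrow> 'n \<Rightarrow> 'a \<Rightarrow> real) \<Rightarrow> ('a \<Rightarrow> real) \<Rightarrow> 'a \<Rightarrow> real" where
  "grad_normsq c G u p = (\<Sum>i\<in>UNIV. \<Sum>j\<in>UNIV. G i j p * grad c G u i p * grad c G u j p)"

definition interior_prod :: "('n::finite \<Rightarrow> 'a \<Rightarrow> real) \<Rightarrow> ('n \<Rightarrow> 'n \<Rightarrow> 'n \<Rightarrow> 'a \<Rightarrow> real) \<Rightarrow> 'n \<Rightarrow> 'n \<Rightarrow> 'a \<Rightarrow> real" where
  "interior_prod X H j k p = (\<Sum>i\<in>UNIV. X i p * H i j k p)"

text \<open>\<open>cov3 c G H m i j k\<close> is \<open>\<nabla>\<^sub>m H\<^sub>i\<^sub>j\<^sub>k\<close>.\<close>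

definition cov3 ::
    "('a, 'n::finite) chart \<Rightarrow> ('n \<Rightarrow> 'n \<Rightarrow> 'a \<Rightarrow> real) \<Rightarrow> ('n \<Rightarrow> 'n \<Rightarrow> 'n \<Rightarrow> 'a \<Rightarrow> real)
      \<Rightarrow> 'n \<Rightarrow> 'n \<Rightarrow> 'n \<Rightarrow> 'n \<Rightarrow> 'a \<Rightarrow> real" where
  "cov3 c G H m i j k p = coord_deriv c m (H i j k) p
     - (\<Sum>l\<in>UNIV. Christoffel c G l m i p * H l j k p + Christoffel c G l m j p * H i l k p + Christoffel c G l m k p * H i j l p)"

definition codiff ::
    "('a, 'n::finite) chart \<Rightarrow> ('n \<Rightarrow> 'n \<Rightarrow> 'a \<Rightarrow> real) \<Rightarrow> ('n \<Rightarrow> 'n \<Rightarrow> 'n \<Rightarrow> 'a \<Rightarrow> real)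
      \<Rightarrow> 'n \<Rightarrow> 'n \<Rightarrow> 'a \<Rightarrow> real" where
  "codiff c G H j k p = - (\<Sum>i\<in>UNIV. \<Sum>m\<in>UNIV. ginv G i m p * cov3 c G H m i j k p)"

definition inner2 ::
    "('n::finite \<Rightarrow> 'n \<Rightarrow> 'a \<Rightarrow> real) \<Rightarrow> ('n \<Rightarrow> 'n \<Rightarrow> 'a \<Rightarrow> real) \<Rightarrow> ('n \<Rightarrow> 'n \<Rightarrow> 'a \<Rightarrow> real) \<Rightarrow> 'a \<Rightarrow> real" where
  "inner2 G S T p = (\<Sum>i\<in>UNIV. \<Sum>j\<in>UNIV. \<Sum>k\<in>UNIV. \<Sum>l\<in>UNIV.
     ginv G i k p * ginv G j l p * S i j p * T k l p)"

definition inner3 ::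
    "('n::finite \<Rightarrow> 'n \<Rightarrow> 'a \<Rightarrow> real) \<Rightarrow> ('n \<Rightarrow> 'n \<Rightarrow> 'n \<Rightarrow> 'a \<Rightarrow> real) \<Rightarrow> ('n \<Rightarrow> 'n \<Rightarrow> 'n \<Rightarrow> 'a \<Rightarrow> real)
      \<Rightarrow> 'a \<Rightarrow> real" where
  "inner3 G S T p = (\<Sum>i\<in>UNIV. \<Sum>j\<in>UNIV. \<Sum>k\<in>UNIV. \<Sum>l\<in>UNIV. \<Sum>m\<in>UNIV. \<Sum>n\<in>UNIV.
     ginv G i l p * ginv G j m p * ginv G k n p * S i j k p * T l m n p)"

text \<open>\<open>H i\<close> has the components of the interior product of \<open>\<partial>\<^sub>i\<close> with \<open>H\<close>.\<close>

definition sq3 ::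
    "('n::finite \<Rightarrow> 'n \<Rightarrow> 'a \<Rightarrow> real) \<Rightarrow> ('n \<Rightarrow> 'n \<Rightarrow> 'n \<Rightarrow> 'a \<Rightarrow> real) \<Rightarrow> 'n \<Rightarrow> 'n \<Rightarrow> 'a \<Rightarrow> real" where
  "sq3 G H i j = inner2 G (H i) (H j)"

definition gen_Ric ::
    "('a, 'n::finite) chart \<Rightarrow> ('n \<Rightarrow> 'n \<Rightarrow> 'a \<Rightarrow> real) \<Rightarrow> ('n \<Rightarrow> 'n \<Rightarrow> 'n \<Rightarrow> 'a \<Rightarrow> real) \<Rightarrow> ('a \<Rightarrow> real)
      \<Rightarrow> 'n \<Rightarrow> 'n \<Rightarrow> 'a \<Rightarrow> real" where
  "gen_Ric c G H \<phi> i j p =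
     Ric c G i j p - 1/4 * sq3 G H i j p + Hess c G \<phi> i j p
     - 1/2 * (codiff c G H i j p + interior_prod (grad c G \<phi>) H i j p)"

definition gen_scal ::
    "('a, 'n::finite) chart \<Rightarrow> ('n \<Rightarrow> 'n \<Rightarrow> 'a \<Rightarrow> real) \<Rightarrow> ('n \<Rightarrow> 'n \<Rightarrow> 'n \<Rightarrow> 'a \<Rightarrow> real) \<Rightarrow> ('a \<Rightarrow> real)
      \<Rightarrow> 'a \<Rightarrow> real" where
  "gen_scal c G H \<phi> p =
     scal c G p - 1/12 * inner3 G H H p + 2 * laplacian c G \<phi> p - grad_normsq c G \<phi> p"


section \<open>Generalized Ricci flow\<close>

text \<open>One-sided at an end point of the interval \<open>I\<close>.\<close>

definition time_deriv :: "real set \<Rightarrow> (real \<Rightarrow> real) \<Rightarrow> real \<Rightarrow> real" where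
  "time_deriv I u t = vector_derivative u (at t within I)"

definition heat_op ::
    "real set \<Rightarrow> ('a, 'n::finite) chart \<Rightarrow> (real \<Rightarrow> 'n \<Rightarrow> 'n \<Rightarrow> 'a \<Rightarrow> real) \<Rightarrow> (real \<Rightarrow> 'a \<Rightarrow> real)
      \<Rightarrow> real \<Rightarrow> 'a \<Rightarrow> real" where
  "heat_op I c G u t p = time_deriv I (\<lambda>s. u s p) t - laplacian c (G t) (u t) p"

definition closed_three_form :: "'a topology \<Rightarrow> ('a, 'n::finite) chart set \<Rightarrow> 'a tensor3 \<Rightarrow> bool" where
  "closed_three_form M A H \<longleftrightarrow> three_form M A H \<and>
     (\<forall>c\<in>A. \<forall>p\<in>cdom c. \<forall>i j k l. d_three c (comp3 M A c H) i j k l p = 0)"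

definition generalized_Ricci_flow ::
    "'a topology \<Rightarrow> ('a, 'n::finite) chart set \<Rightarrow> real set \<Rightarrow> (real \<Rightarrow> 'a tensor2) \<Rightarrow> (real \<Rightarrow> 'a tensor3) \<Rightarrow> bool" where
  "generalized_Ricci_flow M A I g H \<longleftrightarrow>
     (\<forall>t\<in>I. Riemannian_metric M A (g t)) \<and>
     (\<forall>c\<in>A. \<forall>i j. smooth_family I c (\<lambda>t. comp2 M A c (g t) i j)) \<and>
     (\<forall>t\<in>I. closed_three_form M A (H t)) \<and>
     (\<forall>c\<in>A. \<forall>p\<in>cdom c. \<forall>t\<in>I. \<forall>i j.
        time_deriv I (\<lambda>s. comp2 M A c (g s) i j p) t =
          - 2 * Ric c (comp2 M A c (g t)) i j p
          + 1/2 * sq3 (comp2 M A c (g t)) (comp3 M A c (H t)) i j p) \<and>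
     (\<exists>H0 b. closed_three_form M A H0 \<and> (\<forall>t\<in>I. two_form M A (b t)) \<and>
        (\<forall>c\<in>A. \<forall>i j. smooth_family I c (\<lambda>t. comp2 M A c (b t) i j)) \<and>
        (\<forall>c\<in>A. \<forall>p\<in>cdom c. \<forall>t\<in>I. \<forall>i j k.
           comp3 M A c (H t) i j k p = comp3 M A c H0 i j k p + d_two c (comp2 M A c (b t)) i j k p) \<and>
        (\<forall>c\<in>A. \<forall>p\<in>cdom c. \<forall>t\<in>I. \<forall>i j.
           time_deriv I (\<lambda>s. comp2 M A c (b s) i j p) t =
             - codiff c (comp2 M A c (g t)) (comp3 M A c (H t)) i j p))"

definition dilaton_flow ::
    "'a topology \<Rightarrow> ('a, 'n::finite) chart set \<Rightarrow> real set \<Rightarrow> (real \<Rightarrow> 'a tensor2) \<Rightarrow> (real \<Rightarrow> 'a tensor3)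
      \<Rightarrow> (real \<Rightarrow> 'a \<Rightarrow> real) \<Rightarrow> bool" where
  "dilaton_flow M A I g H \<phi> \<longleftrightarrow>
     (\<forall>c\<in>A. smooth_family I c \<phi>) \<and>
     (\<forall>c\<in>A. \<forall>p\<in>cdom c. \<forall>t\<in>I.
        heat_op I c (\<lambda>s. comp2 M A c (g s)) \<phi> t p =
          1/6 * inner3 (comp2 M A c (g t)) (comp3 M A c (H t)) (comp3 M A c (H t)) p)"

text \<open>The generalized Ricci tensor and scalar curvature of a triple on \<open>M\<close>, expressed in the
  chart \<open>c\<close>.\<close>

definition Rc_Hphi ::
    "'a topology \<Rightarrow> ('a, 'n::finite) chart set \<Rightarrow> ('a, 'n) chart \<Rightarrow> 'a tensor2 \<Rightarrow> 'a tensor3 \<Rightarrow> ('a \<Rightarrow> real)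
      \<Rightarrow> 'n \<Rightarrow> 'n \<Rightarrow> 'a \<Rightarrow> real" where
  "Rc_Hphi M A c g H \<phi> = gen_Ric c (comp2 M A c g) (comp3 M A c H) \<phi>"

definition R_Hphi ::
    "'a topology \<Rightarrow> ('a, 'n::finite) chart set \<Rightarrow> ('a, 'n) chart \<Rightarrow> 'a tensor2 \<Rightarrow> 'a tensor3 \<Rightarrow> ('a \<Rightarrow> real)
      \<Rightarrow> 'a \<Rightarrow> real" where
  "R_Hphi M A c g H \<phi> = gen_scal c (comp2 M A c g) (comp3 M A c H) \<phi>"

end

(*
A chart turns the statement into an identity between differential polynomials in the components of
g, H, b and phi.  It is verified in the commutative ring of formal jets at a space-time point,
that is, of the families of all iterated partial derivatives in space and time, with the Leibniz
product; taking jets is multiplicative, intertwines differentiation with a shift and respects all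
identities that hold on the chart, so no smoothness side condition is left inside the ring.  At an
end point of the time interval the jet is that of any local smooth extension.

The tensor calculation uses full traces, which commute with each other and with covariant
differentiation.  The inputs are the contracted second Bianchi identity, the variation formula
delta R = div div h - Laplacian (tr h) - <Rc, h>, the Bochner formula for |grad phi|^2, and the
identity div (H^2) = - <d*H, H> + 1/6 d|H|^2 for closed H; everything else is linear algebra.
*)

theory Submission
  imports Defs
begin

section \<open>Functions of class C^k\<close>

text \<open>The constants interlock. Write N for |H|^2 and f for phi. Everything in the evolution
  that is not an inner product of the pieces of the generalized Ricci tensor has to cancel. The
  Laplacian of N enters with coefficient -5/12 from R, 1/12 from -N/12 and 1/3 from twice the
  Laplacian of f. The product of grad f and grad N enters with 1/3 from the Laplacian and -1/3 from
  -|grad f|^2. Both cancellations depend on the source N/6 of the dilaton flow. The product of H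
  with the covariant derivative of d*H cancels between R and N. Two obstacles shape the algebra.
  Index sums nested six deep resist rewriting, so contractions are written as nested traces whose
  remaining indices are mere parameters. Identities then hold for arbitrary families of ring
  elements, and no transformation law is ever invoked. Moreover jets are used only as a commutative
  ring without 2-torsion, so rational coefficients are cleared and halves are cancelled.\<close>

lemma Ck_on_subset: "Ck_on k W F \<Longrightarrow> V \<subseteq> W \<Longrightarrow> Ck_on k V F"
  by (induction k arbitrary: F) (auto intro: continuous_on_subset)

lemma Ck_on_Suc_imp: "Ck_on (Suc k) W F \<Longrightarrow> Ck_on k W F"
proof (induction k arbitrary: F)
  case 0
  then show ?case
    by (auto intro!: continuous_at_imp_continuous_on differentiable_imp_continuous_within)
next
  case (Suc k)
  have "Ck_on k W (\<lambda>x. frechet_derivative F (at x) v)" for v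
    using Suc.prems by (intro Suc.IH) auto
  then show ?case using Suc.prems by auto
qed

text \<open>Openness enters because \<open>frechet_derivative\<close> at a point of \<open>W\<close>
  sees a full neighbourhood of that point.\<close>

lemma Ck_on_cong: "open W \<Longrightarrow> \<forall>x\<in>W. F x = F' x \<Longrightarrow> Ck_on k W F \<Longrightarrow> Ck_on k W F'"
proof (induction k arbitrary: F F')
  case 0
  then show ?case by (simp cong: continuous_on_cong)
next
  case (Suc k)
  have d: "(F' has_derivative frechet_derivative F (at x)) (at x)" if x: "x \<in> W" for x
  proof (rule has_derivative_transform_within_open[OF _ Suc.prems(1) x])
    show "(F has_derivative frechet_derivative F (at x)) (at x)"
      using Suc.prems(3) x by (simp add: frechet_derivative_works)
  qed (use Suc.prems(2) in auto)
  have "Ck_on k W (\<lambda>x. frechet_derivative F' (at x) v)" for v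
  proof (rule Suc.IH[OF Suc.prems(1)])
    show "Ck_on k W (\<lambda>x. frechet_derivative F (at x) v)"
      using Suc.prems(3) by simp
  qed (auto simp: frechet_derivative_at[OF d, symmetric])
  then show ?case using d by (auto simp: differentiable_def)
qed

text \<open>Allows the derivative to be supplied by the usual \<open>has_derivative\<close> rules;
  uniqueness identifies it with the one in \<open>Ck_on\<close>.\<close>

lemma Ck_on_SucI:
  assumes "open W" and d: "\<And>x. x \<in> W \<Longrightarrow> (F has_derivative F' x) (at x)"
    and "\<And>v. Ck_on k W (\<lambda>x. F' x v)"
  shows "Ck_on (Suc k) W F"
proof -
  have "Ck_on k W (\<lambda>x. frechet_derivative F (at x) v)" for v
    by (rule Ck_on_cong[OF assms(1) _ assms(3)[of v]]) (auto simp: frechet_derivative_at[OF d, symmetric])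
  then show ?thesis using d by (auto simp: differentiable_def)
qed

lemma Ck_on_Suc_deriv:
  assumes "Ck_on (Suc k) W F" "x \<in> W"
  shows "(F has_derivative frechet_derivative F (at x)) (at x)"
  using assms by (simp add: frechet_derivative_works)

lemma Ck_on_deriv: "Ck_on (Suc k) W F \<Longrightarrow> Ck_on k W (\<lambda>x. frechet_derivative F (at x) v)"
  by simp

lemma Ck_on_const: "open W \<Longrightarrow> Ck_on k W (\<lambda>x. c)"
proof (induction k arbitrary: c)
  case (Suc k)
  show ?case
    by (rule Ck_on_SucI[where F' = "\<lambda>x v. 0"]) (auto intro: Suc)
qed auto

lemma Ck_on_add: "open W \<Longrightarrow> Ck_on k W F \<Longrightarrow> Ck_on k W F' \<Longrightarrow> Ck_on k W (\<lambda>x. F x + F' x)"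
proof (induction k arbitrary: F F')
  case (Suc k)
  show ?case
    by (rule Ck_on_SucI[OF Suc.prems(1) has_derivative_add[OF Ck_on_Suc_deriv[OF Suc.prems(2)] Ck_on_Suc_deriv[OF Suc.prems(3)]]])
       (use Suc in auto)
qed (auto intro: continuous_intros)

lemma Ck_on_mult:
  fixes F F' :: "'e::euclidean_space \<Rightarrow> real"
  shows "open W \<Longrightarrow> Ck_on k W F \<Longrightarrow> Ck_on k W F' \<Longrightarrow> Ck_on k W (\<lambda>x. F x * F' x)"
proof (induction k arbitrary: F F')
  case (Suc k)
  show ?case
    by (rule Ck_on_SucI[OF Suc.prems(1) has_derivative_mult[OF Ck_on_Suc_deriv[OF Suc.prems(2)] Ck_on_Suc_deriv[OF Suc.prems(3)]]])
       (assumption | intro Ck_on_add Suc.IH Ck_on_Suc_imp[OF Suc.prems(2)] Ck_on_Suc_imp[OF Suc.prems(3)]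
          Ck_on_deriv[OF Suc.prems(2)] Ck_on_deriv[OF Suc.prems(3)] Suc.prems(1))+
qed (auto intro: continuous_intros)

text \<open>The derivative of the reciprocal contains the reciprocal again, but at stage
  \<open>Suc k\<close> only its class \<open>k\<close> is needed, so the induction closes.\<close>

lemma Ck_on_inverse:
  fixes F :: "'e::euclidean_space \<Rightarrow> real"
  shows "open W \<Longrightarrow> \<forall>x\<in>W. F x \<noteq> 0 \<Longrightarrow> Ck_on k W F \<Longrightarrow> Ck_on k W (\<lambda>x. inverse (F x))"
proof (induction k arbitrary: F)
  case (Suc k)
  show ?case
  proof (rule Ck_on_SucI[OF Suc.prems(1) Deriv.has_derivative_inverse[OF _ Ck_on_Suc_deriv[OF Suc.prems(3)]]])
    fix v
    have i: "Ck_on k W (\<lambda>x. inverse (F x))" and d: "Ck_on k W (\<lambda>x. frechet_derivative F (at x) v)"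
      using Suc.IH[OF Suc.prems(1,2)] Ck_on_Suc_imp[OF Suc.prems(3)] Ck_on_deriv[OF Suc.prems(3)] by blast+
    have "Ck_on k W (\<lambda>x. (-1) * (inverse (F x) * frechet_derivative F (at x) v * inverse (F x)))"
      by (intro Ck_on_mult Suc.prems(1) i d Ck_on_const)
    then show "Ck_on k W (\<lambda>x. - (inverse (F x) * frechet_derivative F (at x) v * inverse (F x)))"
      by simp
  qed (use Suc.prems in auto)
qed (auto intro: continuous_intros)

lemma Ck_on_bounded_linear: "bounded_linear L \<Longrightarrow> open W \<Longrightarrow> Ck_on k W F \<Longrightarrow> Ck_on k W (\<lambda>x. L (F x))"
proof (induction k arbitrary: F)
  case (Suc k)
  show ?case
    by (rule Ck_on_SucI[OF Suc.prems(2) bounded_linear.has_derivative[OF Suc.prems(1) Ck_on_Suc_deriv[OF Suc.prems(3)]]])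
       (use Suc in auto)
qed (auto intro: bounded_linear.continuous_on)

text \<open>Used with the projection \<open>snd\<close>, to regard a function of the space variable
  as one on space-time.\<close>

lemma Ck_on_compose_linear:
  fixes L :: "'e::euclidean_space \<Rightarrow> 'f::euclidean_space"
  shows "bounded_linear L \<Longrightarrow> open W \<Longrightarrow> Ck_on k W F \<Longrightarrow> Ck_on k (L -` W) (\<lambda>x. F (L x))"
proof (induction k arbitrary: F)
  case 0
  then show ?case
    by (auto intro!: continuous_on_compose2[of W F] simp: linear_continuous_on)
next
  case (Suc k)
  have "open (L -` W)"
    using Suc.prems by (auto intro!: open_vimage simp: linear_continuous_on)
  then show ?case
  proof (rule Ck_on_SucI)
    show "((\<lambda>x. F (L x)) has_derivative (\<lambda>v. frechet_derivative F (at (L x)) (L v))) (at x)" if "x \<in> L -` W" for x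
      using that
      by (intro has_derivative_compose[OF bounded_linear_imp_has_derivative[OF Suc.prems(1)]] Ck_on_Suc_deriv[OF Suc.prems(3)]) auto
  qed (use Suc in auto)
qed

section \<open>Symmetry of mixed second derivatives\<close>

lemma second_difference:
  fixes F :: "'e::euclidean_space \<Rightarrow> real"
  assumes h: "h > 0" and W: "\<And>s t. 0 \<le> s \<Longrightarrow> s \<le> h \<Longrightarrow> 0 \<le> t \<Longrightarrow> t \<le> h \<Longrightarrow> x + s *\<^sub>R a + t *\<^sub>R b \<in> W"
    and F: "Ck_on 2 W F"
  shows "\<exists>s t. 0 < s \<and> s < h \<and> 0 < t \<and> t < h \<and>
    F (x + h *\<^sub>R a + h *\<^sub>R b) - F (x + h *\<^sub>R a) - F (x + h *\<^sub>R b) + F x =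
    h * h * frechet_derivative (\<lambda>z. frechet_derivative F (at z) a) (at (x + s *\<^sub>R a + t *\<^sub>R b)) b"
proof -
  define A where "A z = frechet_derivative F (at z) a" for z
  have line: "((\<lambda>r. K (y + r *\<^sub>R v)) has_field_derivative frechet_derivative K (at (y + r *\<^sub>R v)) v) (at r)"
    if "K differentiable at (y + r *\<^sub>R v)" for K :: "'e \<Rightarrow> real" and y v r
  proof -
    have l: "((\<lambda>r. y + r *\<^sub>R v) has_derivative (\<lambda>q. q *\<^sub>R v)) (at r)"
      by (auto intro!: derivative_eq_intros)
    have "((\<lambda>r. K (y + r *\<^sub>R v)) has_derivative (\<lambda>q. frechet_derivative K (at (y + r *\<^sub>R v)) (q *\<^sub>R v))) (at r)"
      by (rule has_derivative_compose[OF l]) (use that in \<open>simp add: frechet_derivative_works\<close>)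
    moreover have "linear (frechet_derivative K (at (y + r *\<^sub>R v)))"
      using that by (rule linear_frechet_derivative)
    ultimately show ?thesis
      by (simp add: has_field_derivative_def linear_cmul mult.commute[of _ "frechet_derivative K _ v"])
  qed
  have dF: "F differentiable at z" and dA: "A differentiable at z" if "z \<in> W" for z
    using F that by (auto simp: numeral_2_eq_2 A_def[abs_def])
  \<comment> \<open>The increment in direction \<open>b\<close> becomes a function of the step in
    direction \<open>a\<close>. One mean value theorem for \<open>g\<close> and one for
    \<open>A\<close> then leave a single mixed derivative at an intermediate point.\<close>
  define g where "g s = F (x + h *\<^sub>R b + s *\<^sub>R a) - F (x + s *\<^sub>R a)" for s
  have "\<exists>s. 0 < s \<and> s < h \<and> g h - g 0 = (h - 0) * (A (x + h *\<^sub>R b + s *\<^sub>R a) - A (x + s *\<^sub>R a))"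
  proof (rule MVT2[OF h])
    fix s assume s: "0 \<le> s" "s \<le> h"
    have "x + h *\<^sub>R b + s *\<^sub>R a \<in> W" "x + s *\<^sub>R a \<in> W"
      using W[of s h] W[of s 0] s h by (auto simp: algebra_simps)
    then show "(g has_field_derivative A (x + h *\<^sub>R b + s *\<^sub>R a) - A (x + s *\<^sub>R a)) (at s)"
      unfolding g_def A_def by (intro DERIV_diff line dF)
  qed
  then obtain s where s: "0 < s" "s < h" and gs: "g h - g 0 = h * (A (x + h *\<^sub>R b + s *\<^sub>R a) - A (x + s *\<^sub>R a))"
    by auto
  have "\<exists>t. 0 < t \<and> t < h \<and> A (x + s *\<^sub>R a + h *\<^sub>R b) - A (x + s *\<^sub>R a + 0 *\<^sub>R b)
     = (h - 0) * frechet_derivative A (at (x + s *\<^sub>R a + t *\<^sub>R b)) b"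
    by (rule MVT2[OF h], rule line, rule dA, rule W) (use s in auto)
  then obtain t where t: "0 < t" "t < h" and "A (x + s *\<^sub>R a + h *\<^sub>R b) - A (x + s *\<^sub>R a)
     = h * frechet_derivative A (at (x + s *\<^sub>R a + t *\<^sub>R b)) b"
    by auto
  with gs have "g h - g 0 = h * (h * frechet_derivative A (at (x + s *\<^sub>R a + t *\<^sub>R b)) b)"
    by (simp add: algebra_simps)
  then show ?thesis
    using s t unfolding g_def A_def by (auto simp: algebra_simps)
qed

text \<open>The second difference is symmetric in the two directions, and divided by \<open>h\<^sup>2\<close> it converges to either
  mixed derivative.\<close>

lemma mixed_derivatives_commute:
  fixes F :: "'e::euclidean_space \<Rightarrow> real"
  assumes "open W" "x \<in> W" and F: "Ck_on 2 W F"
  shows "frechet_derivative (\<lambda>z. frechet_derivative F (at z) a) (at x) b =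
    frechet_derivative (\<lambda>z. frechet_derivative F (at z) b) (at x) a"
proof -
  define P where "P a b z = frechet_derivative (\<lambda>z. frechet_derivative F (at z) a) (at z) b" for a b z
  have cont: "continuous_on W (P a b)" for a b
    using F by (simp add: numeral_2_eq_2 P_def)
  have "\<bar>P a b x - P b a x\<bar> < e" if e: "e > 0" for e
  proof -
    have ev: "eventually (\<lambda>z. dist (P a b z) (P a b x) < e / 2) (at x)" for a b
      using cont assms e
      by (metis at_within_open continuous_on_def half_gt_zero tendstoD)
    from ev[of a b] ev[of b a] obtain d where d: "d > 0"
      "\<And>z. z \<noteq> x \<Longrightarrow> dist z x < d \<Longrightarrow> dist (P a b z) (P a b x) < e / 2"
      "\<And>z. z \<noteq> x \<Longrightarrow> dist z x < d \<Longrightarrow> dist (P b a z) (P b a x) < e / 2"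
      unfolding eventually_at by (metis (no_types, opaque_lifting) UNIV_I min_less_iff_conj)
    obtain r where r: "r > 0" "ball x r \<subseteq> W"
      using assms by (meson open_contains_ball)
    \<comment> \<open>Small enough that the parallelogram with sides \<open>h *\<^sub>R a\<close>
      and \<open>h *\<^sub>R b\<close> stays within \<open>min d r\<close> of \<open>x\<close>; the
      summand 1 keeps the denominator positive when both directions vanish.\<close>
    define h where "h = min d r / (1 + norm a + norm b)"
    have p: "1 + norm a + norm b > 0" by (simp add: add_pos_nonneg)
    have h: "h > 0" using d r p by (simp add: h_def)
    have near: "dist (x + s *\<^sub>R a + t *\<^sub>R b) x < min d r" if "0 \<le> s" "s \<le> h" "0 \<le> t" "t \<le> h" for s t
    proof -
      have "dist (x + s *\<^sub>R a + t *\<^sub>R b) x = norm (s *\<^sub>R a + t *\<^sub>R b)"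
        by (simp add: dist_norm)
      also have "\<dots> \<le> s * norm a + t * norm b"
        using norm_triangle_ineq[of "s *\<^sub>R a" "t *\<^sub>R b"] that by simp
      also have "\<dots> \<le> h * norm a + h * norm b"
        using that by (intro add_mono mult_right_mono) auto
      also have "\<dots> < h * (1 + norm a + norm b)"
        using h by (simp add: algebra_simps)
      also have "\<dots> = min d r" using p by (simp add: h_def)
      finally show ?thesis .
    qed
    have W: "x + s *\<^sub>R a + t *\<^sub>R b \<in> W" if "0 \<le> s" "s \<le> h" "0 \<le> t" "t \<le> h" for s t
      using near[OF that] r by (auto simp: dist_commute subset_eq)
    \<comment> \<open>The intermediate point may be \<open>x\<close> itself, which the punctured
      neighbourhood does not cover; there the difference is 0.\<close>
    have close: "\<bar>P a b y - P a b x\<bar> < e / 2" "\<bar>P b a y - P b a x\<bar> < e / 2"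
      if "y = x + s *\<^sub>R a + t *\<^sub>R b" "0 < s" "s < h" "0 < t" "t < h" for y s t
      using near[of s t] that d e by (cases "y = x"; force simp: dist_real_def)+
    obtain s t where st: "0 < s" "s < h" "0 < t" "t < h" and
      1: "F (x + h *\<^sub>R a + h *\<^sub>R b) - F (x + h *\<^sub>R a) - F (x + h *\<^sub>R b) + F x = h * h * P a b (x + s *\<^sub>R a + t *\<^sub>R b)"
      using second_difference[OF h W F] unfolding P_def by blast
    have W': "x + s *\<^sub>R b + t *\<^sub>R a \<in> W" if "0 \<le> s" "s \<le> h" "0 \<le> t" "t \<le> h" for s t
      using W[of t s] that by (simp add: algebra_simps)
    obtain s' t' where st': "0 < s'" "s' < h" "0 < t'" "t' < h" and
      2: "F (x + h *\<^sub>R b + h *\<^sub>R a) - F (x + h *\<^sub>R b) - F (x + h *\<^sub>R a) + F x = h * h * P b a (x + s' *\<^sub>R b + t' *\<^sub>R a)"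
      using second_difference[OF h W' F] unfolding P_def by blast
    have "h * h * P a b (x + s *\<^sub>R a + t *\<^sub>R b) = h * h * P b a (x + s' *\<^sub>R b + t' *\<^sub>R a)"
      unfolding 1[symmetric] 2[symmetric] by (simp add: algebra_simps)
    then have "P a b (x + s *\<^sub>R a + t *\<^sub>R b) = P b a (x + s' *\<^sub>R b + t' *\<^sub>R a)"
      using h by simp
    moreover have "x + s' *\<^sub>R b + t' *\<^sub>R a = x + t' *\<^sub>R a + s' *\<^sub>R b" by (simp add: algebra_simps)
    ultimately show ?thesis
      using close(1)[OF refl st] close(2)[OF refl st'(3,4,1,2)] by (simp add: abs_if split: if_splits)
  qed
  \<comment> \<open>With the difference itself as \<open>e\<close>, a nonzero difference would be
    smaller than itself.\<close>
  from this[of "\<bar>P a b x - P b a x\<bar>"] have "P a b x = P b a x"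
    by force
  then show ?thesis by (simp add: P_def)
qed

section \<open>Jets\<close>

text \<open>A jet lists the values of all iterated derivatives at a point, indexed by the list of
  directions of differentiation; the outermost derivative comes last.\<close>

typedef 'd jet = "{j :: 'd list \<Rightarrow> real. \<forall>xs a b ys. j (xs @ a # b # ys) = j (xs @ b # a # ys)}"
  morphisms jet_coeff Jet
  by (rule exI[of _ "\<lambda>_. 0"]) simp

setup_lifting type_definition_jet

text \<open>Each direction is handed to one of the two factors and the sum runs over all choices;
  the directions received by a factor keep their order.\<close>

primrec leibniz :: "'d list \<Rightarrow> ('d list \<Rightarrow> real) \<Rightarrow> ('d list \<Rightarrow> real) \<Rightarrow> real" where
  "leibniz [] j k = j [] * k []"
| "leibniz (d # xs) j k = leibniz xs (\<lambda>ys. j (d # ys)) k + leibniz xs j (\<lambda>ys. k (d # ys))"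

lemma leibniz_add_left: "leibniz xs (\<lambda>ys. j ys + j' ys) k = leibniz xs j k + leibniz xs j' k"
  by (induction xs arbitrary: j j' k) (simp_all add: algebra_simps)

lemma leibniz_commute: "leibniz xs j k = leibniz xs k j"
  by (induction xs arbitrary: j k) simp_all

lemma leibniz_add_right: "leibniz xs j (\<lambda>ys. k ys + k' ys) = leibniz xs j k + leibniz xs j k'"
  using leibniz_add_left[of xs k k' j] by (simp add: leibniz_commute)

lemma leibniz_assoc: "leibniz xs (\<lambda>ys. leibniz ys j k) l = leibniz xs j (\<lambda>ys. leibniz ys k l)"
  by (induction xs arbitrary: j k l) (simp_all add: leibniz_add_left leibniz_add_right)

lemma leibniz_0: "leibniz xs (\<lambda>_. 0) k = 0"
  by (induction xs arbitrary: k) simp_all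

lemma leibniz_1: "leibniz xs (\<lambda>ys. if ys = [] then 1 else 0) k = k xs"
  by (induction xs arbitrary: k) (simp_all add: leibniz_0)

text \<open>Of the four ways to distribute \<open>a\<close> and \<open>b\<close>, the two mixed ones
  trade places, and the other two are invariant by the symmetry of \<open>j\<close> or of
  \<open>k\<close>.\<close>

lemma leibniz_swap:
  assumes "\<And>xs a b ys. j (xs @ a # b # ys) = j (xs @ b # a # ys)"
    and "\<And>xs a b ys. k (xs @ a # b # ys) = k (xs @ b # a # ys)"
  shows "leibniz (xs @ a # b # ys) j k = leibniz (xs @ b # a # ys) j k"
  using assms
proof (induction xs arbitrary: j k)
  case Nil
  from Nil(1)[of "[]" a b] Nil(2)[of "[]" a b] show ?case
    by simp
next
  case (Cons d xs)
  have "j ((d # xs) @ a # b # ys) = j ((d # xs) @ b # a # ys)" for xs a b ys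
    by (rule Cons.prems)
  moreover have "k ((d # xs) @ a # b # ys) = k ((d # xs) @ b # a # ys)" for xs a b ys
    by (rule Cons.prems)
  ultimately show ?case
    using Cons.prems by (simp add: Cons.IH)
qed

instantiation jet :: (type) comm_ring_1
begin

lift_definition zero_jet :: "'a jet" is "\<lambda>_. 0" by simp
lift_definition one_jet :: "'a jet" is "\<lambda>xs. if xs = [] then 1 else 0" by simp
lift_definition plus_jet :: "'a jet \<Rightarrow> 'a jet \<Rightarrow> 'a jet" is "\<lambda>j k xs. j xs + k xs" by simp
lift_definition minus_jet :: "'a jet \<Rightarrow> 'a jet \<Rightarrow> 'a jet" is "\<lambda>j k xs. j xs - k xs" by simp
lift_definition uminus_jet :: "'a jet \<Rightarrow> 'a jet" is "\<lambda>j xs. - j xs" by simp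
lift_definition times_jet :: "'a jet \<Rightarrow> 'a jet \<Rightarrow> 'a jet" is "\<lambda>j k xs. leibniz xs j k"
  by (rule leibniz_swap) simp_all

instance
proof
  fix a b c :: "'a jet"
  show "a * b * c = a * (b * c)" by transfer (simp add: leibniz_assoc)
  show "a * b = b * a" by transfer (simp add: leibniz_commute)
  show "1 * a = a" by transfer (simp add: leibniz_1)
  show "(a + b) * c = a * c + b * c" by transfer (simp add: leibniz_add_left)
  show "(0::'a jet) \<noteq> 1" by transfer (metis zero_neq_one)
qed (transfer; simp add: fun_eq_iff)+

end

text \<open>The head of the index list is the innermost derivative, so differentiating the
  underlying function amounts to prefixing a direction.\<close>

lift_definition jet_deriv :: "'d \<Rightarrow> 'd jet \<Rightarrow> 'd jet" is "\<lambda>d j xs. j (d # xs)"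
  by (metis append_Cons)

lemma jet_deriv_commute: "jet_deriv a (jet_deriv b j) = jet_deriv b (jet_deriv a j)"
  by transfer (metis append_Nil)

lemma jet_deriv_add: "jet_deriv d (j + k) = jet_deriv d j + jet_deriv d k"
  by transfer simp

lemma jet_deriv_mult: "jet_deriv d (j * k) = jet_deriv d j * k + j * jet_deriv d k"
  by transfer simp

text \<open>The only property of jets, beyond a commutative ring with commuting derivations, on
  which the tensor calculation relies.\<close>

lemma jet_double_0: "j + j = 0 \<Longrightarrow> j = (0 :: 'd jet)"
  by transfer (simp add: fun_eq_iff)

definition jet_val :: "'d jet \<Rightarrow> real" where
  "jet_val j = jet_coeff j []"

section \<open>Smooth families of functions in a chart\<close>

text \<open>The direction \<open>None\<close> is time, \<open>Some i\<close> is the \<open>i\<close>-th coordinate.\<close>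

definition deriv_dir :: "'n::finite option \<Rightarrow> real \<times> (real ^ 'n)" where
  "deriv_dir d = (case d of None \<Rightarrow> (1, 0) | Some i \<Rightarrow> (0, axis i 1))"

definition family_deriv :: "real set \<Rightarrow> ('a, 'n::finite) chart \<Rightarrow> 'n option \<Rightarrow> (real \<Rightarrow> 'a \<Rightarrow> real) \<Rightarrow> real \<Rightarrow> 'a \<Rightarrow> real" where
  "family_deriv I c d u t p = (case d of None \<Rightarrow> time_deriv I (\<lambda>s. u s p) t | Some i \<Rightarrow> coord_deriv c i (u t) p)"

locale chart_time =
  fixes I :: "real set" and c :: "('a, 'n::finite) chart"
  assumes I: "is_interval I" "interior I \<noteq> {}"
    and V: "open (cmap c ` cdom c)" and inj: "inj_on (cmap c) (cdom c)"
begin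

lemma cmap_cinv: "y \<in> cmap c ` cdom c \<Longrightarrow> cmap c (cinv c y) = y"
  by (simp add: cinv_def f_inv_into_f)

lemma cinv_cmap: "p \<in> cdom c \<Longrightarrow> cinv c (cmap c p) = p"
  by (simp add: cinv_def inj)

lemma cinv_in: "y \<in> cmap c ` cdom c \<Longrightarrow> cinv c y \<in> cdom c"
  by (simp add: cinv_def inv_into_into)

text \<open>A nondegenerate interval accumulates at each of its points, so derivatives within it are
  unique even at an end point.\<close>

lemma at_within_I: "t \<in> I \<Longrightarrow> at t within I \<noteq> bot"
proof -
  assume "t \<in> I"
  have "\<not> (\<exists>x. I = {x})"
    using I(2) by auto
  then have "t islimpt I"
    using \<open>t \<in> I\<close> I(1) by (intro connected_imp_perfect) (auto simp: is_interval_connected_1)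
  then show ?thesis by (simp add: trivial_limit_within)
qed

text \<open>Calculus is done with \<open>F\<close> on the open set \<open>W\<close>, which may reach
  beyond the time interval; only the comparison with \<open>u\<close> is restricted to times in
  \<open>I\<close>.\<close>

definition ext_on :: "(real \<times> (real ^ 'n)) set \<Rightarrow> (real \<times> (real ^ 'n) \<Rightarrow> real) \<Rightarrow> (real \<Rightarrow> 'a \<Rightarrow> real) \<Rightarrow> bool" where
  "ext_on W F u \<longleftrightarrow> open W \<and> (\<forall>k. Ck_on k W F) \<and>
     (\<forall>t\<in>I. \<forall>y\<in>cmap c ` cdom c. (t, y) \<in> W \<longrightarrow> F (t, y) = u t (cinv c y))"

abbreviation sm :: "(real \<Rightarrow> 'a \<Rightarrow> real) \<Rightarrow> bool" where
  "sm \<equiv> smooth_family I c"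

lemma sm_iff: "sm u \<longleftrightarrow> (\<forall>t\<in>I. \<forall>p\<in>cdom c. \<exists>W F. (t, cmap c p) \<in> W \<and> ext_on W F u)"
proof -
  have e: "ext_on W F u \<longleftrightarrow> open W \<and> (\<forall>k. Ck_on k W F) \<and>
      (\<forall>z\<in>(I \<times> cmap c ` cdom c) \<inter> W. F z = (case z of (t, y) \<Rightarrow> u t (cinv c y)))" for W F
    unfolding ext_on_def by auto
  have "sm u \<longleftrightarrow> (\<forall>z\<in>I \<times> cmap c ` cdom c. \<exists>W F. z \<in> W \<and> ext_on W F u)"
    unfolding smooth_family_def smooth_on_def e by meson
  then show ?thesis by simp
qed

lemma smE:
  assumes "sm u" "t \<in> I" "p \<in> cdom c"
  obtains W F where "(t, cmap c p) \<in> W" "ext_on W F u"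
  using assms unfolding sm_iff by blast

lemma ext_on_differentiable: "ext_on W F u \<Longrightarrow> z \<in> W \<Longrightarrow> F differentiable (at z)"
  by (auto simp: ext_on_def dest: spec[of _ "Suc 0"])

lemma ext_on_val: "ext_on W F u \<Longrightarrow> t \<in> I \<Longrightarrow> p \<in> cdom c \<Longrightarrow> (t, cmap c p) \<in> W \<Longrightarrow> F (t, cmap c p) = u t p"
  by (auto simp: ext_on_def cinv_cmap)

text \<open>Although \<open>F\<close> is not unique outside \<open>I\<close>, these derivatives
  depend on \<open>u\<close> alone: the time derivative is determined within \<open>I\<close>, and
  at a fixed time the slice of \<open>W\<close> in the chart is open.\<close>

lemma family_deriv_ext_on:
  assumes e: "ext_on W F u" and t: "t \<in> I" and p: "p \<in> cdom c" and z: "(t, cmap c p) \<in> W"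
  shows "family_deriv I c d u t p = frechet_derivative F (at (t, cmap c p)) (deriv_dir d)"
proof -
  define F' where "F' = frechet_derivative F (at (t, cmap c p))"
  have F': "(F has_derivative F') (at (t, cmap c p))"
    using ext_on_differentiable[OF e z] by (simp add: F'_def frechet_derivative_works)
  have W: "open W" using e by (simp add: ext_on_def)
  have eq: "F (s, y) = u s (cinv c y)" if "s \<in> I" "y \<in> cmap c ` cdom c" "(s, y) \<in> W" for s y
    using e that unfolding ext_on_def by blast
  show ?thesis
  proof (cases d)
    case None
    have "((\<lambda>s. (s, cmap c p)) has_derivative (\<lambda>r. (r, 0))) (at t)"
      by (auto intro!: derivative_eq_intros)
    from has_derivative_compose[OF this F']
    have "((\<lambda>s. F (s, cmap c p)) has_derivative (\<lambda>r. F' (r, 0))) (at t within I)"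
      by (rule has_derivative_at_withinI)
    moreover have "(\<lambda>r. F' (r, 0)) = (\<lambda>r. r *\<^sub>R F' (1, 0))"
    proof
      show "F' (r, 0) = r *\<^sub>R F' (1, 0)" for r
        using linear_cmul[OF has_derivative_linear[OF F'], of r "(1, 0)"] by simp
    qed
    ultimately have D: "((\<lambda>s. F (s, cmap c p)) has_vector_derivative F' (1, 0)) (at t within I)"
      by (simp only: has_vector_derivative_def)
    have "open ((\<lambda>s. (s, cmap c p)) -` W)"
      by (intro open_vimage W continuous_intros)
    then obtain r where r: "r > 0" "\<And>s. dist s t < r \<Longrightarrow> (s, cmap c p) \<in> W"
      using z by (auto simp: open_dist)
    have "((\<lambda>s. u s p) has_vector_derivative F' (1, 0)) (at t within I)"
      by (rule has_vector_derivative_transform_within[OF D r(1) t])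
         (use r eq p in \<open>auto simp: cinv_cmap\<close>)
    then show ?thesis
      using None vector_derivative_within[OF at_within_I[OF t]]
      by (simp add: family_deriv_def time_deriv_def deriv_dir_def F'_def)
  next
    case (Some i)
    have "((\<lambda>y. (t, y)) has_derivative (\<lambda>v. (0, v))) (at (cmap c p))"
      by (auto intro!: derivative_eq_intros)
    from has_derivative_compose[OF this F']
    have D: "((\<lambda>y. F (t, y)) has_derivative (\<lambda>v. F' (0, v))) (at (cmap c p))" .
    have "open ((\<lambda>y. (t, y)) -` W \<inter> cmap c ` cdom c)"
      by (intro open_Int open_vimage W V continuous_intros)
    from has_derivative_transform_within_open[OF D this]
    have "((u t \<circ> cinv c) has_derivative (\<lambda>v. F' (0, v))) (at (cmap c p))"
      using z t p eq by auto
    then show ?thesis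
      using Some by (simp add: family_deriv_def coord_deriv_def deriv_dir_def F'_def flip: frechet_derivative_at)
  qed
qed

lemma ext_on_family_deriv:
  assumes e: "ext_on W F u"
  shows "ext_on W (\<lambda>z. frechet_derivative F (at z) (deriv_dir d)) (family_deriv I c d u)"
proof -
  have "Ck_on k W (\<lambda>z. frechet_derivative F (at z) (deriv_dir d))" for k
    using e by (auto simp: ext_on_def intro: Ck_on_deriv)
  moreover have "frechet_derivative F (at (t, y)) (deriv_dir d) = family_deriv I c d u t (cinv c y)"
    if "t \<in> I" "y \<in> cmap c ` cdom c" "(t, y) \<in> W" for t y
    using family_deriv_ext_on[OF e that(1) cinv_in[OF that(2)]] that by (simp add: cmap_cinv)
  ultimately show ?thesis
    using e by (simp add: ext_on_def)
qed

lemma sm_family_deriv: "sm u \<Longrightarrow> sm (family_deriv I c d u)"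
  unfolding sm_iff by (meson ext_on_family_deriv)

lemma sm_cong:
  assumes "sm u" "\<And>t p. t \<in> I \<Longrightarrow> p \<in> cdom c \<Longrightarrow> u t p = v t p"
  shows "sm v"
proof -
  have "ext_on W F u \<Longrightarrow> ext_on W F v" for W F
    using assms(2) cinv_in by (simp add: ext_on_def)
  then show ?thesis using assms(1) unfolding sm_iff by meson
qed

lemma family_deriv_cong:
  assumes u: "sm u" and uv: "\<And>t p. t \<in> I \<Longrightarrow> p \<in> cdom c \<Longrightarrow> u t p = v t p" and t: "t \<in> I" "p \<in> cdom c"
  shows "family_deriv I c d u t p = family_deriv I c d v t p"
proof -
  obtain W F where W: "(t, cmap c p) \<in> W" "ext_on W F u" using smE[OF u t] .
  then have "ext_on W F v" using uv cinv_in by (simp add: ext_on_def)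
  then show ?thesis using family_deriv_ext_on W t by metis
qed

section \<open>Closure properties of smooth families\<close>

lemma sm_binop:
  assumes u: "sm u" and v: "sm v"
    and C: "\<And>k (W :: (real \<times> (real ^ 'n)) set) F F'. open W \<Longrightarrow> Ck_on k W F \<Longrightarrow> Ck_on k W F' \<Longrightarrow> Ck_on k W (\<lambda>x. b (F x) (F' x))"
  shows "sm (\<lambda>t p. b (u t p) (v t p))"
  unfolding sm_iff
proof (intro ballI)
  fix t p assume t: "t \<in> I" "p \<in> cdom c"
  obtain W F where W: "(t, cmap c p) \<in> W" "ext_on W F u" using smE[OF u t] .
  obtain W' F' where W': "(t, cmap c p) \<in> W'" "ext_on W' F' v" using smE[OF v t] .
  have "Ck_on k (W \<inter> W') (\<lambda>x. b (F x) (F' x))" for k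
    using W W' by (intro C) (auto simp: ext_on_def intro: Ck_on_subset)
  then have "ext_on (W \<inter> W') (\<lambda>x. b (F x) (F' x)) (\<lambda>t p. b (u t p) (v t p))"
    using W W' by (auto simp: ext_on_def)
  then show "\<exists>W F. (t, cmap c p) \<in> W \<and> ext_on W F (\<lambda>t p. b (u t p) (v t p))"
    using W W' by blast
qed

lemma sm_const [simp]: "sm (\<lambda>t p. r)"
proof -
  have "ext_on UNIV (\<lambda>x. r) (\<lambda>t p. r)"
    by (simp add: ext_on_def Ck_on_const del: Ck_on.simps)
  then show ?thesis unfolding sm_iff by blast
qed

lemma sm_add [simp]: "sm u \<Longrightarrow> sm v \<Longrightarrow> sm (\<lambda>t p. u t p + v t p)"
  by (rule sm_binop[of _ _ "(+)"]) (auto intro: Ck_on_add)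

lemma sm_mult [simp]: "sm u \<Longrightarrow> sm v \<Longrightarrow> sm (\<lambda>t p. u t p * v t p)"
  by (rule sm_binop[of _ _ "(*)"]) (auto intro: Ck_on_mult)

lemma sm_minus [simp]: "sm u \<Longrightarrow> sm (\<lambda>t p. - u t p)"
  using sm_mult[OF sm_const[of "- 1"]] by simp

lemma sm_diff [simp]: "sm u \<Longrightarrow> sm v \<Longrightarrow> sm (\<lambda>t p. u t p - v t p)"
  using sm_add[OF _ sm_minus] by simp

lemma sm_sum [simp]: "(\<And>i. i \<in> S \<Longrightarrow> sm (u i)) \<Longrightarrow> sm (\<lambda>t p. \<Sum>i\<in>S. u i t p)"
  by (induction S rule: infinite_finite_induct) simp_all

lemma sm_prod [simp]: "(\<And>i. i \<in> S \<Longrightarrow> sm (u i)) \<Longrightarrow> sm (\<lambda>t p. \<Prod>i\<in>S. u i t p)"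
  by (induction S rule: infinite_finite_induct) simp_all

lemma sm_inverse:
  assumes u: "sm u" and nz: "\<And>t p. t \<in> I \<Longrightarrow> p \<in> cdom c \<Longrightarrow> u t p \<noteq> 0"
  shows "sm (\<lambda>t p. inverse (u t p))"
  unfolding sm_iff
proof (intro ballI)
  fix t p assume t: "t \<in> I" "p \<in> cdom c"
  obtain W F where W: "(t, cmap c p) \<in> W" "ext_on W F u" using smE[OF u t] .
  have "open W" "Ck_on 0 W F" using W by (auto simp: ext_on_def simp del: Ck_on.simps)
  \<comment> \<open>The extension may vanish away from the times in \<open>I\<close>, so its domain
    is first shrunk to the set where it is nonzero.\<close>
  then have o: "open (W \<inter> F -` (- {0}))"
    by (auto intro!: continuous_open_preimage)
  moreover have "Ck_on k (W \<inter> F -` (- {0})) (\<lambda>x. inverse (F x))" for k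
    using o W by (intro Ck_on_inverse) (auto simp: ext_on_def intro: Ck_on_subset)
  ultimately have "ext_on (W \<inter> F -` (- {0})) (\<lambda>x. inverse (F x)) (\<lambda>t p. inverse (u t p))"
    using W by (auto simp: ext_on_def)
  moreover have "F (t, cmap c p) \<noteq> 0"
    using ext_on_val[OF W(2) t W(1)] nz[OF t] by simp
  ultimately show "\<exists>W F. (t, cmap c p) \<in> W \<and> ext_on W F (\<lambda>t p. inverse (u t p))"
    using W(1) by (intro exI[of _ "W \<inter> F -` (- {0})"] exI[of _ "\<lambda>x. inverse (F x)"]) auto
qed

section \<open>Rules for first derivatives\<close>

lemma family_deriv_add:
  assumes u: "sm u" and v: "sm v" and t: "t \<in> I" "p \<in> cdom c"
  shows "family_deriv I c d (\<lambda>t p. u t p + v t p) t p = family_deriv I c d u t p + family_deriv I c d v t p"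
proof -
  obtain W F where W: "(t, cmap c p) \<in> W" "ext_on W F u" using smE[OF u t] .
  obtain W' F' where W': "(t, cmap c p) \<in> W'" "ext_on W' F' v" using smE[OF v t] .
  have "ext_on (W \<inter> W') (\<lambda>x. F x + F' x) (\<lambda>t p. u t p + v t p)"
    using W W' by (auto simp: ext_on_def intro!: Ck_on_add intro: Ck_on_subset)
  moreover have "((\<lambda>x. F x + F' x) has_derivative
      (\<lambda>v. frechet_derivative F (at (t, cmap c p)) v + frechet_derivative F' (at (t, cmap c p)) v)) (at (t, cmap c p))"
    using ext_on_differentiable W W' by (intro has_derivative_add) (auto simp flip: frechet_derivative_works)
  ultimately show ?thesis
    using W W' t by (simp add: family_deriv_ext_on flip: frechet_derivative_at)
qed

lemma family_deriv_mult:
  assumes u: "sm u" and v: "sm v" and t: "t \<in> I" "p \<in> cdom c"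
  shows "family_deriv I c d (\<lambda>t p. u t p * v t p) t p = family_deriv I c d u t p * v t p + u t p * family_deriv I c d v t p"
proof -
  obtain W F where W: "(t, cmap c p) \<in> W" "ext_on W F u" using smE[OF u t] .
  obtain W' F' where W': "(t, cmap c p) \<in> W'" "ext_on W' F' v" using smE[OF v t] .
  have "ext_on (W \<inter> W') (\<lambda>x. F x * F' x) (\<lambda>t p. u t p * v t p)"
    using W W' by (auto simp: ext_on_def intro!: Ck_on_mult intro: Ck_on_subset)
  moreover have "((\<lambda>x. F x * F' x) has_derivative
      (\<lambda>v. F (t, cmap c p) * frechet_derivative F' (at (t, cmap c p)) v + frechet_derivative F (at (t, cmap c p)) v * F' (t, cmap c p))) (at (t, cmap c p))"
    using ext_on_differentiable W W' by (intro has_derivative_mult) (auto simp flip: frechet_derivative_works)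
  ultimately show ?thesis
    using W W' t by (simp add: family_deriv_ext_on ext_on_val flip: frechet_derivative_at)
qed

lemma family_deriv_const: "t \<in> I \<Longrightarrow> p \<in> cdom c \<Longrightarrow> family_deriv I c d (\<lambda>t p. r) t p = 0"
proof -
  have "ext_on UNIV (\<lambda>x. r) (\<lambda>t p. r)"
    by (simp add: ext_on_def Ck_on_const del: Ck_on.simps)
  then show "t \<in> I \<Longrightarrow> p \<in> cdom c \<Longrightarrow> ?thesis" by (simp add: family_deriv_ext_on)
qed

text \<open>Symmetry is applied to the extension \<open>F\<close> on its open domain, which also
  covers end points of \<open>I\<close>.\<close>

lemma family_deriv_commute:
  assumes u: "sm u" and t: "t \<in> I" "p \<in> cdom c"
  shows "family_deriv I c d (family_deriv I c d' u) t p = family_deriv I c d' (family_deriv I c d u) t p"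
proof -
  obtain W F where W: "(t, cmap c p) \<in> W" "ext_on W F u" using smE[OF u t] .
  then have "open W" "Ck_on 2 W F" by (auto simp: ext_on_def simp del: Ck_on.simps)
  from mixed_derivatives_commute[OF this(1) W(1) this(2)] show ?thesis
    by (simp add: family_deriv_ext_on[OF ext_on_family_deriv[OF W(2)] t W(1)])
qed

section \<open>Iterated derivatives\<close>

primrec ders :: "'n option list \<Rightarrow> (real \<Rightarrow> 'a \<Rightarrow> real) \<Rightarrow> real \<Rightarrow> 'a \<Rightarrow> real" where
  "ders [] u = u"
| "ders (d # ds) u = ders ds (family_deriv I c d u)"

lemma ders_cong:
  assumes "sm u" "\<And>t p. t \<in> I \<Longrightarrow> p \<in> cdom c \<Longrightarrow> u t p = v t p" and t: "t \<in> I" "p \<in> cdom c"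
  shows "ders ds u t p = ders ds v t p"
  using assms(1,2)
proof (induction ds arbitrary: u v)
  case (Cons d ds)
  show ?case
    using Cons.prems by (simp, intro Cons.IH) (auto simp: sm_family_deriv intro: family_deriv_cong)
qed (use t in simp)

lemma ders_swap:
  assumes "sm u" and t: "t \<in> I" "p \<in> cdom c"
  shows "ders (xs @ a # b # ys) u t p = ders (xs @ b # a # ys) u t p"
  using assms(1)
proof (induction xs arbitrary: u)
  case Nil
  then show ?case by (simp, intro ders_cong t) (auto simp: sm_family_deriv intro: family_deriv_commute)
qed (simp add: sm_family_deriv)

lemma ders_add:
  assumes "sm u" "sm v" and t: "t \<in> I" "p \<in> cdom c"
  shows "ders ds (\<lambda>t p. u t p + v t p) t p = ders ds u t p + ders ds v t p"
  using assms(1,2)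
proof (induction ds arbitrary: u v)
  case (Cons d ds)
  have "ders ds (family_deriv I c d (\<lambda>t p. u t p + v t p)) t p = ders ds (\<lambda>t p. family_deriv I c d u t p + family_deriv I c d v t p) t p"
    using Cons.prems by (intro ders_cong t) (auto simp: sm_family_deriv intro: family_deriv_add)
  then show ?case using Cons by (simp add: sm_family_deriv)
qed simp

lemma ders_mult:
  assumes "sm u" "sm v" and t: "t \<in> I" "p \<in> cdom c"
  shows "ders ds (\<lambda>t p. u t p * v t p) t p = leibniz ds (\<lambda>ds. ders ds u t p) (\<lambda>ds. ders ds v t p)"
  using assms(1,2)
proof (induction ds arbitrary: u v)
  case (Cons d ds)
  have "ders ds (family_deriv I c d (\<lambda>t p. u t p * v t p)) t p =
      ders ds (\<lambda>t p. family_deriv I c d u t p * v t p + u t p * family_deriv I c d v t p) t p"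
    using Cons.prems by (intro ders_cong t) (auto simp: sm_family_deriv intro: family_deriv_mult)
  then show ?case using Cons by (simp add: sm_family_deriv ders_add t)
qed simp

lemma ders_const: "t \<in> I \<Longrightarrow> p \<in> cdom c \<Longrightarrow> ders ds (\<lambda>t p. r) t p = (if ds = [] then r else 0)"
proof (induction ds arbitrary: r)
  case (Cons d ds)
  have "ders ds (family_deriv I c d (\<lambda>t p. r)) t p = ders ds (\<lambda>t p. 0) t p"
    using Cons.prems by (intro ders_cong) (auto simp: sm_family_deriv intro: family_deriv_const)
  then show ?case using Cons by simp
qed simp

end

locale chart_time_point = chart_time I c for I and c :: "('a, 'n::finite) chart" +
  fixes t :: real and p :: 'a
  assumes t: "t \<in> I" and p: "p \<in> cdom c"
begin

text \<open>\<open>Jet\<close> is meaningful on symmetric coefficient families only, so the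
  coefficients of \<open>J u\<close> are known just for smooth \<open>u\<close>.\<close>

definition J :: "(real \<Rightarrow> 'a \<Rightarrow> real) \<Rightarrow> 'n option jet" where
  "J u = Jet (\<lambda>ds. ders ds u t p)"

lemma coeff_J: "sm u \<Longrightarrow> jet_coeff (J u) = (\<lambda>ds. ders ds u t p)"
  unfolding J_def by (rule Jet_inverse) (auto intro: ders_swap t p)

lemma J_eqI: "sm u \<Longrightarrow> (\<And>ds. ders ds u t p = jet_coeff j ds) \<Longrightarrow> J u = j"
  by (intro jet_coeff_inject[THEN iffD1] ext) (simp add: coeff_J)

lemma J_family_deriv: "sm u \<Longrightarrow> J (family_deriv I c d u) = jet_deriv d (J u)"
  by (rule J_eqI) (simp_all add: sm_family_deriv jet_deriv.rep_eq coeff_J)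

lemma J_add: "sm u \<Longrightarrow> sm v \<Longrightarrow> J (\<lambda>t p. u t p + v t p) = J u + J v"
  by (rule J_eqI) (simp_all add: plus_jet.rep_eq coeff_J ders_add t p)

lemma J_mult: "sm u \<Longrightarrow> sm v \<Longrightarrow> J (\<lambda>t p. u t p * v t p) = J u * J v"
  by (rule J_eqI) (simp_all add: times_jet.rep_eq coeff_J ders_mult t p)

lemma J_0: "J (\<lambda>t p. 0) = 0"
  by (rule J_eqI) (simp_all add: zero_jet.rep_eq ders_const t p)

lemma J_1: "J (\<lambda>t p. 1) = 1"
  by (rule J_eqI) (simp_all add: one_jet.rep_eq ders_const t p)

lemma J_minus: "sm u \<Longrightarrow> J (\<lambda>t p. - u t p) = - J u"
  using J_add[of u "\<lambda>t p. - u t p"] by (simp add: J_0 eq_neg_iff_add_eq_0 add.commute)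

lemma J_diff: "sm u \<Longrightarrow> sm v \<Longrightarrow> J (\<lambda>t p. u t p - v t p) = J u - J v"
  using J_add[of u "\<lambda>t p. - v t p"] by (simp add: J_minus)

lemma J_sum: "(\<And>i. i \<in> S \<Longrightarrow> sm (u i)) \<Longrightarrow> J (\<lambda>t p. \<Sum>i\<in>S. u i t p) = (\<Sum>i\<in>S. J (u i))"
  by (induction S rule: infinite_finite_induct) (simp_all add: J_0 J_add)

lemma J_of_nat: "J (\<lambda>t p. of_nat n) = of_nat n"
  by (induction n) (simp_all add: J_0 J_1 J_add)

lemma J_numeral: "J (\<lambda>t p. numeral n) = numeral n"
  using J_of_nat[of "numeral n"] by simp

text \<open>The gateway from geometry to the ring: an identity must hold on all of \<open>I\<close>
  and the chart, not only at the base point, since its derivatives are compared too.\<close>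

lemma J_cong: "sm u \<Longrightarrow> (\<And>t p. t \<in> I \<Longrightarrow> p \<in> cdom c \<Longrightarrow> u t p = v t p) \<Longrightarrow> J u = J v"
  unfolding J_def by (intro arg_cong[of _ _ Jet] ext ders_cong t p) auto

lemma jet_val_J: "sm u \<Longrightarrow> jet_val (J u) = u t p"
  by (simp add: jet_val_def coeff_J)

end

section \<open>Metrics over differential rings\<close>

definition derivation :: "('r::comm_ring_1 \<Rightarrow> 'r) \<Rightarrow> bool" where
  "derivation E \<longleftrightarrow> (\<forall>x y. E (x + y) = E x + E y \<and> E (x * y) = E x * y + x * E y)"

lemma derivation_add: "derivation E \<Longrightarrow> E (x + y) = E x + E y"
  and derivation_mult: "derivation E \<Longrightarrow> E (x * y) = E x * y + x * E y"
  by (auto simp: derivation_def)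

lemma derivation_0: "derivation E \<Longrightarrow> E 0 = 0"
  using derivation_add[of E 0 0] by simp

lemma derivation_1: "derivation E \<Longrightarrow> E 1 = 0"
  using derivation_mult[of E 1 1] by simp

lemma derivation_minus: "derivation E \<Longrightarrow> E (- x) = - E x"
  using derivation_add[of E x "- x"] by (simp add: derivation_0 add_eq_0_iff)

lemma derivation_diff: "derivation E \<Longrightarrow> E (x - y) = E x - E y"
  using derivation_add[of E x "- y"] by (simp add: derivation_minus)

lemma derivation_sum: "derivation E \<Longrightarrow> E (sum f S) = (\<Sum>i\<in>S. E (f i))"
  by (induction S rule: infinite_finite_induct) (simp_all add: derivation_0 derivation_add)

lemma derivation_of_nat: "derivation E \<Longrightarrow> E (of_nat n) = 0"
  by (induction n) (simp_all add: derivation_0 derivation_1 derivation_add)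

lemma derivation_numeral: "derivation E \<Longrightarrow> E (numeral n) = 0"
  using derivation_of_nat[of E "numeral n"] by simp

lemmas derivation_simps = derivation_0 derivation_1 derivation_add derivation_mult derivation_minus
  derivation_diff derivation_sum derivation_numeral

text \<open>\<open>Ch l i j\<close> stands for the Christoffel symbol with upper index \<open>l\<close>, and \<open>gi\<close> for the inverse
  metric.  Neither is given by a formula: symmetry and metric compatibility suffice, which avoids
  division.\<close>

locale metric_ring =
  fixes D :: "'n::finite \<Rightarrow> 'r::comm_ring_1 \<Rightarrow> 'r"
    and G gi :: "'n \<Rightarrow> 'n \<Rightarrow> 'r"
    and Ch :: "'n \<Rightarrow> 'n \<Rightarrow> 'n \<Rightarrow> 'r"
  assumes double_0: "\<And>x::'r. x + x = 0 \<Longrightarrow> x = 0"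
    and D_deriv: "derivation (D i)"
    and D_commute: "D i (D j x) = D j (D i x)"
    and G_sym: "G i j = G j i"
    and gi_sym: "gi i j = gi j i"
    and G_gi: "(\<Sum>j\<in>UNIV. G i j * gi j k) = (if i = k then 1 else 0)"
    and Ch_sym: "Ch k i j = Ch k j i"
    and D_G: "D k (G i j) = (\<Sum>l\<in>UNIV. Ch l k i * G l j) + (\<Sum>l\<in>UNIV. Ch l k j * G i l)"
begin

lemmas D_simps = derivation_simps[OF D_deriv]

lemma gi_G: "(\<Sum>j\<in>UNIV. gi i j * G j k) = (if i = k then 1 else 0)"
proof -
  have "(\<Sum>j\<in>UNIV. gi i j * G j k) = (\<Sum>j\<in>UNIV. G k j * gi j i)"
    by (simp add: G_sym[of k] gi_sym[of i] mult.commute)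
  then show ?thesis by (simp add: G_gi)
qed

lemma sum_delta:
  fixes f :: "'n \<Rightarrow> 'r"
  shows "(\<Sum>l\<in>UNIV. (if l = n then 1 else 0) * f l) = f n"
    "(\<Sum>l\<in>UNIV. (if n = l then 1 else 0) * f l) = f n"
    "(\<Sum>l\<in>UNIV. f l * (if l = n then 1 else 0)) = f n"
    "(\<Sum>l\<in>UNIV. f l * (if n = l then 1 else 0)) = f n"
  by (simp_all add: if_distrib if_distribR cong: if_cong)

lemma deriv_gi:
  assumes "derivation E"
  shows "E (gi i n) = - (\<Sum>j\<in>UNIV. \<Sum>m\<in>UNIV. gi i j * E (G j m) * gi m n)"
proof -
  note simps = derivation_simps[OF assms]
  have E0: "(\<Sum>j\<in>UNIV. E (gi i j) * G j m) = - (\<Sum>j\<in>UNIV. gi i j * E (G j m))" for m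
  proof -
    have "E (\<Sum>j\<in>UNIV. gi i j * G j m) = 0" by (simp only: gi_G) (simp add: simps)
    then show ?thesis by (simp add: simps sum.distrib add_eq_0_iff)
  qed
  have "E (gi i n) = (\<Sum>j\<in>UNIV. E (gi i j) * (if j = n then 1 else 0))"
    by (simp add: sum_delta)
  also have "\<dots> = (\<Sum>j\<in>UNIV. E (gi i j) * (\<Sum>m\<in>UNIV. G j m * gi m n))"
    by (simp only: G_gi)
  also have "\<dots> = (\<Sum>j\<in>UNIV. \<Sum>m\<in>UNIV. E (gi i j) * G j m * gi m n)"
    by (simp add: sum_distrib_left mult.assoc)
  also have "\<dots> = (\<Sum>m\<in>UNIV. (\<Sum>j\<in>UNIV. E (gi i j) * G j m) * gi m n)"
    by (subst sum.swap) (simp add: sum_distrib_right)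
  also have "\<dots> = - (\<Sum>m\<in>UNIV. \<Sum>j\<in>UNIV. gi i j * E (G j m) * gi m n)"
    by (simp add: E0 sum_distrib_right sum_negf)
  finally show ?thesis by (subst sum.swap)
qed

text \<open>The inverse metric is parallel: metric compatibility is inserted into
  \<open>deriv_gi\<close>, and each product of \<open>G\<close> with \<open>gi\<close> collapses to
  a Kronecker delta.\<close>

lemma D_gi: "D k (gi i n) = - (\<Sum>l\<in>UNIV. Ch i k l * gi l n) - (\<Sum>l\<in>UNIV. Ch n k l * gi i l)"
proof -
  have "(\<Sum>j\<in>UNIV. \<Sum>m\<in>UNIV. gi i j * (\<Sum>l\<in>UNIV. Ch l k j * G l m) * gi m n)
      = (\<Sum>j\<in>UNIV. \<Sum>m\<in>UNIV. \<Sum>l\<in>UNIV. gi i j * Ch l k j * (G l m * gi m n))"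
    by (simp add: sum_distrib_left sum_distrib_right mult.assoc)
  also have "\<dots> = (\<Sum>j\<in>UNIV. \<Sum>l\<in>UNIV. gi i j * Ch l k j * (\<Sum>m\<in>UNIV. G l m * gi m n))"
    by (rule sum.cong[OF refl], subst sum.swap) (simp add: sum_distrib_left)
  also have "\<dots> = (\<Sum>j\<in>UNIV. gi i j * Ch n k j)"
    by (simp only: G_gi sum_delta)
  finally have 1: "(\<Sum>j\<in>UNIV. \<Sum>m\<in>UNIV. gi i j * (\<Sum>l\<in>UNIV. Ch l k j * G l m) * gi m n)
      = (\<Sum>l\<in>UNIV. Ch n k l * gi i l)" by (simp add: mult.commute)
  have "(\<Sum>j\<in>UNIV. \<Sum>m\<in>UNIV. gi i j * (\<Sum>l\<in>UNIV. Ch l k m * G j l) * gi m n)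
      = (\<Sum>j\<in>UNIV. \<Sum>m\<in>UNIV. \<Sum>l\<in>UNIV. (gi i j * G j l) * (Ch l k m * gi m n))"
    by (simp add: sum_distrib_left sum_distrib_right mult.assoc mult.left_commute)
  also have "\<dots> = (\<Sum>m\<in>UNIV. \<Sum>j\<in>UNIV. \<Sum>l\<in>UNIV. (gi i j * G j l) * (Ch l k m * gi m n))"
    by (rule sum.swap)
  also have "\<dots> = (\<Sum>m\<in>UNIV. \<Sum>l\<in>UNIV. (\<Sum>j\<in>UNIV. gi i j * G j l) * (Ch l k m * gi m n))"
    by (rule sum.cong[OF refl], subst sum.swap) (simp add: sum_distrib_right)
  also have "\<dots> = (\<Sum>m\<in>UNIV. Ch i k m * gi m n)"
    by (simp only: gi_G sum_delta)
  finally show ?thesis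
    using 1 by (simp add: deriv_gi[OF D_deriv] D_G distrib_left distrib_right sum.distrib)
qed

section \<open>Traces and the Christoffel term of a single index\<close>

definition tr :: "('n \<Rightarrow> 'n \<Rightarrow> 'r) \<Rightarrow> 'r" where
  "tr F = (\<Sum>i\<in>UNIV. \<Sum>j\<in>UNIV. gi i j * F i j)"

text \<open>The Christoffel term of \<open>\<nabla>\<^sub>k\<close> for a single lower index.  The remaining indices of a tensor are
  treated as parameters, so that the covariant derivatives below are \<open>D\<close> minus one such term per index.\<close>

definition low :: "'n \<Rightarrow> ('n \<Rightarrow> 'r) \<Rightarrow> 'n \<Rightarrow> 'r" where
  "low k \<alpha> j = (\<Sum>l\<in>UNIV. Ch l k j * \<alpha> l)"

lemma tr_add: "tr (\<lambda>i j. F i j + F' i j) = tr F + tr F'"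
  by (simp add: tr_def distrib_left sum.distrib)

lemma tr_diff: "tr (\<lambda>i j. F i j - F' i j) = tr F - tr F'"
  by (simp add: tr_def right_diff_distrib sum_subtractf)

lemma tr_minus: "tr (\<lambda>i j. - F i j) = - tr F"
  by (simp add: tr_def sum_negf)

lemma tr_0 [simp]: "tr (\<lambda>i j. 0) = 0"
  by (simp add: tr_def)

lemma tr_mult_left: "tr (\<lambda>i j. c * F i j) = c * tr F"
  by (simp add: tr_def sum_distrib_left mult.left_commute)

lemma tr_mult_right: "tr (\<lambda>i j. F i j * c) = tr F * c"
  by (simp add: tr_def sum_distrib_right mult.assoc)

lemma tr_sum: "tr (\<lambda>i j. \<Sum>k\<in>S. F k i j) = (\<Sum>k\<in>S. tr (F k))"
  by (induction S rule: infinite_finite_induct) (simp_all add: tr_add)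

lemma tr_swap: "tr (\<lambda>i j. F j i) = tr F"
  unfolding tr_def by (subst sum.swap) (simp add: gi_sym)

lemma tr_tr: "tr (\<lambda>i j. tr (\<lambda>k l. F i j k l)) = tr (\<lambda>k l. tr (\<lambda>i j. F i j k l))"
proof -
  have "tr (\<lambda>i j. tr (\<lambda>k l. F i j k l)) = (\<Sum>k\<in>UNIV. \<Sum>l\<in>UNIV. tr (\<lambda>i j. gi k l * F i j k l))"
    unfolding tr_def[of "\<lambda>k l. F _ _ k l"] by (simp add: tr_sum)
  also have "\<dots> = tr (\<lambda>k l. tr (\<lambda>i j. F i j k l))"
    by (simp only: tr_mult_left) (simp only: tr_def[of "\<lambda>k l. tr (\<lambda>i j. F i j k l)"])
  finally show ?thesis .
qed

lemma low_add: "low k (\<lambda>a. \<alpha> a + \<beta> a) j = low k \<alpha> j + low k \<beta> j"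
  by (simp add: low_def distrib_left sum.distrib)

lemma low_diff: "low k (\<lambda>a. \<alpha> a - \<beta> a) j = low k \<alpha> j - low k \<beta> j"
  by (simp add: low_def right_diff_distrib sum_subtractf)

lemma low_minus: "low k (\<lambda>a. - \<alpha> a) j = - low k \<alpha> j"
  by (simp add: low_def sum_negf)

lemma low_mult_left: "low k (\<lambda>a. c * \<alpha> a) j = c * low k \<alpha> j"
  by (simp add: low_def sum_distrib_left mult.left_commute)

lemma low_mult_right: "low k (\<lambda>a. \<alpha> a * c) j = low k \<alpha> j * c"
  by (simp add: low_def sum_distrib_right mult.assoc)

lemma low_tr: "low k (\<lambda>a. tr (\<lambda>i j. F a i j)) m = tr (\<lambda>i j. low k (\<lambda>a. F a i j) m)"
  unfolding low_def by (simp add: tr_sum tr_mult_left)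

lemmas tr_simps = tr_add tr_diff tr_minus tr_mult_left tr_mult_right
lemmas low_simps = low_add low_diff low_minus low_mult_left low_mult_right low_tr

lemma deriv_tr:
  assumes "derivation E"
  shows "E (tr F) = tr (\<lambda>i j. E (F i j)) - tr (\<lambda>i a. tr (\<lambda>j b. E (G a b) * F i j))"
proof -
  have "tr (\<lambda>i a. tr (\<lambda>j b. E (G a b) * F i j))
      = (\<Sum>i\<in>UNIV. \<Sum>a\<in>UNIV. \<Sum>j\<in>UNIV. \<Sum>b\<in>UNIV. gi i a * E (G a b) * gi b j * F i j)"
    by (simp add: tr_def sum_distrib_left ac_simps gi_sym)
  also have "\<dots> = (\<Sum>i\<in>UNIV. \<Sum>j\<in>UNIV. \<Sum>a\<in>UNIV. \<Sum>b\<in>UNIV. gi i a * E (G a b) * gi b j * F i j)"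
    by (intro sum.cong refl sum.swap)
  also have "\<dots> = (\<Sum>i\<in>UNIV. \<Sum>j\<in>UNIV. - E (gi i j) * F i j)"
    by (simp add: deriv_gi[OF assms] sum_distrib_right)
  finally show ?thesis
    by (simp add: tr_def derivation_simps[OF assms] sum.distrib sum_negf)
qed

text \<open>Because the inverse metric is parallel, its Christoffel terms migrate to the two
  contracted slots. Nothing is demanded of further indices that \<open>F\<close> carries as
  parameters.\<close>

lemma D_tr: "D k (tr F) = tr (\<lambda>i j. D k (F i j) - low k (\<lambda>a. F a j) i - low k (F i) j)"
proof -
  have 1: "(\<Sum>i\<in>UNIV. \<Sum>j\<in>UNIV. (\<Sum>l\<in>UNIV. Ch i k l * gi l j) * F i j) = tr (\<lambda>i j. low k (\<lambda>a. F a j) i)"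
  proof -
    have "(\<Sum>i\<in>UNIV. \<Sum>j\<in>UNIV. (\<Sum>l\<in>UNIV. Ch i k l * gi l j) * F i j)
        = (\<Sum>j\<in>UNIV. \<Sum>i\<in>UNIV. \<Sum>l\<in>UNIV. Ch i k l * gi l j * F i j)"
      by (subst sum.swap) (simp add: sum_distrib_right)
    also have "\<dots> = (\<Sum>j\<in>UNIV. \<Sum>l\<in>UNIV. \<Sum>i\<in>UNIV. Ch i k l * gi l j * F i j)"
      by (intro sum.cong refl sum.swap)
    also have "\<dots> = tr (\<lambda>i j. low k (\<lambda>a. F a j) i)"
      unfolding tr_def low_def
      by (subst sum.swap) (simp add: sum_distrib_left mult.assoc mult.left_commute)
    finally show ?thesis .
  qed
  have 2: "(\<Sum>i\<in>UNIV. \<Sum>j\<in>UNIV. (\<Sum>l\<in>UNIV. Ch j k l * gi i l) * F i j) = tr (\<lambda>i j. low k (F i) j)"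
  proof -
    have "(\<Sum>i\<in>UNIV. \<Sum>j\<in>UNIV. (\<Sum>l\<in>UNIV. Ch j k l * gi i l) * F i j)
        = (\<Sum>i\<in>UNIV. \<Sum>j\<in>UNIV. \<Sum>l\<in>UNIV. Ch j k l * gi i l * F i j)"
      by (simp add: sum_distrib_right)
    also have "\<dots> = (\<Sum>i\<in>UNIV. \<Sum>l\<in>UNIV. \<Sum>j\<in>UNIV. Ch j k l * gi i l * F i j)"
      by (intro sum.cong refl sum.swap)
    also have "\<dots> = tr (\<lambda>i j. low k (F i) j)"
      unfolding tr_def low_def
      by (simp add: sum_distrib_left mult.assoc mult.left_commute)
    finally show ?thesis .
  qed
  have "D k (tr F) = (\<Sum>i\<in>UNIV. \<Sum>j\<in>UNIV. D k (gi i j) * F i j) + tr (\<lambda>i j. D k (F i j))"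
    by (simp add: tr_def D_simps sum.distrib)
  also have "(\<Sum>i\<in>UNIV. \<Sum>j\<in>UNIV. D k (gi i j) * F i j) =
     - tr (\<lambda>i j. low k (\<lambda>a. F a j) i) - tr (\<lambda>i j. low k (F i) j)"
    unfolding 1[symmetric] 2[symmetric] by (simp add: D_gi left_diff_distrib sum_subtractf sum_negf)
  finally show ?thesis by (simp add: tr_diff)
qed

section \<open>Covariant derivatives and divergences\<close>

definition cov1 :: "'n \<Rightarrow> ('n \<Rightarrow> 'r) \<Rightarrow> 'n \<Rightarrow> 'r" where
  "cov1 k \<alpha> i = D k (\<alpha> i) - low k \<alpha> i"

definition cov2 :: "'n \<Rightarrow> ('n \<Rightarrow> 'n \<Rightarrow> 'r) \<Rightarrow> 'n \<Rightarrow> 'n \<Rightarrow> 'r" where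
  "cov2 k B i j = D k (B i j) - low k (\<lambda>a. B a j) i - low k (\<lambda>b. B i b) j"

definition cov3 :: "'n \<Rightarrow> ('n \<Rightarrow> 'n \<Rightarrow> 'n \<Rightarrow> 'r) \<Rightarrow> 'n \<Rightarrow> 'n \<Rightarrow> 'n \<Rightarrow> 'r" where
  "cov3 k C i j l = D k (C i j l) - low k (\<lambda>a. C a j l) i - low k (\<lambda>b. C i b l) j - low k (\<lambda>b. C i j b) l"

lemma D_tr_cov2: "D k (tr B) = tr (cov2 k B)"
  by (simp add: D_tr cov2_def[abs_def])

lemma cov1_tr: "cov1 k (\<lambda>c. tr (\<lambda>i j. C c i j)) c = tr (\<lambda>i j. cov3 k C c i j)"
  by (simp add: cov1_def cov3_def D_tr low_tr tr_diff)

definition inner2 :: "('n \<Rightarrow> 'n \<Rightarrow> 'r) \<Rightarrow> ('n \<Rightarrow> 'n \<Rightarrow> 'r) \<Rightarrow> 'r" where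
  "inner2 S T = tr (\<lambda>i k. tr (\<lambda>j l. S i j * T k l))"

definition lap :: "'r \<Rightarrow> 'r" where
  "lap u = tr (\<lambda>i j. cov1 i (\<lambda>j. D j u) j)"

definition div2 :: "('n \<Rightarrow> 'n \<Rightarrow> 'r) \<Rightarrow> 'n \<Rightarrow> 'r" where
  "div2 B j = tr (\<lambda>k l. cov2 k B l j)"

definition div1 :: "('n \<Rightarrow> 'r) \<Rightarrow> 'r" where
  "div1 \<alpha> = tr (\<lambda>i j. cov1 i \<alpha> j)"

section \<open>Curvature and the Bianchi identities\<close>

definition riem :: "'n \<Rightarrow> 'n \<Rightarrow> 'n \<Rightarrow> 'n \<Rightarrow> 'r" where
  "riem l i j k = D i (Ch l j k) - D j (Ch l i k) + (\<Sum>m\<in>UNIV. Ch l i m * Ch m j k - Ch l j m * Ch m i k)"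

definition ric :: "'n \<Rightarrow> 'n \<Rightarrow> 'r" where
  "ric j k = (\<Sum>l\<in>UNIV. riem l l j k)"

definition sc :: 'r where
  "sc = tr ric"

lemma tr_alt: "tr F = (\<Sum>i\<in>UNIV. \<Sum>j\<in>UNIV. F i j * gi i j)"
  by (simp add: tr_def mult.commute)

text \<open>The left-hand side is the divergence of the vector field dual to \<open>\<alpha>\<close>.\<close>

lemma div_raise:
  "(\<Sum>i\<in>UNIV. D i (\<Sum>a\<in>UNIV. gi i a * \<alpha> a)) + (\<Sum>i\<in>UNIV. \<Sum>b\<in>UNIV. Ch i i b * (\<Sum>a\<in>UNIV. gi b a * \<alpha> a))
     = div1 \<alpha>"
proof -
  have "(\<Sum>i\<in>UNIV. \<Sum>a\<in>UNIV. (\<Sum>l\<in>UNIV. Ch i i l * gi l a) * \<alpha> a)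
      = (\<Sum>i\<in>UNIV. \<Sum>a\<in>UNIV. \<Sum>b\<in>UNIV. Ch i i b * gi b a * \<alpha> a)"
    by (simp add: sum_distrib_right)
  also have "\<dots> = (\<Sum>i\<in>UNIV. \<Sum>b\<in>UNIV. \<Sum>a\<in>UNIV. Ch i i b * gi b a * \<alpha> a)"
    by (intro sum.cong[OF refl] sum.swap)
  finally have 1: "(\<Sum>i\<in>UNIV. \<Sum>b\<in>UNIV. Ch i i b * (\<Sum>a\<in>UNIV. gi b a * \<alpha> a))
      = (\<Sum>i\<in>UNIV. \<Sum>a\<in>UNIV. (\<Sum>l\<in>UNIV. Ch i i l * gi l a) * \<alpha> a)"
    by (simp add: sum_distrib_left mult.assoc)
  have "(\<Sum>i\<in>UNIV. \<Sum>a\<in>UNIV. (\<Sum>l\<in>UNIV. Ch a i l * gi i l) * \<alpha> a)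
      = (\<Sum>i\<in>UNIV. \<Sum>a\<in>UNIV. \<Sum>l\<in>UNIV. gi i l * (Ch a i l * \<alpha> a))"
    unfolding sum_distrib_right by (simp add: ac_simps)
  also have "\<dots> = (\<Sum>i\<in>UNIV. \<Sum>l\<in>UNIV. \<Sum>a\<in>UNIV. gi i l * (Ch a i l * \<alpha> a))"
    by (intro sum.cong[OF refl] sum.swap)
  also have "\<dots> = tr (\<lambda>i l. low i \<alpha> l)"
    by (simp add: tr_def low_def sum_distrib_left)
  finally have 2: "(\<Sum>i\<in>UNIV. \<Sum>a\<in>UNIV. (\<Sum>l\<in>UNIV. Ch a i l * gi i l) * \<alpha> a) = tr (\<lambda>i l. low i \<alpha> l)" .
  have 3: "(\<Sum>i\<in>UNIV. D i (\<Sum>a\<in>UNIV. gi i a * \<alpha> a)) =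
     (\<Sum>i\<in>UNIV. \<Sum>a\<in>UNIV. D i (gi i a) * \<alpha> a) + tr (\<lambda>i a. D i (\<alpha> a))"
    by (simp add: D_simps tr_def sum.distrib)
  have 4: "(\<Sum>i\<in>UNIV. \<Sum>a\<in>UNIV. D i (gi i a) * \<alpha> a) =
     - (\<Sum>i\<in>UNIV. \<Sum>a\<in>UNIV. (\<Sum>l\<in>UNIV. Ch i i l * gi l a) * \<alpha> a) - tr (\<lambda>i l. low i \<alpha> l)"
    unfolding 2[symmetric] by (simp add: D_gi left_diff_distrib sum_subtractf sum_negf)
  show ?thesis
    by (simp only: 1 3 4) (simp add: div1_def cov1_def tr_diff)
qed

lemma riem_antisym: "riem l i j k = - riem l j i k"
  by (simp add: riem_def sum_subtractf)

lemma first_Bianchi: "riem l i j k + riem l j k i + riem l k i j = 0"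
  by (simp add: riem_def sum_subtractf Ch_sym)

text \<open>The Ricci identity for one-forms. Christoffel terms pairing \<open>i\<close> with
  \<open>j\<close> are symmetric since the connection is torsion-free; only those acting on
  \<open>k\<close> survive the antisymmetrization.\<close>

lemma cov_commutator:
  "cov2 i (\<lambda>j k. cov1 j \<alpha> k) j k - cov2 j (\<lambda>j k. cov1 j \<alpha> k) i k = - (\<Sum>l\<in>UNIV. riem l i j k * \<alpha> l)"
proof -
  have sw: "low i (\<lambda>a. low j \<alpha> a) k = (\<Sum>l\<in>UNIV. \<Sum>m\<in>UNIV. Ch l j m * Ch m i k * \<alpha> l)" for i j
    unfolding low_def by (subst sum.swap) (simp add: sum_distrib_left ac_simps)
  have *: "(\<Sum>l\<in>UNIV. riem l i j k * \<alpha> l) = (\<Sum>l\<in>UNIV. D i (Ch l j k) * \<alpha> l) - (\<Sum>l\<in>UNIV. D j (Ch l i k) * \<alpha> l)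
      + low j (\<lambda>a. low i \<alpha> a) k - low i (\<lambda>a. low j \<alpha> a) k"
    unfolding sw
    by (simp add: riem_def sum_distrib_right left_diff_distrib distrib_right sum.distrib sum_subtractf)
  have s: "low i (\<lambda>a. D a (\<alpha> k)) j = low j (\<lambda>a. D a (\<alpha> k)) i"
    "low i (\<lambda>a. low a \<alpha> k) j = low j (\<lambda>a. low a \<alpha> k) i"
    by (simp_all add: low_def Ch_sym)
  have d: "D i (low j \<alpha> k) = (\<Sum>l\<in>UNIV. D i (Ch l j k) * \<alpha> l) + low j (\<lambda>a. D i (\<alpha> a)) k" for i j
    by (simp add: low_def D_simps sum.distrib)
  show ?thesis unfolding *
    by (simp add: cov2_def cov1_def D_simps low_diff d s D_commute[of i])
qed

text \<open>Meant for Christoffel symbols with the form index frozen: the upper index numbers the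
  rows, the last lower index the columns.\<close>

definition mat_mult :: "('n \<Rightarrow> 'n \<Rightarrow> 'r) \<Rightarrow> ('n \<Rightarrow> 'n \<Rightarrow> 'r) \<Rightarrow> 'n \<Rightarrow> 'n \<Rightarrow> 'r" where
  "mat_mult X Y l k = (\<Sum>a\<in>UNIV. X l a * Y a k)"

lemma mat_mult_linear:
  "mat_mult (\<lambda>l k. X l k + X' l k) Y l k = mat_mult X Y l k + mat_mult X' Y l k"
  "mat_mult (\<lambda>l k. X l k - X' l k) Y l k = mat_mult X Y l k - mat_mult X' Y l k"
  "mat_mult X (\<lambda>l k. Y l k + Y' l k) l k = mat_mult X Y l k + mat_mult X Y' l k"
  "mat_mult X (\<lambda>l k. Y l k - Y' l k) l k = mat_mult X Y l k - mat_mult X Y' l k"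
  by (simp_all add: mat_mult_def algebra_simps sum.distrib sum_subtractf)

lemma mat_mult_assoc: "mat_mult (mat_mult X Y) Z l k = mat_mult X (mat_mult Y Z) l k"
  unfolding mat_mult_def
  by (simp add: sum_distrib_left sum_distrib_right mult.assoc) (rule sum.swap)

lemma D_mat_mult: "D i (mat_mult X Y l k) = mat_mult (\<lambda>l k. D i (X l k)) Y l k + mat_mult X (\<lambda>l k. D i (Y l k)) l k"
  by (simp add: mat_mult_def D_simps sum.distrib)

text \<open>In matrix notation \<open>riem\<close> is the curvature \<open>D\<^sub>iA\<^sub>j - D\<^sub>jA\<^sub>i + [A\<^sub>i, A\<^sub>j]\<close> of the connection \<open>A\<close>.  The
  Christoffel terms of the three differential form indices are absent from \<open>S\<close> because they cancel
  in the cyclic sum.\<close>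

lemma second_Bianchi:
  fixes m i j l k
  defines "S \<equiv> \<lambda>m i j. D m (riem l i j k) + (\<Sum>a\<in>UNIV. Ch l m a * riem a i j k) - low m (\<lambda>a. riem l i j a) k"
  shows "S m i j + S i j m + S j m i = 0"
proof -
  define A where "A = (\<lambda>i l k. Ch l i k)"
  have F: "riem = (\<lambda>l i j k. D i (A j l k) - D j (A i l k) + (mat_mult (A i) (A j) l k - mat_mult (A j) (A i) l k))"
    by (simp add: riem_def A_def mat_mult_def sum_subtractf fun_eq_iff)
  have S: "S m i j = D m (riem l i j k) + (mat_mult (A m) (\<lambda>l k. riem l i j k) l k - mat_mult (\<lambda>l k. riem l i j k) (A m) l k)" for m i j
    by (simp add: S_def A_def mat_mult_def low_def mult.commute)
  show ?thesis
    unfolding S F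
    \<comment> \<open>The instances of \<open>D_commute\<close> sort second derivatives into the
      order \<open>m\<close>, \<open>i\<close>, \<open>j\<close>, so that they cancel; the triple
      products cancel by associativity.\<close>
    by (simp add: mat_mult_linear mat_mult_assoc D_mat_mult D_simps D_commute[of j] D_commute[of i m] algebra_simps)
qed

text \<open>Obtained by antisymmetrizing \<open>D\<^sub>i (D\<^sub>j G)\<close>, with \<open>D G\<close> expressed by the Christoffel symbols.\<close>

lemma riem_metric_lower: "(\<Sum>m\<in>UNIV. riem m i j k * G m l) = - (\<Sum>m\<in>UNIV. riem m i j l * G m k)"
proof -
  define P where "P i j k l = (\<Sum>m\<in>UNIV. D i (Ch m j k) * G m l) + (\<Sum>n\<in>UNIV. \<Sum>m\<in>UNIV. Ch n i m * Ch m j k * G n l)" for i j k l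
  \<comment> \<open>The cross terms, with one Christoffel symbol attached to \<open>k\<close> and
    the other to \<open>l\<close>. Exchanging \<open>i\<close> with \<open>j\<close> and
    \<open>k\<close> with \<open>l\<close> preserves them, so they drop out of the
    antisymmetrization.\<close>
  define X where "X i j k l = (\<Sum>m\<in>UNIV. \<Sum>n\<in>UNIV. Ch m j k * Ch n i l * G n m)" for i j k l
  have X: "X i j k l = X j i l k" for i j k l
    unfolding X_def by (subst sum.swap) (simp add: G_sym ac_simps)
  have R: "(\<Sum>m\<in>UNIV. riem m i j k * G m l) = P i j k l - P j i k l" for i j k l
    by (simp add: P_def riem_def sum_distrib_right distrib_right left_diff_distrib sum.distrib sum_subtractf)
  have Q: "(\<Sum>m\<in>UNIV. Ch m j k * D i (G m l)) = (\<Sum>n\<in>UNIV. \<Sum>m\<in>UNIV. Ch n i m * Ch m j k * G n l) + X i j k l" for i j k l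
  proof -
    have "(\<Sum>m\<in>UNIV. Ch m j k * D i (G m l)) = (\<Sum>m\<in>UNIV. \<Sum>n\<in>UNIV. Ch n i m * Ch m j k * G n l) + X i j k l"
      by (simp add: D_G X_def distrib_left sum.distrib sum_distrib_left ac_simps G_sym)
    then show ?thesis by (subst sum.swap)
  qed
  have DG: "D j (G k l) = (\<Sum>m\<in>UNIV. Ch m j k * G m l) + (\<Sum>m\<in>UNIV. Ch m j l * G m k)" for j k l
    by (simp add: D_G G_sym)
  have "D i (D j (G k l)) = P i j k l + X i j k l + (P i j l k + X i j l k)" for i j
    by (simp add: DG[of j] D_simps sum.distrib Q P_def)
  then have "P i j k l + X i j k l + (P i j l k + X i j l k) = P j i k l + X j i k l + (P j i l k + X j i l k)"
    by (metis D_commute)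
  then show ?thesis
    unfolding R X[of j i] by (simp add: algebra_simps)
qed

text \<open>\<open>L\<close> is the curvature with its upper index lowered, which is skew by
  \<open>riem_metric_lower\<close>; raising both indices preserves this.\<close>

lemma riem_metric_upper: "(\<Sum>k\<in>UNIV. riem l i j k * gi k n) = - (\<Sum>k\<in>UNIV. riem n i j k * gi k l)"
proof -
  define L where "L k p = (\<Sum>m\<in>UNIV. riem m i j k * G m p)" for k p
  have r: "riem l i j k = (\<Sum>p\<in>UNIV. L k p * gi p l)" for l k
  proof -
    have "(\<Sum>p\<in>UNIV. L k p * gi p l) = (\<Sum>p\<in>UNIV. \<Sum>m\<in>UNIV. riem m i j k * (G m p * gi p l))"
      by (simp add: L_def sum_distrib_right mult.assoc)
    also have "\<dots> = (\<Sum>m\<in>UNIV. riem m i j k * (\<Sum>p\<in>UNIV. G m p * gi p l))"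
      by (subst sum.swap) (simp add: sum_distrib_left)
    finally show ?thesis by (simp only: G_gi sum_delta)
  qed
  have L: "L k p = - L p k" for k p
    unfolding L_def by (rule riem_metric_lower)
  have "(\<Sum>k\<in>UNIV. riem l i j k * gi k n) = (\<Sum>k\<in>UNIV. \<Sum>p\<in>UNIV. L k p * (gi p l * gi k n))"
    by (simp add: r sum_distrib_right mult.assoc)
  also have "\<dots> = (\<Sum>p\<in>UNIV. \<Sum>k\<in>UNIV. L k p * (gi p l * gi k n))"
    by (rule sum.swap)
  also have "\<dots> = (\<Sum>p\<in>UNIV. \<Sum>k\<in>UNIV. - (L p k * (gi k n * gi p l)))"
    by (subst L) (simp add: mult.commute)
  also have "\<dots> = - (\<Sum>k\<in>UNIV. riem n i j k * gi k l)"
    by (simp add: r sum_distrib_right mult.assoc sum_negf)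
  finally show ?thesis .
qed

text \<open>Skewness in the metric pair exchanges the upper index with a raised last one, turning
  the metric trace into the contraction that defines \<open>ric\<close>.\<close>

lemma riem_trace_last: "tr (\<lambda>m k. riem i j m k) = (\<Sum>a\<in>UNIV. gi i a * ric j a)"
proof -
  have "tr (\<lambda>m k. riem i j m k) = (\<Sum>m\<in>UNIV. \<Sum>k\<in>UNIV. riem i j m k * gi k m)"
    by (simp add: tr_alt gi_sym)
  also have "\<dots> = (\<Sum>m\<in>UNIV. \<Sum>k\<in>UNIV. riem m m j k * gi k i)"
    by (subst riem_metric_upper) (simp add: riem_antisym[of _ _ j] sum_negf)
  also have "\<dots> = (\<Sum>a\<in>UNIV. gi i a * ric j a)"
    by (subst sum.swap) (simp add: ric_def sum_distrib_left mult.commute gi_sym)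
  finally show ?thesis .
qed

text \<open>This contracts a skew pair of indices with the symmetric metric, so it equals its own
  negative.\<close>

lemma riem_trace_first: "(\<Sum>k\<in>UNIV. riem k i j k) = 0"
proof -
  have "(\<Sum>n\<in>UNIV. \<Sum>l\<in>UNIV. (\<Sum>k\<in>UNIV. riem l i j k * gi k n) * G n l)
      = (\<Sum>n\<in>UNIV. \<Sum>l\<in>UNIV. - ((\<Sum>k\<in>UNIV. riem n i j k * gi k l) * G l n))"
    by (subst riem_metric_upper) (simp add: G_sym)
  also have "\<dots> = - (\<Sum>n\<in>UNIV. \<Sum>l\<in>UNIV. (\<Sum>k\<in>UNIV. riem l i j k * gi k n) * G n l)"
    by (subst sum.swap) (simp add: sum_negf)
  finally have *: "(\<Sum>n\<in>UNIV. \<Sum>l\<in>UNIV. (\<Sum>k\<in>UNIV. riem l i j k * gi k n) * G n l) = 0" (is "?t = 0")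
    by (rule double_0[OF eq_neg_iff_add_eq_0[THEN iffD1]])
  have "?t = (\<Sum>n\<in>UNIV. \<Sum>l\<in>UNIV. \<Sum>k\<in>UNIV. riem l i j k * (gi k n * G n l))"
    by (simp add: sum_distrib_right mult.assoc)
  also have "\<dots> = (\<Sum>l\<in>UNIV. \<Sum>n\<in>UNIV. \<Sum>k\<in>UNIV. riem l i j k * (gi k n * G n l))"
    by (rule sum.swap)
  also have "\<dots> = (\<Sum>l\<in>UNIV. \<Sum>k\<in>UNIV. \<Sum>n\<in>UNIV. riem l i j k * (gi k n * G n l))"
    by (intro sum.cong[OF refl] sum.swap)
  also have "\<dots> = (\<Sum>l\<in>UNIV. \<Sum>k\<in>UNIV. riem l i j k * (\<Sum>n\<in>UNIV. gi k n * G n l))"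
    by (simp add: sum_distrib_left)
  also have "\<dots> = (\<Sum>l\<in>UNIV. riem l i j l)"
    by (simp only: gi_G sum_delta)
  finally show ?thesis using * by simp
qed

text \<open>Contract the first Bianchi identity; one of the three terms vanishes by
  \<open>riem_trace_first\<close>.\<close>

lemma ric_sym: "ric j k = ric k j"
proof -
  have "(\<Sum>i\<in>UNIV. riem i i j k + riem i j k i + riem i k i j) = 0"
    by (simp add: first_Bianchi)
  then have "ric j k + (\<Sum>i\<in>UNIV. riem i k i j) = 0"
    by (simp add: sum.distrib riem_trace_first ric_def)
  moreover have "(\<Sum>i\<in>UNIV. riem i k i j) = - ric k j"
    by (subst riem_antisym) (simp add: ric_def sum_negf)
  ultimately show ?thesis by simp
qed

lemma low_sum: "low k (\<lambda>a. \<Sum>i\<in>S. F i a) j = (\<Sum>i\<in>S. low k (\<lambda>a. F i a) j)"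
  unfolding low_def sum_distrib_left by (rule sum.swap)

text \<open>The Christoffel terms of the upper index and of the lower index contracted with it
  cancel under the sum.\<close>

lemma D_ric_trace:
  "(\<Sum>i\<in>UNIV. D m (riem i i j k) + (\<Sum>a\<in>UNIV. Ch i m a * riem a i j k) - low m (\<lambda>a. riem i i j a) k
     - low m (\<lambda>a. riem i a j k) i - low m (\<lambda>a. riem i i a k) j) = cov2 m ric j k"
proof -
  have "(\<Sum>i\<in>UNIV. \<Sum>a\<in>UNIV. Ch i m a * riem a i j k) = (\<Sum>i\<in>UNIV. low m (\<lambda>a. riem i a j k) i)"
    unfolding low_def by (rule sum.swap)
  then show ?thesis
    by (simp add: cov2_def ric_def[abs_def] low_sum D_simps sum.distrib sum_subtractf)
qed

text \<open>The second Bianchi identity contracted once; the left side is the full covariant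
  divergence in the upper index.\<close>

lemma div_riem:
  "(\<Sum>i\<in>UNIV. D i (riem i j m k) + (\<Sum>a\<in>UNIV. Ch i i a * riem a j m k) - low i (\<lambda>a. riem i j m a) k
     - low i (\<lambda>a. riem i a m k) j - low i (\<lambda>a. riem i j a k) m) = cov2 j ric m k - cov2 m ric j k"
proof -
  define N where "N m l i j = D m (riem l i j k) + (\<Sum>a\<in>UNIV. Ch l m a * riem a i j k) - low m (\<lambda>a. riem l i j a) k
     - low m (\<lambda>a. riem l a j k) i - low m (\<lambda>a. riem l i a k) j" for m l i j
  \<comment> \<open>Accounts for the Christoffel terms of the form indices, which \<open>N\<close>
    contains and \<open>second_Bianchi\<close> omits: they cancel in pairs around the cycle.\<close>
  have low_riem: "low a (\<lambda>b. riem l b c k) d = - low d (\<lambda>b. riem l c b k) a" for a c d l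
    by (simp add: low_def riem_antisym[of _ _ c] Ch_sym sum_negf)
  have "N m l i j + N i l j m + N j l m i = 0" for l i
    using second_Bianchi[of m l i j k] low_riem[of m l j i] low_riem[of i l m j] low_riem[of j l i m]
    by (simp add: N_def algebra_simps)
  then have "(\<Sum>i\<in>UNIV. N m i i j + N i i j m + N j i m i) = 0" by simp
  moreover have "N j i m i = - N j i i m" for i
  proof -
    have "low j (\<lambda>a. riem i a i k) m = - low j (\<lambda>a. riem i i a k) m"
      by (subst riem_antisym) (simp add: low_minus)
    then show ?thesis
      by (simp add: N_def riem_antisym[of _ m] D_simps low_minus sum_negf)
  qed
  ultimately have "(\<Sum>i\<in>UNIV. N m i i j) + (\<Sum>i\<in>UNIV. N i i j m) - (\<Sum>i\<in>UNIV. N j i i m) = 0"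
    by (simp add: sum.distrib sum_subtractf)
  moreover have "(\<Sum>i\<in>UNIV. N m i i j) = cov2 m ric j k" for m j
    unfolding N_def by (rule D_ric_trace)
  ultimately have "(\<Sum>i\<in>UNIV. N i i j m) = cov2 j ric m k - cov2 m ric j k"
    by (simp add: algebra_simps)
  then show ?thesis by (simp only: N_def)
qed

lemma cov2_sym: "(\<And>a b. B a b = B b a) \<Longrightarrow> cov2 k B i j = cov2 k B j i"
  by (simp add: cov2_def)

text \<open>Contract \<open>div_riem\<close> once more. Its left side becomes the divergence of
  \<open>U\<close>, that is of \<open>ric\<close> with an index raised, and its right side
  \<open>D j sc - div2 ric j\<close>.\<close>

lemma contracted_Bianchi: "2 * div2 ric j = D j sc"
proof -
  define U where "U i j = (\<Sum>a\<in>UNIV. gi i a * ric j a)" for i j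
  have U: "tr (\<lambda>m k. riem i j m k) = U i j" for i j
    by (simp add: riem_trace_last U_def)
  have sum_tr: "tr (\<lambda>m k. \<Sum>i\<in>UNIV. X i m k) = (\<Sum>i\<in>UNIV. tr (X i))" for X
    by (rule tr_sum)
  have t1: "tr (\<lambda>m k. D i (riem i j m k) - low i (\<lambda>a. riem i j m a) k - low i (\<lambda>a. riem i j a k) m) = D i (U i j)" for i
    unfolding U[symmetric] D_tr by (rule arg_cong[of _ _ tr]) (simp add: fun_eq_iff algebra_simps)
  have t2: "tr (\<lambda>m k. \<Sum>a\<in>UNIV. Ch i i a * riem a j m k) = (\<Sum>a\<in>UNIV. Ch i i a * U a j)" for i
    by (simp add: tr_sum tr_mult_left U)
  have t3: "tr (\<lambda>m k. low i (\<lambda>a. riem i a m k) j) = low i (\<lambda>a. U i a) j" for i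
    by (simp flip: low_tr U)
  have "tr (\<lambda>m k. cov2 j ric m k - cov2 m ric j k)
      = (\<Sum>i\<in>UNIV. tr (\<lambda>m k. D i (riem i j m k) + (\<Sum>a\<in>UNIV. Ch i i a * riem a j m k) - low i (\<lambda>a. riem i j m a) k
     - low i (\<lambda>a. riem i a m k) j - low i (\<lambda>a. riem i j a k) m))"
    unfolding div_riem[symmetric] by (rule tr_sum)
  also have "\<dots> = (\<Sum>i\<in>UNIV. D i (U i j) + (\<Sum>a\<in>UNIV. Ch i i a * U a j) - low i (\<lambda>a. U i a) j)"
    unfolding t1[symmetric] t2[symmetric] t3[symmetric] tr_add[symmetric] tr_diff[symmetric]
    by (simp add: algebra_simps)
  also have "\<dots> = div1 (ric j) - (\<Sum>i\<in>UNIV. low i (\<lambda>a. U i a) j)"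
    unfolding div_raise[symmetric] by (simp add: U_def sum.distrib sum_subtractf)
  also have "(\<Sum>i\<in>UNIV. low i (\<lambda>a. U i a) j) = tr (\<lambda>i a. low i (\<lambda>b. ric b a) j)"
  proof -
    have "low i (\<lambda>a. U i a) j = (\<Sum>a\<in>UNIV. gi i a * low i (\<lambda>b. ric b a) j)" for i
      unfolding low_def U_def
      by (simp add: sum_distrib_left, subst sum.swap) (simp add: ac_simps)
    then show ?thesis by (simp add: tr_def)
  qed
  also have "div1 (ric j) - tr (\<lambda>i a. low i (\<lambda>b. ric b a) j) = tr (\<lambda>i a. cov2 i ric j a)"
    by (simp add: div1_def cov1_def cov2_def tr_diff)
  also have "\<dots> = div2 ric j"
    unfolding div2_def by (intro arg_cong[of _ _ tr] ext cov2_sym ric_sym)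
  finally have "tr (cov2 j ric) - tr (\<lambda>m k. cov2 m ric j k) = div2 ric j"
    by (simp only: tr_diff)
  moreover have "tr (\<lambda>m k. cov2 m ric j k) = div2 ric j"
    unfolding div2_def by (intro arg_cong[of _ _ tr] ext cov2_sym ric_sym)
  ultimately show ?thesis by (simp add: sc_def D_tr_cov2 algebra_simps)
qed

lemma double_cancel: "2 * x = 2 * y \<Longrightarrow> x = (y::'r)"
  using double_0[of "x - y"] by (simp add: algebra_simps mult_2)

section \<open>Inner products and Bochner's formula\<close>

definition inner1 :: "('n \<Rightarrow> 'r) \<Rightarrow> ('n \<Rightarrow> 'r) \<Rightarrow> 'r" where
  "inner1 \<alpha> \<beta> = tr (\<lambda>i j. \<alpha> i * \<beta> j)"

definition inner3 :: "('n \<Rightarrow> 'n \<Rightarrow> 'n \<Rightarrow> 'r) \<Rightarrow> ('n \<Rightarrow> 'n \<Rightarrow> 'n \<Rightarrow> 'r) \<Rightarrow> 'r" where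
  "inner3 S T = tr (\<lambda>i l. inner2 (S i) (T l))"

abbreviation hess :: "'r \<Rightarrow> 'n \<Rightarrow> 'n \<Rightarrow> 'r" where
  "hess u i j \<equiv> cov1 i (\<lambda>j. D j u) j"

lemma hess_sym: "hess u i j = hess u j i"
  by (simp add: cov1_def D_commute[of i] low_def Ch_sym)

lemma inner1_commute: "inner1 \<alpha> \<beta> = inner1 \<beta> \<alpha>"
  unfolding inner1_def by (subst tr_swap[symmetric]) (simp add: mult.commute)

lemma inner2_commute: "inner2 S T = inner2 T S"
proof -
  have "inner2 S T = tr (\<lambda>k i. tr (\<lambda>l j. S i j * T k l))"
    unfolding inner2_def by (simp only: tr_swap[of "\<lambda>i k. tr (\<lambda>j l. S i j * T k l)"] tr_swap[of "\<lambda>j l. S _ j * T _ l"])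
  then show ?thesis by (simp add: inner2_def mult.commute)
qed

lemma inner1_linear:
  "inner1 \<alpha> (\<lambda>i. \<beta> i + \<gamma> i) = inner1 \<alpha> \<beta> + inner1 \<alpha> \<gamma>"
  "inner1 \<alpha> (\<lambda>i. \<beta> i - \<gamma> i) = inner1 \<alpha> \<beta> - inner1 \<alpha> \<gamma>"
  "inner1 \<alpha> (\<lambda>i. - \<beta> i) = - inner1 \<alpha> \<beta>"
  "inner1 \<alpha> (\<lambda>i. c * \<beta> i) = c * inner1 \<alpha> \<beta>"
  by (simp_all add: inner1_def tr_simps distrib_left right_diff_distrib mult.left_commute[of _ c])

lemma inner2_linear_right:
  "inner2 S (\<lambda>i j. T i j + T' i j) = inner2 S T + inner2 S T'"
  "inner2 S (\<lambda>i j. T i j - T' i j) = inner2 S T - inner2 S T'"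
  "inner2 S (\<lambda>i j. - T i j) = - inner2 S T"
  "inner2 S (\<lambda>i j. c * T i j) = c * inner2 S T"
  by (simp_all add: inner2_def tr_simps distrib_left right_diff_distrib mult.left_commute[of _ c])

lemma inner2_linear_left:
  "inner2 (\<lambda>i j. T i j + T' i j) S = inner2 T S + inner2 T' S"
  "inner2 (\<lambda>i j. T i j - T' i j) S = inner2 T S - inner2 T' S"
  "inner2 (\<lambda>i j. - T i j) S = - inner2 T S"
  "inner2 (\<lambda>i j. c * T i j) S = c * inner2 T S"
  by (simp_all only: inner2_commute[of _ S] inner2_linear_right)

lemmas inner2_linear = inner2_linear_right inner2_linear_left

lemma inner3_linear:
  "inner3 S (\<lambda>i j k. T i j k + T' i j k) = inner3 S T + inner3 S T'"
  "inner3 S (\<lambda>i j k. T i j k - T' i j k) = inner3 S T - inner3 S T'"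
  "inner3 S (\<lambda>i j k. - T i j k) = - inner3 S T"
  "inner3 (\<lambda>i j k. - S i j k) T = - inner3 S T"
  by (simp_all add: inner3_def inner2_linear tr_simps)

lemma inner3_commute: "inner3 S T = inner3 T S"
  unfolding inner3_def by (subst tr_swap[symmetric]) (simp add: inner2_commute)

lemma inner2_transpose: "inner2 (\<lambda>i j. S j i) (\<lambda>i j. T j i) = inner2 S T"
  unfolding inner2_def by (rule tr_tr)

text \<open>Permuting the slots of both factors only renames summation indices. If the first factor
  is skew, a permutation of the second alone thus costs just a sign.\<close>

lemma inner3_perm23: "inner3 (\<lambda>i j k. S i k j) (\<lambda>i j k. T i k j) = inner3 S T"
  unfolding inner3_def by (simp add: inner2_transpose[of "\<lambda>i j. S _ i j"])

lemma inner3_perm12: "inner3 (\<lambda>i j k. S j i k) (\<lambda>i j k. T j i k) = inner3 S T"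
  unfolding inner3_def inner2_def by (rule tr_tr)

lemma inner3_perm13: "inner3 (\<lambda>i j k. S k j i) (\<lambda>i j k. T k j i) = inner3 S T"
proof -
  have "inner3 (\<lambda>i j k. S k j i) (\<lambda>i j k. T k j i) = inner3 (\<lambda>i j k. S k i j) (\<lambda>i j k. T k i j)"
    by (rule inner3_perm12)
  also have "\<dots> = inner3 (\<lambda>i j k. S j i k) (\<lambda>i j k. T j i k)"
    by (rule inner3_perm23)
  also have "\<dots> = inner3 S T"
    by (rule inner3_perm12)
  finally show ?thesis .
qed

text \<open>Transposing both factors shows that the product is its own negative.\<close>

lemma inner2_sym_skew:
  assumes "\<And>i j. S i j = S j i" "\<And>i j. A i j = - A j i"
  shows "inner2 S A = 0"
proof (rule double_0)
  have s: "(\<lambda>i j. S j i) = S"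
    by (intro ext) (rule assms(1))
  have a: "(\<lambda>i j. A j i) = (\<lambda>i j. - A i j)"
    by (intro ext) (rule assms(2))
  have "inner2 S A = inner2 (\<lambda>i j. S j i) (\<lambda>i j. A j i)"
    by (rule inner2_transpose[symmetric])
  then have "inner2 S A = - inner2 S A"
    unfolding s a inner2_linear .
  then show "inner2 S A + inner2 S A = 0"
    by (rule eq_neg_iff_add_eq_0[THEN iffD1])
qed

lemma tr_inner2: "tr (\<lambda>i l. inner2 (\<lambda>j m. X i l j m) h) = inner2 (\<lambda>j m. tr (\<lambda>i l. X i l j m)) h"
proof -
  have "tr (\<lambda>i l. inner2 (\<lambda>j m. X i l j m) h) = tr (\<lambda>j j'. tr (\<lambda>i l. tr (\<lambda>m m'. X i l j m * h j' m')))"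
    unfolding inner2_def by (rule tr_tr)
  also have "\<dots> = tr (\<lambda>j j'. tr (\<lambda>m m'. tr (\<lambda>i l. X i l j m * h j' m')))"
    by (simp only: tr_tr[of "\<lambda>i l m m'. X i l _ m * h _ m'"])
  finally show ?thesis by (simp only: tr_mult_right inner2_def)
qed

lemma deriv_tr_inner2: "derivation E \<Longrightarrow> E (tr F) = tr (\<lambda>i j. E (F i j)) - inner2 F (\<lambda>i j. E (G i j))"
  by (simp add: deriv_tr inner2_def mult.commute)

lemma D_inner1: "D k (inner1 \<alpha> \<beta>) = inner1 (cov1 k \<alpha>) \<beta> + inner1 \<alpha> (cov1 k \<beta>)"
  by (simp add: inner1_def D_tr D_simps low_simps cov1_def algebra_simps tr_simps)

lemma cov1_inner2:
  "cov1 k (\<lambda>j. inner2 S (T j)) j = inner2 (cov2 k S) (T j) + inner2 S (cov3 k T j)"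
  unfolding inner2_def
  by (simp add: cov1_def D_tr D_simps low_simps cov2_def cov3_def algebra_simps tr_simps)

lemma cov2_inner2:
  "cov2 k (\<lambda>i j. inner2 (S i) (T j)) i j = inner2 (cov3 k S i) (T j) + inner2 (S i) (cov3 k T j)"
  unfolding inner2_def
  by (simp add: cov2_def D_tr D_simps low_simps cov3_def algebra_simps tr_simps)

lemma D_inner3: "D k (inner3 S T) = inner3 (cov3 k S) T + inner3 S (cov3 k T)"
  unfolding inner3_def by (simp add: D_tr_cov2 cov2_inner2[abs_def] tr_add)

text \<open>Bochner's formula: in the third derivatives of \<open>u\<close> the outermost index has
  to be exchanged with the free one, and the curvature produced by the Ricci identity traces to
  \<open>ric\<close>.\<close>

lemma lap_inner1_self:
  fixes u
  defines "\<alpha> \<equiv> \<lambda>i. D i u"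
  shows "lap (inner1 \<alpha> \<alpha>) = 2 * inner2 (hess u) (hess u) + 2 * inner1 \<alpha> (\<lambda>k. D k (lap u))
    + 2 * inner2 (\<lambda>i j. \<alpha> i * \<alpha> j) ric"
proof -
  define A where "A = hess u"
  have A: "A j k = cov1 j \<alpha> k" for j k by (simp add: A_def \<alpha>_def)
  have A_sym: "A j k = A k j" for j k unfolding A_def by (rule hess_sym)
  have "D j (inner1 \<alpha> \<alpha>) = 2 * tr (\<lambda>k l. A j k * \<alpha> l)" for j
    using inner1_commute[of "cov1 j \<alpha>" \<alpha>] by (simp add: D_inner1 A flip: inner1_def)
  then have l: "lap (inner1 \<alpha> \<alpha>) = tr (\<lambda>i j. cov1 i (\<lambda>j. 2 * tr (\<lambda>k l. A j k * \<alpha> l)) j)"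
    by (simp add: lap_def)
  have p: "cov1 i (\<lambda>j. 2 * tr (\<lambda>k l. A j k * \<alpha> l)) j =
     2 * tr (\<lambda>k l. cov2 i A j k * \<alpha> l) + 2 * tr (\<lambda>k l. A j k * A i l)" for i j
    unfolding A[of i] by (simp add: cov1_def cov2_def D_tr D_simps low_simps algebra_simps tr_simps)
  have "tr (\<lambda>i j. tr (\<lambda>k l. A j k * A i l)) = inner2 A A"
    unfolding inner2_def by (rule tr_swap)
  then have 1: "lap (inner1 \<alpha> \<alpha>) = 2 * tr (\<lambda>i j. tr (\<lambda>k l. cov2 i A j k * \<alpha> l)) + 2 * inner2 A A"
    unfolding l p tr_add tr_mult_left by simp
  \<comment> \<open>Symmetry of the Hessian first makes the two indices to be exchanged
    adjacent.\<close>
  have c: "cov2 i A j k = cov2 k A i j - (\<Sum>l\<in>UNIV. riem l i k j * \<alpha> l)" for i j k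
  proof -
    have "cov2 i A k j - cov2 k A i j = - (\<Sum>l\<in>UNIV. riem l i k j * \<alpha> l)"
      using cov_commutator[of i \<alpha> k j] by (simp add: A[abs_def])
    then show ?thesis by (simp add: cov2_sym[of A, OF A_sym] algebra_simps)
  qed
  have t: "tr (\<lambda>i j. cov2 i A j k) = D k (lap u) + tr (\<lambda>b a. \<alpha> b * ric k a)" for k
  proof -
    have "tr (\<lambda>i j. \<Sum>l\<in>UNIV. riem l i k j * \<alpha> l) = - (\<Sum>l\<in>UNIV. tr (\<lambda>i j. riem l k i j) * \<alpha> l)"
      by (simp add: tr_sum riem_antisym[of _ _ k] tr_simps sum_negf)
    also have "\<dots> = - tr (\<lambda>b a. \<alpha> b * ric k a)"
      unfolding riem_trace_last tr_def[of "\<lambda>b a. \<alpha> b * ric k a"] by (simp add: sum_distrib_left ac_simps)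
    finally have "tr (\<lambda>i j. \<Sum>l\<in>UNIV. riem l i k j * \<alpha> l) = - tr (\<lambda>b a. \<alpha> b * ric k a)" .
    moreover have "tr (cov2 k A) = D k (lap u)"
      by (simp add: lap_def A_def flip: D_tr_cov2)
    moreover have "tr (\<lambda>i j. cov2 i A j k) = tr (\<lambda>i j. cov2 k A i j - (\<Sum>l\<in>UNIV. riem l i k j * \<alpha> l))"
      by (intro arg_cong[of _ _ tr] ext c)
    ultimately show ?thesis by (simp only: tr_diff) simp
  qed
  have "tr (\<lambda>i j. tr (\<lambda>k l. cov2 i A j k * \<alpha> l)) = tr (\<lambda>k l. tr (\<lambda>i j. cov2 i A j k) * \<alpha> l)"
    by (subst tr_tr) (simp add: tr_mult_right)
  also have "\<dots> = tr (\<lambda>k l. D k (lap u) * \<alpha> l) + tr (\<lambda>k l. tr (\<lambda>b a. \<alpha> b * ric k a) * \<alpha> l)"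
    by (simp add: t distrib_right tr_add)
  also have "tr (\<lambda>k l. D k (lap u) * \<alpha> l) = inner1 \<alpha> (\<lambda>k. D k (lap u))"
    by (subst inner1_commute) (simp add: inner1_def)
  also have "tr (\<lambda>k l. tr (\<lambda>b a. \<alpha> b * ric k a) * \<alpha> l) = inner2 (\<lambda>i j. \<alpha> i * \<alpha> j) ric"
    unfolding inner2_def by (subst tr_swap[symmetric]) (simp add: mult.assoc tr_mult_left mult.commute[of "tr _"])
  finally show ?thesis unfolding 1 by (simp add: A_def algebra_simps)
qed

end

section \<open>Variation of the metric\<close>

locale metric_variation = metric_ring D G gi Ch
  for D :: "'n::finite \<Rightarrow> 'r::comm_ring_1 \<Rightarrow> 'r" and G gi Ch +
  fixes T :: "'r \<Rightarrow> 'r"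
  assumes T_deriv: "derivation T"
    and T_D: "T (D i x) = D i (T x)"
begin

lemmas T_simps = derivation_simps[OF T_deriv]

definition h :: "'n \<Rightarrow> 'n \<Rightarrow> 'r" where
  "h i j = T (G i j)"

text \<open>Twice the variation of the Christoffel symbols, with the upper index lowered to the first place.\<close>

definition double_var_Ch :: "'n \<Rightarrow> 'n \<Rightarrow> 'n \<Rightarrow> 'r" where
  "double_var_Ch m i j = cov2 i h j m + cov2 j h i m - cov2 m h i j"

lemma h_sym: "h i j = h j i"
  by (simp add: h_def G_sym)

lemma T_tr: "T (tr F) = tr (\<lambda>i j. T (F i j)) - inner2 F h"
  using deriv_tr_inner2[OF T_deriv] by (simp add: h_def[abs_def])

text \<open>Vary the Koszul formula for the lowered symbol \<open>K\<close>. The part in which the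
  variation hits the metric supplies exactly the terms that make the derivatives of \<open>h\<close>
  covariant.\<close>

lemma T_Ch: "2 * T (Ch l i j) = (\<Sum>m\<in>UNIV. gi l m * double_var_Ch m i j)"
proof -
  define K where "K m i j = (\<Sum>l\<in>UNIV. G m l * Ch l i j)" for m i j
  have K: "D i (G j m) + D j (G i m) - D m (G i j) = 2 * K m i j" for m i j
    by (simp add: D_G K_def Ch_sym G_sym algebra_simps)
  have TK: "T (K m i j) = (\<Sum>l\<in>UNIV. h m l * Ch l i j) + (\<Sum>l\<in>UNIV. G m l * T (Ch l i j))" for m
    by (simp add: K_def T_simps sum.distrib h_def)
  have hC: "(\<Sum>l\<in>UNIV. h m l * Ch l i j) = low i (\<lambda>a. h a m) j" for m i j
    by (simp add: low_def Ch_sym h_sym mult.commute)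
  have ls: "low i \<alpha> j = low j \<alpha> i" for i j \<alpha>
    by (simp add: low_def Ch_sym)
  have hs: "low i (h j) k = low i (\<lambda>a. h a j) k" for i j k
    by (simp add: low_def h_sym)
  have "D i (h j m) + D j (h i m) - D m (h i j) = 2 * T (K m i j)" for m
    using arg_cong[OF K[of i j m], of T] by (simp add: T_simps T_D h_def)
  then have "double_var_Ch m i j = 2 * (\<Sum>l\<in>UNIV. G m l * T (Ch l i j))" for m
    unfolding TK hC double_var_Ch_def cov2_def
    using ls[of i _ j] ls[of i _ m] ls[of j _ m] hs[of i j m] hs[of j i m] hs[of m i j]
    by (simp add: algebra_simps)
  then have "(\<Sum>m\<in>UNIV. gi l m * double_var_Ch m i j) = 2 * (\<Sum>m\<in>UNIV. \<Sum>k\<in>UNIV. gi l m * G m k * T (Ch k i j))"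
    by (simp add: sum_distrib_left ac_simps)
  also have "(\<Sum>m\<in>UNIV. \<Sum>k\<in>UNIV. gi l m * G m k * T (Ch k i j)) = (\<Sum>k\<in>UNIV. (\<Sum>m\<in>UNIV. gi l m * G m k) * T (Ch k i j))"
    by (subst sum.swap) (simp add: sum_distrib_right)
  finally show ?thesis by (simp only: gi_G sum_delta)
qed

lemma tr_double_var_Ch_23: "tr (\<lambda>i j. double_var_Ch m i j) = 2 * div2 h m - D m (tr h)"
  unfolding double_var_Ch_def tr_add tr_diff D_tr_cov2 div2_def
  by (subst (2) tr_swap[symmetric]) simp

lemma tr_double_var_Ch_12: "tr (\<lambda>l a. double_var_Ch a l k) = D k (tr h)"
proof -
  have "tr (\<lambda>l a. cov2 l h k a) = tr (\<lambda>a l. cov2 a h l k)"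
    by (intro arg_cong[of _ _ tr] ext cov2_sym h_sym)
  also have "\<dots> = tr (\<lambda>l a. cov2 a h l k)"
    by (rule tr_swap[symmetric])
  finally show ?thesis
    by (simp add: double_var_Ch_def tr_add tr_diff D_tr_cov2)
qed

text \<open>Palatini's identity. \<open>W\<close> is twice the variation of the connection, and the
  quadratic terms of the curvature complete its covariant derivative. The contraction of
  \<open>W\<close> is the gradient of \<open>tr h\<close>, whence the Hessian.\<close>

lemma T_ric: "2 * T (ric j k) = tr (\<lambda>l m. cov3 l double_var_Ch m j k) - hess (tr h) j k"
proof -
  define W where "W l i j = (\<Sum>m\<in>UNIV. gi l m * double_var_Ch m i j)" for l i j
  have W: "2 * T (Ch l i j) = W l i j" for l i j by (simp add: T_Ch W_def)
  have "2 * T (riem l i j k) = D i (2 * T (Ch l j k)) - D j (2 * T (Ch l i k))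
      + (\<Sum>m\<in>UNIV. 2 * T (Ch l i m) * Ch m j k + Ch l i m * (2 * T (Ch m j k))
          - 2 * T (Ch l j m) * Ch m i k - Ch l j m * (2 * T (Ch m i k)))" for l i j k
    by (simp add: riem_def T_simps T_D D_simps algebra_simps sum_distrib_left sum.distrib sum_subtractf)
  then have "2 * T (riem l i j k) = D i (W l j k) - D j (W l i k)
      + (\<Sum>m\<in>UNIV. W l i m * Ch m j k + Ch l i m * W m j k - W l j m * Ch m i k - Ch l j m * W m i k)" for l i j k
    unfolding W .
  then have "2 * T (ric j k) = (\<Sum>l\<in>UNIV. D l (W l j k)) - (\<Sum>l\<in>UNIV. D j (W l l k))
      + ((\<Sum>l\<in>UNIV. \<Sum>m\<in>UNIV. W l l m * Ch m j k) + (\<Sum>l\<in>UNIV. \<Sum>m\<in>UNIV. Ch l l m * W m j k)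
      - (\<Sum>l\<in>UNIV. \<Sum>m\<in>UNIV. W l j m * Ch m l k) - (\<Sum>l\<in>UNIV. \<Sum>m\<in>UNIV. Ch l j m * W m l k))"
    by (simp add: ric_def T_simps sum_distrib_left sum.distrib sum_subtractf)
  moreover have "(\<Sum>l\<in>UNIV. D l (W l j k)) + (\<Sum>l\<in>UNIV. \<Sum>m\<in>UNIV. Ch l l m * W m j k)
      = tr (\<lambda>l m. D l (double_var_Ch m j k) - low l (\<lambda>m. double_var_Ch m j k) m)"
    unfolding W_def div_raise by (simp add: div1_def cov1_def)
  moreover have "(\<Sum>l\<in>UNIV. \<Sum>m\<in>UNIV. W l j m * Ch m l k) = tr (\<lambda>l a. low l (\<lambda>m. double_var_Ch a j m) k)"
  proof -
    have "(\<Sum>m\<in>UNIV. W l j m * Ch m l k) = (\<Sum>a\<in>UNIV. gi l a * low l (\<lambda>m. double_var_Ch a j m) k)" for l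
      unfolding W_def low_def sum_distrib_left sum_distrib_right
      by (subst sum.swap) (simp add: ac_simps)
    then show ?thesis by (simp add: tr_def)
  qed
  moreover have "(\<Sum>l\<in>UNIV. \<Sum>m\<in>UNIV. Ch l j m * W m l k) = tr (\<lambda>m a. low m (\<lambda>l. double_var_Ch a l k) j)"
  proof -
    have "(\<Sum>l\<in>UNIV. Ch l j m * W m l k) = (\<Sum>a\<in>UNIV. gi m a * low m (\<lambda>l. double_var_Ch a l k) j)" for m
      unfolding W_def low_def sum_distrib_left sum_distrib_right
      by (subst sum.swap) (simp add: ac_simps Ch_sym)
    then show ?thesis by (subst sum.swap) (simp add: tr_def)
  qed
  moreover have "(\<Sum>l\<in>UNIV. D j (W l l k)) - (\<Sum>l\<in>UNIV. \<Sum>m\<in>UNIV. W l l m * Ch m j k) = hess (tr h) j k"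
  proof -
    have w: "(\<Sum>l\<in>UNIV. W l l k) = D k (tr h)" for k
      unfolding tr_double_var_Ch_12[symmetric] by (simp add: W_def tr_def)
    have "(\<Sum>l\<in>UNIV. \<Sum>m\<in>UNIV. W l l m * Ch m j k) = (\<Sum>m\<in>UNIV. Ch m j k * (\<Sum>l\<in>UNIV. W l l m))"
      by (subst sum.swap) (simp add: sum_distrib_left mult.commute)
    moreover have "(\<Sum>l\<in>UNIV. D j (W l l k)) = D j (D k (tr h))"
      by (simp only: w flip: derivation_sum[OF D_deriv])
    ultimately show ?thesis
      by (simp add: cov1_def low_def w)
  qed
  ultimately show ?thesis
    by (simp add: cov3_def tr_diff tr_add algebra_simps)
qed

text \<open>Tracing \<open>T_ric\<close> gives the divergence of
  \<open>2 * div2 h m - D m (tr h)\<close> and a further Laplacian; the last term comes from varying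
  the inverse metric.\<close>

lemma T_sc: "T sc = div1 (div2 h) - lap (tr h) - inner2 ric h"
proof (rule double_cancel)
  have "2 * tr (\<lambda>j k. T (ric j k)) = tr (\<lambda>j k. tr (\<lambda>l m. cov3 l double_var_Ch m j k)) - lap (tr h)"
    by (simp add: T_ric tr_diff lap_def flip: tr_mult_left)
  also have "tr (\<lambda>j k. tr (\<lambda>l m. cov3 l double_var_Ch m j k)) = tr (\<lambda>l m. cov1 l (\<lambda>m. 2 * div2 h m - D m (tr h)) m)"
    unfolding tr_double_var_Ch_23[symmetric] by (subst tr_tr) (intro arg_cong[of _ _ tr] ext cov1_tr[symmetric])
  also have "\<dots> = 2 * div1 (div2 h) - lap (tr h)"
    by (simp add: cov1_def D_simps low_simps div1_def lap_def algebra_simps tr_simps)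
  finally show "2 * T sc = 2 * (div1 (div2 h) - lap (tr h) - inner2 ric h)"
    by (simp add: sc_def T_tr algebra_simps)
qed

text \<open>The Hessian varies through \<open>u\<close> and through the Christoffel symbols, whose
  traced variation is again \<open>2 * div2 h m - D m (tr h)\<close> up to the factor 2 of
  \<open>T_Ch\<close>.\<close>

lemma T_lap: "2 * T (lap u) = 2 * lap (T u) - 2 * inner2 (hess u) h - 2 * inner1 (\<lambda>i. D i u) (div2 h)
    + inner1 (\<lambda>i. D i u) (\<lambda>i. D i (tr h))"
proof -
  have "2 * T (hess u i j) = 2 * hess (T u) i j - tr (\<lambda>l a. D l u * double_var_Ch a i j)" for i j
  proof -
    have 1: "T (hess u i j) = hess (T u) i j - (\<Sum>l\<in>UNIV. T (Ch l i j) * D l u)"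
      by (simp add: cov1_def low_def T_simps T_D sum.distrib)
    have "2 * (\<Sum>l\<in>UNIV. T (Ch l i j) * D l u) = (\<Sum>l\<in>UNIV. 2 * T (Ch l i j) * D l u)"
      by (simp add: sum_distrib_left mult.assoc)
    also have "\<dots> = tr (\<lambda>l a. D l u * double_var_Ch a i j)"
      unfolding T_Ch tr_def sum_distrib_right by (simp add: ac_simps)
    finally show ?thesis by (simp only: 1 right_diff_distrib)
  qed
  then have "2 * tr (\<lambda>i j. T (hess u i j)) = 2 * lap (T u) - tr (\<lambda>i j. tr (\<lambda>l a. D l u * double_var_Ch a i j))"
    by (simp add: lap_def tr_diff flip: tr_mult_left)
  also have "tr (\<lambda>i j. tr (\<lambda>l a. D l u * double_var_Ch a i j)) = inner1 (\<lambda>i. D i u) (\<lambda>a. 2 * div2 h a - D a (tr h))"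
    by (subst tr_tr) (simp add: inner1_def flip: tr_double_var_Ch_23 tr_mult_left)
  finally show ?thesis
    by (simp add: lap_def T_tr inner1_linear algebra_simps)
qed

lemma T_inner1_self:
  "T (inner1 (\<lambda>i. D i u) (\<lambda>i. D i u)) = 2 * inner1 (\<lambda>i. D i u) (\<lambda>i. D i (T u)) - inner2 (\<lambda>i j. D i u * D j u) h"
proof -
  have "tr (\<lambda>i j. D i (T u) * D j u) = inner1 (\<lambda>i. D i u) (\<lambda>i. D i (T u))"
    by (subst inner1_commute) (simp add: inner1_def)
  moreover have "tr (\<lambda>i j. D i u * D j (T u)) = inner1 (\<lambda>i. D i u) (\<lambda>i. D i (T u))"
    by (simp add: inner1_def)
  ultimately show ?thesis
    by (simp add: inner1_def[of "\<lambda>i. D i u" "\<lambda>i. D i u"] T_tr T_simps T_D tr_add)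
qed

end

section \<open>The flow equations over a differential ring\<close>

context metric_ring
begin

definition sq3 :: "('n \<Rightarrow> 'n \<Rightarrow> 'n \<Rightarrow> 'r) \<Rightarrow> 'n \<Rightarrow> 'n \<Rightarrow> 'r" where
  "sq3 H i j = inner2 (H i) (H j)"

definition codiff :: "('n \<Rightarrow> 'n \<Rightarrow> 'n \<Rightarrow> 'r) \<Rightarrow> 'n \<Rightarrow> 'n \<Rightarrow> 'r" where
  "codiff H j k = - tr (\<lambda>i m. cov3 m H i j k)"

definition int_prod :: "('n \<Rightarrow> 'r) \<Rightarrow> ('n \<Rightarrow> 'n \<Rightarrow> 'n \<Rightarrow> 'r) \<Rightarrow> 'n \<Rightarrow> 'n \<Rightarrow> 'r" where
  "int_prod \<alpha> H j k = tr (\<lambda>i m. \<alpha> i * H m j k)"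

definition skew3 :: "('n \<Rightarrow> 'n \<Rightarrow> 'n \<Rightarrow> 'r) \<Rightarrow> bool" where
  "skew3 H \<longleftrightarrow> (\<forall>i j k. H i j k = - H j i k \<and> H i j k = - H i k j)"

definition closed3 :: "('n \<Rightarrow> 'n \<Rightarrow> 'n \<Rightarrow> 'r) \<Rightarrow> bool" where
  "closed3 H \<longleftrightarrow> (\<forall>i j k l. D i (H j k l) - D j (H i k l) + D k (H i j l) - D l (H i j k) = 0)"

lemma sq3_sym: "sq3 H i j = sq3 H j i"
  unfolding sq3_def by (rule inner2_commute)

lemma tr_sq3: "tr (sq3 H) = inner3 H H"
  by (simp add: inner3_def sq3_def[abs_def])

end

locale three_form_ring = metric_ring D G gi Ch
  for D :: "'n::finite \<Rightarrow> 'r::comm_ring_1 \<Rightarrow> 'r" and G gi Ch +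
  fixes H :: "'n \<Rightarrow> 'n \<Rightarrow> 'n \<Rightarrow> 'r"
  assumes H_skew: "skew3 H" and H_closed: "closed3 H"
begin

lemma H12: "H i j k = - H j i k" and H23: "H i j k = - H i k j"
  using H_skew unfolding skew3_def by blast+

lemma H13: "H k j i = - H i j k"
  by (metis H12 H23)

lemma D_H12: "D m (H i j k) = - D m (H j i k)"
  by (subst H12) (simp add: D_simps)

lemma D_H23: "D m (H i j k) = - D m (H i k j)"
  by (subst H23) (simp add: D_simps)

lemma low_H:
  "low m (\<lambda>a. H a j k) i = - low m (\<lambda>a. H j a k) i"
  "low m (\<lambda>a. H j k a) i = - low m (\<lambda>a. H k j a) i"
  "low m (\<lambda>a. H j a k) i = - low m (\<lambda>a. H j k a) i"
  "low m (\<lambda>a. H a j k) i = - low m (\<lambda>a. H a k j) i"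
  by (subst H12 H23, simp add: low_minus; fail)+

lemma cov3_H23: "cov3 m H i j k = - cov3 m H i k j"
  unfolding cov3_def D_H23[of m i j] low_H(4)[of m j k i] low_H(3)[of m i k j] low_H(3)[of m i j k]
  by simp

lemma codiff_skew: "codiff H j k = - codiff H k j"
  unfolding codiff_def by (subst cov3_H23) (simp add: tr_minus)

lemma int_prod_skew: "int_prod \<alpha> H j k = - int_prod \<alpha> H k j"
  unfolding int_prod_def by (subst H23) (simp add: tr_minus)

text \<open>For a torsion-free connection the exterior derivative may be formed with covariant
  derivatives: the twelve Christoffel terms cancel in the six pairs listed in the proof.\<close>

lemma closed_cov3: "cov3 i H j k l - cov3 j H i k l + cov3 k H i j l - cov3 l H i j k = 0"
proof -
  have "D i (H j k l) - D j (H i k l) + D k (H i j l) - D l (H i j k) = 0"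
    using H_closed by (simp add: closed3_def)
  moreover have s: "low a F b = low b F a" for a b F
    by (simp add: low_def Ch_sym)
  have "low i (\<lambda>a. H a k l) j = low j (\<lambda>a. H a k l) i"
    "low i (\<lambda>a. H j a l) k = - low k (\<lambda>a. H a j l) i"
    "low i (\<lambda>a. H j k a) l = low l (\<lambda>a. H a j k) i"
    "low j (\<lambda>a. H i a l) k = low k (\<lambda>a. H i a l) j"
    "low j (\<lambda>a. H i k a) l = - low l (\<lambda>a. H i a k) j"
    "low k (\<lambda>a. H i j a) l = low l (\<lambda>a. H i j a) k"
    using s[of i "\<lambda>a. H a k l" j] s[of i "\<lambda>a. H j a l" k] s[of i "\<lambda>a. H j k a" l]
      s[of j "\<lambda>a. H i a l" k] s[of j "\<lambda>a. H i k a" l] s[of k "\<lambda>a. H i j a" l]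
      low_H(1)[of k j l i] low_H(1)[of l j k i] low_H(3)[of l j k i] low_H(3)[of l i k j]
    by simp_all
  ultimately show ?thesis
    unfolding cov3_def by (simp add: algebra_simps)
qed

lemma tr_cov3: "tr (\<lambda>k l. cov3 k H l a b) = - codiff H a b"
  unfolding codiff_def by (simp, rule tr_swap)

text \<open>\<open>Y\<close> is the part of the divergence in which \<open>H\<close> is differentiated in its uncontracted factor.  By
  closedness \<open>D\<^sub>j |H|\<^sup>2 / 2\<close> is a sum of three terms that are equal to \<open>Y\<close> after renaming indices.\<close>

lemma div_sq3: "6 * div2 (sq3 H) j = D j (inner3 H H) - 6 * inner2 (codiff H) (H j)"
proof -
  define Y where "Y = inner3 H (\<lambda>k c d. cov3 k H j c d)"
  have neg: "(\<lambda>i k l. H k i l) = (\<lambda>i k l. - H i k l)" "(\<lambda>i k l. H l k i) = (\<lambda>i k l. - H i k l)"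
    by (intro ext H12 H13)+
  have "inner3 H (\<lambda>k c d. cov3 c H j k d) = inner3 (\<lambda>i k l. H k i l) (\<lambda>k c d. cov3 k H j c d)"
    by (subst inner3_perm12[symmetric]) simp
  then have 1: "inner3 H (\<lambda>k c d. cov3 c H j k d) = - Y"
    unfolding neg by (simp add: inner3_linear Y_def)
  have "inner3 H (\<lambda>k c d. cov3 d H j k c) = inner3 (\<lambda>i k l. H l k i) (\<lambda>k c d. cov3 k H j d c)"
    by (subst inner3_perm13[symmetric]) simp
  moreover have neg': "(\<lambda>k c d. cov3 k H j d c) = (\<lambda>k c d. - cov3 k H j c d)"
    by (intro ext cov3_H23)
  ultimately have 2: "inner3 H (\<lambda>k c d. cov3 d H j k c) = Y"
    unfolding neg neg' by (simp add: inner3_linear Y_def)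
  have "cov3 j H k c d = cov3 k H j c d - cov3 c H j k d + cov3 d H j k c" for k c d
    using closed_cov3[of j k c d] by (simp add: algebra_simps)
  then have "cov3 j H = (\<lambda>k c d. cov3 k H j c d - cov3 c H j k d + cov3 d H j k c)"
    by (intro ext)
  then have "inner3 H (cov3 j H) = 3 * Y"
    by (simp add: inner3_linear 1 2 flip: Y_def)
  \<comment> \<open>A factor 2 from differentiating a square, and the factor 3 from
    closedness.\<close>
  then have N: "D j (inner3 H H) = 6 * Y"
    using inner3_commute[of "cov3 j H" H] by (simp add: D_inner3)
  have "div2 (sq3 H) j = tr (\<lambda>k l. inner2 (cov3 k H l) (H j)) + tr (\<lambda>k l. inner2 (H l) (cov3 k H j))"
    unfolding div2_def sq3_def[abs_def] cov2_inner2 by (rule tr_add)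
  also have "tr (\<lambda>k l. inner2 (H l) (cov3 k H j)) = Y"
    unfolding Y_def inner3_def by (subst tr_swap[symmetric]) simp
  also have "tr (\<lambda>k l. inner2 (cov3 k H l) (H j)) = inner2 (\<lambda>a b. tr (\<lambda>k l. cov3 k H l a b)) (H j)"
    using tr_inner2[of "\<lambda>k l. cov3 k H l" "H j"] by simp
  finally have "div2 (sq3 H) j = Y - inner2 (codiff H) (H j)"
    unfolding tr_cov3 by (simp add: inner2_linear)
  then show ?thesis
    by (simp only: N right_diff_distrib)
qed

text \<open>In the divergence of \<open>div_sq3\<close> the derivative falls either on
  \<open>codiff H\<close> or on \<open>H\<close>; in the second case it is contracted into
  \<open>- codiff H\<close>, which completes a square.\<close>

lemma div_div_sq3:
  "6 * div1 (div2 (sq3 H)) = lap (inner3 H H) - 6 * inner3 (\<lambda>i. cov2 i (codiff H)) H + 6 * inner2 (codiff H) (codiff H)"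
proof -
  have "6 * div1 (div2 (sq3 H)) = div1 (\<lambda>j. 6 * div2 (sq3 H) j)"
    by (simp add: div1_def cov1_def D_simps low_simps tr_simps algebra_simps)
  also have "\<dots> = lap (inner3 H H) - 6 * tr (\<lambda>i j. cov1 i (\<lambda>j. inner2 (codiff H) (H j)) j)"
    unfolding div_sq3
    by (simp add: div1_def lap_def cov1_def D_simps low_simps tr_simps algebra_simps)
  also have "tr (\<lambda>i j. cov1 i (\<lambda>j. inner2 (codiff H) (H j)) j) =
     inner3 (\<lambda>i. cov2 i (codiff H)) H + tr (\<lambda>i j. inner2 (codiff H) (cov3 i H j))"
    unfolding cov1_inner2 tr_add inner3_def ..
  also have "tr (\<lambda>i j. inner2 (codiff H) (cov3 i H j)) = inner2 (codiff H) (\<lambda>a b. tr (\<lambda>i j. cov3 i H j a b))"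
    using tr_inner2[of "\<lambda>k l. cov3 k H l" "codiff H"] by (simp add: inner2_commute[of "cov3 _ H _" "codiff H"] inner2_commute[of "\<lambda>a b. tr (\<lambda>k l. cov3 k H l a b)" "codiff H"])
  finally show ?thesis
    unfolding tr_cov3
    by (simp add: inner2_linear algebra_simps)
qed

text \<open>By skewness \<open>H\<close> pairs equally with all three terms. For
  \<open>B = codiff H\<close> this expresses the evolution of the norm of \<open>H\<close> by the
  same product that occurs in \<open>div_div_sq3\<close>, so that the two can cancel.\<close>

lemma inner3_d_two:
  assumes B: "\<And>i j. B i j = - B j i"
  shows "inner3 H (\<lambda>i j k. D i (B j k) - D j (B i k) + D k (B i j)) = 3 * inner3 (\<lambda>i. cov2 i B) H"
proof -
  have s: "low a (\<lambda>x. F x) b = low b (\<lambda>x. F x) a" for a b F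
    by (simp add: low_def Ch_sym)
  have L: "low a (\<lambda>x. B x c) b = - low a (\<lambda>x. B c x) b" for a b c
    by (subst B) (simp add: low_minus)
  have "D i (B j k) - D j (B i k) + D k (B i j) = cov2 i B j k - cov2 j B i k + cov2 k B i j" for i j k
    using s[of i "B k" j] s[of i "B j" k] s[of j "B i" k]
    by (simp add: cov2_def L algebra_simps)
  moreover have neg: "(\<lambda>i k l. H k i l) = (\<lambda>i k l. - H i k l)" "(\<lambda>i k l. H l k i) = (\<lambda>i k l. - H i k l)"
    by (intro ext H12 H13)+
  have "inner3 H (\<lambda>i j k. cov2 j B i k) = - inner3 H (\<lambda>i. cov2 i B)"
    by (subst inner3_perm12[symmetric]) (simp only: neg inner3_linear)
  moreover have "cov2 i B k j = - cov2 i B j k" for i j k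
  proof -
    have "D i (B k j) = - D i (B j k)" by (subst B) (simp add: D_simps)
    then show ?thesis by (simp add: cov2_def L)
  qed
  then have neg': "(\<lambda>i j k. cov2 i B k j) = (\<lambda>i j k. - cov2 i B j k)"
    by (intro ext)
  have "inner3 H (\<lambda>i j k. cov2 k B i j) = inner3 H (\<lambda>i. cov2 i B)"
    by (subst inner3_perm13[symmetric]) (simp only: neg neg' inner3_linear minus_minus)
  ultimately show ?thesis
    by (simp add: inner3_linear inner3_commute[of _ H])
qed

text \<open>Turns a gradient term of the evolution into the cross term of the squared skew part of
  the generalized Ricci tensor.\<close>

lemma inner1_div_sq3:
  "inner1 \<alpha> (\<lambda>j. inner2 (codiff H) (H j)) = inner2 (codiff H) (int_prod \<alpha> H)"
proof -
  have "inner1 \<alpha> (\<lambda>j. inner2 (codiff H) (H j)) = tr (\<lambda>i j. inner2 (\<lambda>a b. \<alpha> i * H j a b) (codiff H))"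
    by (simp add: inner1_def inner2_commute[of "codiff H"] inner2_linear)
  also have "\<dots> = inner2 (int_prod \<alpha> H) (codiff H)"
    by (simp add: tr_inner2 int_prod_def[abs_def])
  finally show ?thesis by (simp add: inner2_commute)
qed

lemma inner2_int_prod_self:
  "inner2 (int_prod \<alpha> H) (int_prod \<alpha> H) = inner2 (\<lambda>i j. \<alpha> i * \<alpha> j) (sq3 H)"
proof -
  have *: "inner2 (int_prod \<alpha> H) S = tr (\<lambda>i m. \<alpha> i * inner2 (H m) S)" for S
    using tr_inner2[of "\<lambda>i m a b. \<alpha> i * H m a b" S] by (simp add: inner2_linear int_prod_def[abs_def])
  show ?thesis
    unfolding * inner2_commute[of "H _" "int_prod \<alpha> H"]
    unfolding * inner2_def[of "\<lambda>i j. \<alpha> i * \<alpha> j"] sq3_def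
    by (simp add: mult.assoc tr_mult_left inner2_commute)
qed

end

text \<open>The flow equations with denominators cleared and the potential eliminated: since
  \<open>H\<close> varies by the exterior derivative of the potential, its evolution is minus that
  of \<open>codiff H\<close>.\<close>

locale flow_ring = three_form_ring D G gi Ch H + metric_variation D G gi Ch T
  for D :: "'n::finite \<Rightarrow> 'r::comm_ring_1 \<Rightarrow> 'r" and G gi Ch H T +
  fixes \<phi> :: 'r
  assumes T_G: "2 * T (G i j) = sq3 H i j - 4 * ric i j"
    and T_H: "T (H i j k) = - (D i (codiff H j k) - D j (codiff H i k) + D k (codiff H i j))"
    and T_phi: "6 * (T \<phi> - lap \<phi>) = inner3 H H"
begin

lemma two_h: "2 * h i j = sq3 H i j - 4 * ric i j"
  by (simp add: h_def T_G)

lemma two_inner2_h: "2 * inner2 S h = inner2 S (sq3 H) - 4 * inner2 S ric"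
  by (simp add: two_h flip: inner2_linear)

lemma two_tr_h: "2 * tr h = inner3 H H - 4 * sc"
  by (simp add: two_h sc_def flip: tr_mult_left tr_diff tr_sq3)

text \<open>The contracted Bianchi identity trades the divergence of \<open>ric\<close> for a
  gradient.\<close>

lemma two_div_h: "2 * div2 h j = div2 (sq3 H) j - 2 * D j sc"
proof -
  have "2 * div2 h j = div2 (\<lambda>i j. 2 * h i j) j"
    by (simp add: div2_def cov2_def D_simps low_simps tr_simps algebra_simps)
  also have "\<dots> = div2 (sq3 H) j - 4 * div2 ric j"
    unfolding two_h by (simp add: div2_def cov2_def D_simps low_simps tr_simps algebra_simps)
  finally show ?thesis by (simp flip: contracted_Bianchi)
qed

text \<open>Three inverse metrics contract \<open>H\<close> with itself. Skewness moves the slot of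
  each to the front, so each contributes the same \<open>- inner2 (sq3 H) h\<close>.\<close>

lemma T_inner3_self: "T (inner3 H H) = 2 * inner3 H (\<lambda>i j k. T (H i j k)) - 3 * inner2 (sq3 H) h"
proof -
  have neg: "tr (\<lambda>i l. tr (\<lambda>k n. H i j k * H l m n)) = sq3 H j m"
    "tr (\<lambda>i l. tr (\<lambda>k n. H i k j * H l n m)) = sq3 H j m" for j m
  proof -
    have "H i j k * H l m n = H j i k * H m l n" for i k l n
      by (subst H12, subst (2) H12) simp
    then show 1: "tr (\<lambda>i l. tr (\<lambda>k n. H i j k * H l m n)) = sq3 H j m"
      by (simp add: sq3_def inner2_def)
    have "H i k j * H l n m = H i j k * H l m n" for i k l n
      by (subst H23, subst (2) H23) simp
    then show "tr (\<lambda>i l. tr (\<lambda>k n. H i k j * H l n m)) = sq3 H j m"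
      by (simp add: 1)
  qed
  have "T (inner3 H H) = inner3 (\<lambda>i j k. T (H i j k)) H + inner3 H (\<lambda>i j k. T (H i j k))
     - tr (\<lambda>i l. tr (\<lambda>j m. inner2 (\<lambda>k n. H i j k * H l m n) h))
     - tr (\<lambda>i l. inner2 (\<lambda>j m. tr (\<lambda>k n. H i j k * H l m n)) h)
     - inner2 (\<lambda>i l. inner2 (H i) (H l)) h"
    unfolding inner3_def
    by (simp add: T_tr inner2_def[of "H _" "H _"] tr_simps T_simps)
       (simp add: inner2_def[of _ "H _"] inner2_def[of "H _" "\<lambda>j. _ j"])
  also have "tr (\<lambda>i l. inner2 (\<lambda>j m. tr (\<lambda>k n. H i j k * H l m n)) h) = inner2 (sq3 H) h"
    unfolding tr_inner2 neg ..
  also have "tr (\<lambda>i l. tr (\<lambda>j m. inner2 (\<lambda>k n. H i j k * H l m n) h)) = inner2 (sq3 H) h"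
    unfolding tr_inner2 neg ..
  also have "(\<lambda>i l. inner2 (H i) (H l)) = sq3 H"
    by (simp add: sq3_def[abs_def])
  finally show ?thesis
    using inner3_commute[of "\<lambda>i j k. T (H i j k)" H] by simp
qed

text \<open>Multiples of the generalized Ricci and scalar curvatures, since the ring has no fractions.\<close>

definition gen_Ric4 :: "'n \<Rightarrow> 'n \<Rightarrow> 'r" where
  "gen_Ric4 i j = 4 * ric i j - sq3 H i j + 4 * hess \<phi> i j - 2 * (codiff H i j + int_prod (\<lambda>i. D i \<phi>) H i j)"

definition gen_scal12 :: 'r where
  "gen_scal12 = 12 * sc - inner3 H H + 24 * lap \<phi> - 12 * inner1 (\<lambda>i. D i \<phi>) (\<lambda>i. D i \<phi>)"

lemma lap_linear:
  "lap (x + y) = lap x + lap y" "lap (x - y) = lap x - lap y" "lap (numeral w * x) = numeral w * lap x"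
  by (simp_all add: lap_def cov1_def D_simps low_simps tr_simps algebra_simps)

text \<open>With \<open>gen_scal12\<close> scaled by 12 and \<open>gen_Ric4\<close> by 4, both sides
  are 24 times those of the evolution equation: 2 times 12 on the left, 3 times 16 against 24 times
  2 on the right.\<close>

theorem heat_gen_scal12: "2 * (T gen_scal12 - lap gen_scal12) = 3 * inner2 gen_Ric4 gen_Ric4"
proof -
  define \<alpha> where "\<alpha> = (\<lambda>i. D i \<phi>)"
  define Q where "Q = sq3 H"
  define N where "N = inner3 H H"
  define B where "B = codiff H"
  define C where "C = int_prod \<alpha> H"
  define E where "E = hess \<phi>"
  define aN where "aN = inner1 \<alpha> (\<lambda>i. D i N)"
  define aR where "aR = inner1 \<alpha> (\<lambda>i. D i sc)"
  define aL where "aL = inner1 \<alpha> (\<lambda>i. D i (lap \<phi>))"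
  define DB where "DB = inner3 (\<lambda>i. cov2 i B) H"
  define aa where "aa = (\<lambda>i j. \<alpha> i * \<alpha> j)"
  note defs = Q_def N_def B_def C_def E_def \<alpha>_def
  have Tphi: "6 * T \<phi> = 6 * lap \<phi> + N"
    using T_phi by (simp add: N_def algebra_simps)
  have DTphi: "6 * D i (T \<phi>) = 6 * D i (lap \<phi>) + D i N" for i
    using arg_cong[OF Tphi, of "D i"] by (simp add: D_simps)
  have ddh: "2 * div1 (div2 h) = div1 (div2 Q) - 2 * lap sc"
  proof -
    have "2 * div1 (div2 h) = div1 (\<lambda>j. 2 * div2 h j)"
      by (simp add: div1_def cov1_def D_simps low_simps tr_simps algebra_simps)
    then show ?thesis
      unfolding two_div_h Q_def by (simp add: div1_def lap_def cov1_def D_simps low_simps tr_simps algebra_simps)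
  qed
  have lap_h: "2 * lap (tr h) = lap N - 4 * lap sc"
    using arg_cong[OF two_tr_h, of lap] by (simp add: lap_linear N_def)
  have ddQ: "6 * div1 (div2 Q) = lap N - 6 * DB + 6 * inner2 B B"
    using div_div_sq3 by (simp add: defs DB_def)
  have ih: "2 * inner2 S h = inner2 S Q - 4 * inner2 S ric" for S
    using two_inner2_h by (simp add: Q_def)
  \<comment> \<open>The coefficient -10 is 2 from the double divergence of \<open>Q\<close> and -12
    from the Laplacian of \<open>tr h\<close>.\<close>
  have e1: "24 * T sc = 24 * lap sc - 10 * lap N - 12 * DB + 12 * inner2 B B + 48 * inner2 ric ric - 12 * inner2 ric Q"
  proof -
    have "24 * T sc = 12 * (2 * div1 (div2 h)) - 12 * (2 * lap (tr h)) - 12 * (2 * inner2 ric h)"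
      by (simp add: T_sc algebra_simps)
    also have "\<dots> = 2 * (6 * div1 (div2 Q)) + 24 * lap sc - 12 * lap N - 12 * inner2 ric Q + 48 * inner2 ric ric"
      unfolding ddh lap_h ih by (simp add: algebra_simps)
    finally show ?thesis unfolding ddQ by (simp add: algebra_simps)
  qed
  \<comment> \<open>\<open>DB\<close> has the same coefficient as in \<open>e1\<close> and
    disappears when the two are subtracted.\<close>
  have e2: "2 * T N = 12 * inner2 ric Q - 3 * inner2 Q Q - 12 * DB"
  proof -
    have "inner3 H (\<lambda>i j k. T (H i j k)) = - 3 * DB"
      unfolding T_H inner3_linear(3) DB_def B_def by (subst inner3_d_two) (simp_all flip: codiff_skew)
    then have "2 * T N = - 12 * DB - 3 * (2 * inner2 Q h)"
      unfolding N_def T_inner3_self Q_def by (simp add: algebra_simps)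
    then show ?thesis
      unfolding ih inner2_commute[of Q ric] by (simp add: algebra_simps)
  qed
  \<comment> \<open>The terms \<open>aR\<close> from the divergence of \<open>h\<close> and from the
    gradient of \<open>tr h\<close> cancel; \<open>8 * lap N\<close> is the effect of the dilaton
    source.\<close>
  have e3: "48 * T (lap \<phi>) = 48 * lap (lap \<phi>) + 8 * lap N + 96 * inner2 ric E - 24 * inner2 E Q + 24 * inner2 B C + 8 * aN"
  proof -
    have 1: "6 * inner1 \<alpha> (div2 Q) = aN - 6 * inner2 B C"
    proof -
      have "6 * inner1 \<alpha> (div2 Q) = inner1 \<alpha> (\<lambda>j. 6 * div2 Q j)"
        by (simp add: inner1_linear)
      also have "\<dots> = aN - 6 * inner1 \<alpha> (\<lambda>j. inner2 B (H j))"
        unfolding Q_def div_sq3 by (simp add: inner1_linear aN_def N_def B_def)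
      finally show ?thesis by (simp add: inner1_div_sq3 B_def C_def)
    qed
    have 2: "2 * inner1 \<alpha> (div2 h) = inner1 \<alpha> (div2 Q) - 2 * aR"
      unfolding Q_def aR_def by (simp add: two_div_h flip: inner1_linear)
    have 3: "2 * inner1 \<alpha> (\<lambda>i. D i (tr h)) = aN - 4 * aR"
    proof -
      have "2 * D i (tr h) = D i N - 4 * D i sc" for i
        using arg_cong[OF two_tr_h, of "D i"] by (simp add: D_simps N_def)
      then show ?thesis unfolding aN_def aR_def by (simp flip: inner1_linear)
    qed
    have 4: "6 * lap (T \<phi>) = 6 * lap (lap \<phi>) + lap N"
      using arg_cong[OF Tphi, of lap] by (simp add: lap_linear)
    have "48 * T (lap \<phi>) = 24 * (2 * T (lap \<phi>))" by simp
    also have "\<dots> = 8 * (6 * lap (T \<phi>)) - 24 * (2 * inner2 E h) - 24 * (2 * inner1 \<alpha> (div2 h)) + 12 * (2 * inner1 \<alpha> (\<lambda>i. D i (tr h)))"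
      unfolding T_lap E_def \<alpha>_def by (simp add: algebra_simps)
    also have "\<dots> = 48 * lap (lap \<phi>) + 8 * lap N - 24 * inner2 E Q + 96 * inner2 E ric - 4 * (6 * inner1 \<alpha> (div2 Q)) + 12 * aN"
      unfolding 2 3 4 ih by (simp add: algebra_simps)
    finally show ?thesis
      unfolding 1 by (simp add: inner2_commute[of E ric] algebra_simps) 
  qed
  \<comment> \<open>Bochner's formula is read backwards: it absorbs \<open>aL\<close> and the Ricci
    term into the Laplacian of the squared gradient, at the price of the squared Hessian.\<close>
  have e4: "24 * T (inner1 \<alpha> \<alpha>) = 24 * lap (inner1 \<alpha> \<alpha>) + 8 * aN - 12 * inner2 aa Q - 48 * inner2 E E"
  proof -
    have 1: "6 * inner1 \<alpha> (\<lambda>i. D i (T \<phi>)) = 6 * aL + aN"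
      unfolding aL_def aN_def by (simp add: DTphi flip: inner1_linear)
    have "24 * T (inner1 \<alpha> \<alpha>) = 8 * (6 * inner1 \<alpha> (\<lambda>i. D i (T \<phi>))) - 12 * (2 * inner2 aa h)"
      unfolding \<alpha>_def aa_def T_inner1_self by (simp add: algebra_simps)
    also have "\<dots> = 48 * aL + 8 * aN - 12 * inner2 aa Q + 48 * inner2 aa ric"
      unfolding 1 ih by (simp add: algebra_simps)
    finally have "24 * T (inner1 \<alpha> \<alpha>) = 48 * aL + 8 * aN - 12 * inner2 aa Q + 48 * inner2 aa ric" .
    moreover have "lap (inner1 \<alpha> \<alpha>) = 2 * inner2 E E + 2 * aL + 2 * inner2 aa ric"
      unfolding aL_def E_def aa_def \<alpha>_def by (rule lap_inner1_self)
    ultimately show ?thesis by (simp add: algebra_simps)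
  qed
  have r: "inner2 gen_Ric4 gen_Ric4 = 16 * inner2 ric ric - 8 * inner2 ric Q + inner2 Q Q + 32 * inner2 ric E
     - 8 * inner2 E Q + 16 * inner2 E E + 4 * (inner2 B B + 2 * inner2 B C + inner2 aa Q)"
  proof -
    define S where "S = (\<lambda>i j. 4 * ric i j - Q i j + 4 * E i j)"
    define A where "A = (\<lambda>i j. B i j + C i j)"
    have g: "gen_Ric4 = (\<lambda>i j. S i j - 2 * A i j)"
      by (simp add: gen_Ric4_def S_def A_def defs fun_eq_iff)
    have "inner2 S A = 0"
    proof (rule inner2_sym_skew)
      show "S i j = S j i" for i j
        using ric_sym[of i j] sq3_sym[of H i j] hess_sym[of i \<phi> j] by (simp add: S_def Q_def E_def)
      show "A i j = - A j i" for i j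
        using codiff_skew[of i j] int_prod_skew[of \<alpha> i j] by (simp add: A_def B_def C_def)
    qed
    then have "inner2 gen_Ric4 gen_Ric4 = inner2 S S + 4 * inner2 A A"
      using inner2_commute[of A S] by (simp add: g inner2_linear)
    moreover have "inner2 A A = inner2 B B + 2 * inner2 B C + inner2 C C"
      using inner2_commute[of B C] by (simp add: A_def inner2_linear algebra_simps)
    moreover have "inner2 C C = inner2 aa Q"
      unfolding C_def aa_def Q_def by (rule inner2_int_prod_self)
    moreover have "inner2 S S = 16 * inner2 ric ric - 8 * inner2 ric Q + inner2 Q Q + 32 * inner2 ric E
     - 8 * inner2 E Q + 16 * inner2 E E"
      using inner2_commute[of Q E] inner2_commute[of E ric] inner2_commute[of Q ric]
      unfolding S_def inner2_linear by (simp add: algebra_simps)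
    ultimately show ?thesis by simp
  qed
  have "2 * (T gen_scal12 - lap gen_scal12) = 24 * T sc - 24 * lap sc - 2 * T N + 2 * lap N + 48 * T (lap \<phi>) - 48 * lap (lap \<phi>)
     - 24 * T (inner1 \<alpha> \<alpha>) + 24 * lap (inner1 \<alpha> \<alpha>)"
    unfolding gen_scal12_def N_def \<alpha>_def lap_linear T_simps by (simp add: algebra_simps)
  then show ?thesis
    unfolding e1 e2 e3 e4 r by (simp add: algebra_simps)
qed

end

section \<open>Tangent vectors in a chart\<close>

lemma smooth_onE:
  assumes "smooth_on S f" "x \<in> S"
  obtains W F where "open W" "x \<in> W" "\<forall>k. Ck_on k W F" "\<forall>y\<in>S \<inter> W. F y = f y"
proof -
  have "\<exists>W F. open W \<and> x \<in> W \<and> (\<forall>k. Ck_on k W F) \<and> (\<forall>y\<in>S \<inter> W. F y = f y)"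
    using assms unfolding smooth_on_def by (rule bspec)
  then obtain W F where "open W \<and> x \<in> W \<and> (\<forall>k. Ck_on k W F) \<and> (\<forall>y\<in>S \<inter> W. F y = f y)"
    by (elim exE)
  then show ?thesis
    by (intro that[of W F]) auto
qed

lemma smooth_on_subset: "smooth_on S f \<Longrightarrow> S' \<subseteq> S \<Longrightarrow> smooth_on S' f"
proof -
  assume f: "smooth_on S f" and S: "S' \<subseteq> S"
  show "smooth_on S' f"
    unfolding smooth_on_def
  proof
    fix x assume "x \<in> S'"
    then obtain W F where W: "open W" "x \<in> W" "\<forall>k. Ck_on k W F" "\<forall>y\<in>S \<inter> W. F y = f y"
      using S by (blast intro: smooth_onE[OF f])
    then show "\<exists>W F. open W \<and> x \<in> W \<and> (\<forall>k. Ck_on k W F) \<and> (\<forall>y\<in>S' \<inter> W. F y = f y)"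
      using S by (intro exI[of _ W] exI[of _ F]) auto
  qed
qed

lemma smooth_on_binop:
  fixes f g :: "'e::euclidean_space \<Rightarrow> real"
  assumes f: "smooth_on S f" and g: "smooth_on S g"
    and C: "\<And>k (W :: 'e set) F G. open W \<Longrightarrow> Ck_on k W F \<Longrightarrow> Ck_on k W G \<Longrightarrow> Ck_on k W (\<lambda>x. b (F x) (G x))"
  shows "smooth_on S (\<lambda>x. b (f x) (g x))"
  unfolding smooth_on_def
proof
  fix x assume x: "x \<in> S"
  obtain W F where W: "open W" "x \<in> W" "\<forall>k. Ck_on k W F" "\<forall>y\<in>S \<inter> W. F y = f y"
    by (rule smooth_onE[OF f x])
  obtain W' G where W': "open W'" "x \<in> W'" "\<forall>k. Ck_on k W' G" "\<forall>y\<in>S \<inter> W'. G y = g y"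
    by (rule smooth_onE[OF g x])
  have "Ck_on k (W \<inter> W') (\<lambda>x. b (F x) (G x))" for k
    using W W' by (intro C) (auto intro: Ck_on_subset)
  then show "\<exists>W F. open W \<and> x \<in> W \<and> (\<forall>k. Ck_on k W F) \<and> (\<forall>y\<in>S \<inter> W. F y = b (f y) (g y))"
    using W W' by (intro exI[of _ "W \<inter> W'"] exI[of _ "\<lambda>x. b (F x) (G x)"]) auto
qed

lemma smooth_on_bounded_linear:
  assumes f: "smooth_on S f" and L: "bounded_linear L"
  shows "smooth_on S (\<lambda>x. L (f x))"
  unfolding smooth_on_def
proof
  fix x assume x: "x \<in> S"
  obtain W F where W: "open W" "x \<in> W" "\<forall>k. Ck_on k W F" "\<forall>y\<in>S \<inter> W. F y = f y"
    by (rule smooth_onE[OF f x])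
  have "Ck_on k W (\<lambda>x. L (F x))" for k
    using Ck_on_bounded_linear[OF L W(1)] W(3) by blast
  then show "\<exists>W F. open W \<and> x \<in> W \<and> (\<forall>k. Ck_on k W F) \<and> (\<forall>y\<in>S \<inter> W. F y = L (f y))"
    using W by (intro exI[of _ W] exI[of _ "\<lambda>x. L (F x)"]) auto
qed

lemma smooth_on_open_imp_differentiable:
  assumes "smooth_on S f" "open S" "x \<in> S"
  shows "f differentiable (at x)"
proof -
  obtain W F where W: "open W" "x \<in> W" "\<forall>k. Ck_on k W F" "\<forall>y\<in>S \<inter> W. F y = f y"
    by (rule smooth_onE[OF assms(1,3)])
  have "(F has_derivative frechet_derivative F (at x)) (at x)"
    by (rule Ck_on_Suc_deriv[OF W(3)[rule_format, of "Suc 0"] W(2)])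
  then have "(f has_derivative frechet_derivative F (at x)) (at x)"
    by (rule has_derivative_transform_within_open[of _ _ _ _ "S \<inter> W"]) (use assms W in auto)
  then show ?thesis by (auto simp: differentiable_def)
qed

lemma smooth_near_binop:
  assumes f: "smooth_near M A p f" and g: "smooth_near M A p g"
    and C: "\<And>k (W :: (real ^ 'n::finite) set) F G. open W \<Longrightarrow> Ck_on k W F \<Longrightarrow> Ck_on k W G \<Longrightarrow> Ck_on k W (\<lambda>x. b (F x) (G x))"
  shows "smooth_near M (A :: ('a, 'n) chart set) p (\<lambda>q. b (f q) (g q))"
proof -
  obtain W W' where W: "openin M W" "p \<in> W" "\<And>c. c \<in> A \<Longrightarrow> smooth_on (cmap c ` (cdom c \<inter> W)) (f \<circ> cinv c)"
    and W': "openin M W'" "p \<in> W'" "\<And>c. c \<in> A \<Longrightarrow> smooth_on (cmap c ` (cdom c \<inter> W')) (g \<circ> cinv c)"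
    using f g unfolding smooth_near_def by meson
  have "smooth_on (cmap c ` (cdom c \<inter> (W \<inter> W'))) ((\<lambda>q. b (f q) (g q)) \<circ> cinv c)" if "c \<in> A" for c
    unfolding o_def
  proof (rule smooth_on_binop[OF _ _ C])
    show "smooth_on (cmap c ` (cdom c \<inter> (W \<inter> W'))) (\<lambda>x. f (cinv c x))"
      "smooth_on (cmap c ` (cdom c \<inter> (W \<inter> W'))) (\<lambda>x. g (cinv c x))"
      using W(3)[OF that] W'(3)[OF that] by (auto simp: o_def elim!: smooth_on_subset)
  qed
  then show ?thesis
    unfolding smooth_near_def using W W' by (intro exI[of _ "W \<inter> W'"]) auto
qed

lemma tangent_space_lincomb:
  assumes "X \<in> tangent_space M A p" "Y \<in> tangent_space M A p"
  shows "(\<lambda>f. r * X f + s * Y f) \<in> tangent_space M A p"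
  using assms unfolding tangent_space_def by (simp add: algebra_simps)

lemma tangent_space_0: "(\<lambda>f. 0) \<in> tangent_space M A p"
  by (simp add: tangent_space_def)

locale manifold_chart =
  fixes M :: "'a topology" and A :: "('a, 'n::finite) chart set" and c :: "('a, 'n) chart"
  assumes M: "smooth_manifold M A" and c: "c \<in> A"
begin

lemma chart_open: "open (cmap c ` cdom c)"
  and chart_dom: "openin M (cdom c)"
  and chart_homeo: "homeomorphic_map (subtopology M (cdom c)) (top_of_set (cmap c ` cdom c)) (cmap c)"
  using M c unfolding smooth_manifold_def is_chart_def by blast+

lemma cdom_topspace: "cdom c \<subseteq> topspace M"
  using chart_dom by (rule openin_subset)

lemma chart_inj: "inj_on (cmap c) (cdom c)"
  using homeomorphic_imp_injective_map[OF chart_homeo] cdom_topspace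
  by (simp add: Int_absorb1)

lemma open_chart_image:
  assumes "openin M W"
  shows "open (cmap c ` (cdom c \<inter> W))"
proof -
  have "openin (subtopology M (cdom c)) (cdom c \<inter> W)"
    using assms by (auto simp: openin_subtopology)
  then have "openin (top_of_set (cmap c ` cdom c)) (cmap c ` (cdom c \<inter> W))"
    using homeomorphic_imp_open_map[OF chart_homeo] by (simp add: open_map_def)
  then show ?thesis
    using chart_open openin_open_trans by blast
qed

lemma cinv_cmap: "q \<in> cdom c \<Longrightarrow> cinv c (cmap c q) = q"
  by (simp add: cinv_def chart_inj)

lemma smooth_near_differentiable:
  assumes "smooth_near M A p f" "p \<in> cdom c"
  shows "(f \<circ> cinv c) differentiable (at (cmap c p))"
  using assms c unfolding smooth_near_def
  by (auto intro: smooth_on_open_imp_differentiable open_chart_image)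

text \<open>Symmetry, positivity and skewness of the fields are known on tangent vectors; this
  transfers them to components.\<close>

lemma coord_vec_tangent:
  assumes p: "p \<in> cdom c"
  shows "coord_vec M A c i p \<in> tangent_space M A p"
  unfolding tangent_space_def mem_Collect_eq
proof (intro conjI allI impI)
  fix f h assume f: "smooth_near M A p f" and h: "smooth_near M A p h"
  define F where "F = frechet_derivative (f \<circ> cinv c) (at (cmap c p))"
  define K where "K = frechet_derivative (h \<circ> cinv c) (at (cmap c p))"
  have F: "((\<lambda>y. f (cinv c y)) has_derivative F) (at (cmap c p))"
    using smooth_near_differentiable[OF f p] by (simp add: F_def o_def frechet_derivative_works)
  have K: "((\<lambda>y. h (cinv c y)) has_derivative K) (at (cmap c p))"
    using smooth_near_differentiable[OF h p] by (simp add: K_def o_def frechet_derivative_works)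
  fix a b :: real
  have "smooth_near M A p (\<lambda>q. a * f q + b * h q)"
    by (rule smooth_near_binop[OF f h]) (intro Ck_on_add Ck_on_mult Ck_on_const)
  moreover have "((\<lambda>y. a * f (cinv c y) + b * h (cinv c y)) has_derivative (\<lambda>v. a * F v + b * K v)) (at (cmap c p))"
    by (intro has_derivative_add has_derivative_mult_right F K)
  ultimately show "coord_vec M A c i p (\<lambda>q. a * f q + b * h q) = a * coord_vec M A c i p f + b * coord_vec M A c i p h"
    using f h F K by (simp add: coord_vec_def coord_deriv_def o_def flip: frechet_derivative_at)
next
  fix f h assume f: "smooth_near M A p f" and h: "smooth_near M A p h"
  define F where "F = frechet_derivative (f \<circ> cinv c) (at (cmap c p))"
  define K where "K = frechet_derivative (h \<circ> cinv c) (at (cmap c p))"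
  have F: "((\<lambda>y. f (cinv c y)) has_derivative F) (at (cmap c p))"
    using smooth_near_differentiable[OF f p] by (simp add: F_def o_def frechet_derivative_works)
  have K: "((\<lambda>y. h (cinv c y)) has_derivative K) (at (cmap c p))"
    using smooth_near_differentiable[OF h p] by (simp add: K_def o_def frechet_derivative_works)
  have "smooth_near M A p (\<lambda>q. f q * h q)"
    by (rule smooth_near_binop[OF f h]) (intro Ck_on_mult)
  moreover have "((\<lambda>y. f (cinv c y) * h (cinv c y)) has_derivative
      (\<lambda>v. f (cinv c (cmap c p)) * K v + F v * h (cinv c (cmap c p)))) (at (cmap c p))"
    by (intro has_derivative_mult F K)
  ultimately show "coord_vec M A c i p (\<lambda>q. f q * h q) = f p * coord_vec M A c i p h + h p * coord_vec M A c i p f"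
    using f h F K p by (simp add: coord_vec_def coord_deriv_def o_def cinv_cmap flip: frechet_derivative_at)
qed (simp add: coord_vec_def)

text \<open>Smooth transition maps make the coordinates of \<open>c\<close> smooth in every chart,
  hence admissible arguments of tangent vectors. They separate the coordinate vectors.\<close>

lemma coord_vec_coordinate:
  assumes p: "p \<in> cdom c"
  shows "coord_vec M A c i p (\<lambda>q. cmap c q $ k) = (if i = k then 1 else 0)"
proof -
  have "smooth_on (cmap d ` (cdom d \<inter> cdom c)) ((\<lambda>q. cmap c q $ k) \<circ> cinv d)" if "d \<in> A" for d
  proof -
    have "smooth_on (cmap d ` (cdom d \<inter> cdom c)) (cmap c \<circ> cinv d)"
      using M c that by (simp add: smooth_manifold_def)
    from smooth_on_bounded_linear[OF this bounded_linear_vec_nth[of k]] show ?thesis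
      by (simp add: o_def)
  qed
  then have "smooth_near M A p (\<lambda>q. cmap c q $ k)"
    unfolding smooth_near_def using chart_dom p by blast
  moreover have "((\<lambda>y. cmap c (cinv c y) $ k) has_derivative (\<lambda>v. v $ k)) (at (cmap c p))"
  proof (rule has_derivative_transform_within_open[OF _ chart_open])
    show "((\<lambda>y. y $ k) has_derivative (\<lambda>v. v $ k)) (at (cmap c p))"
      by (intro bounded_linear_imp_has_derivative bounded_linear_vec_nth)
  qed (use p in \<open>auto simp: cinv_cmap\<close>)
  ultimately show ?thesis
    by (auto simp: coord_vec_def coord_deriv_def o_def axis_def simp flip: frechet_derivative_at)
qed

lemma metric_comp_sym:
  assumes "Riemannian_metric M A g" "p \<in> cdom c"
  shows "comp2 M A c g i j p = comp2 M A c g j i p"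
  using assms coord_vec_tangent cdom_topspace by (auto simp: Riemannian_metric_def comp2_def)

text \<open>A vector in the kernel of the Gram matrix gives a tangent vector of length \<open>0\<close>, and the coordinates of
  a tangent vector are recovered by applying it to the coordinate functions.\<close>

lemma metric_comp_det:
  assumes g: "Riemannian_metric M A g" and p: "p \<in> cdom c"
  shows "det (\<chi> i j. comp2 M A c g i j p) \<noteq> 0"
proof -
  let ?T = "tangent_space M A p"
  define e where "e i = coord_vec M A c i p" for i
  have e: "e i \<in> ?T" for i unfolding e_def by (rule coord_vec_tangent[OF p])
  have pM: "p \<in> topspace M" using p cdom_topspace by blast
  have sym: "g p X Y = g p Y X" if "X \<in> ?T" "Y \<in> ?T" for X Y
    using g that pM by (auto simp: Riemannian_metric_def)
  have lin: "g p (\<lambda>f. a * X f + b * Y f) Z = a * g p X Z + b * g p Y Z"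
    if "X \<in> ?T" "Y \<in> ?T" "Z \<in> ?T" for X Y Z a b
    using g that pM unfolding Riemannian_metric_def by blast
  \<comment> \<open>Both claims are proved together, since linearity may be applied only to sums
    already known to be tangent. The factor 1 below fits the sum into a two-term linear
    combination.\<close>
  have sums: "(\<lambda>f. \<Sum>i\<in>S. x i * e i f) \<in> ?T \<and>
     (\<forall>Z\<in>?T. g p (\<lambda>f. \<Sum>i\<in>S. x i * e i f) Z = (\<Sum>i\<in>S. x i * g p (e i) Z))"
    if "finite S" for S x
    using that
  proof (induction S)
    case empty
    have "g p (\<lambda>f. 0) Z = 0" if "Z \<in> ?T" for Z
      using lin[OF tangent_space_0 tangent_space_0 that, of 0 0] by simp
    then show ?case by (simp add: tangent_space_0)
  next
    case (insert i S)
    then have "(\<lambda>f. x i * e i f + 1 * (\<Sum>i\<in>S. x i * e i f)) \<in> ?T"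
      by (intro tangent_space_lincomb e) auto
    moreover have "g p (\<lambda>f. x i * e i f + 1 * (\<Sum>i\<in>S. x i * e i f)) Z =
       x i * g p (e i) Z + 1 * (\<Sum>i\<in>S. x i * g p (e i) Z)" if "Z \<in> ?T" for Z
      using insert that by (subst lin[OF e]) auto
    ultimately show ?case using insert by simp
  qed
  have "x = 0" if x: "(\<chi> i j. comp2 M A c g i j p) *v x = 0" for x
  proof -
    have x0: "(\<Sum>j\<in>UNIV. x $ j * g p (e j) (e i)) = 0" for i
    proof -
      have "((\<chi> i j. comp2 M A c g i j p) *v x) $ i = 0" using x by simp
      then show ?thesis
        using sym[OF e e] by (simp add: matrix_vector_mult_def comp2_def e_def mult.commute)
    qed
    define X where "X = (\<lambda>f. \<Sum>i\<in>UNIV. x $ i * e i f)"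
    have X: "X \<in> ?T" "\<And>Z. Z \<in> ?T \<Longrightarrow> g p X Z = (\<Sum>i\<in>UNIV. x $ i * g p (e i) Z)"
      using sums[OF finite_class.finite_UNIV, of "\<lambda>i. x $ i"] by (auto simp: X_def)
    have "g p X X = (\<Sum>i\<in>UNIV. x $ i * g p X (e i))"
      using X sym[OF e X(1)] by simp
    also have "\<dots> = 0" using X(2)[OF e] x0 by simp
    finally have "g p X X = 0" .
    then have "X = (\<lambda>f. 0)"
      using g pM X(1) unfolding Riemannian_metric_def by (metis less_irrefl)
    then have "X (\<lambda>q. cmap c q $ k) = 0" for k by simp
    then have "x $ k = 0" for k
      unfolding X_def e_def coord_vec_coordinate[OF p] by (simp add: if_distrib cong: if_cong)
    then show "x = 0" by (simp add: vec_eq_iff)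
  qed
  then show ?thesis
    by (metis invertible_det_nz invertible_left_inverse matrix_left_invertible_ker)
qed

lemma three_form_comp_skew:
  assumes "three_form M A H" "p \<in> cdom c"
  shows "comp3 M A c H i j k p = - comp3 M A c H j i k p" "comp3 M A c H i j k p = - comp3 M A c H i k j p"
  using assms coord_vec_tangent cdom_topspace unfolding three_form_def comp3_def by (meson subsetD)+

end

section \<open>Jets of tensor fields\<close>

context metric_ring
begin

lemma inner2_alt: "inner2 S T = (\<Sum>i\<in>UNIV. \<Sum>j\<in>UNIV. \<Sum>k\<in>UNIV. \<Sum>l\<in>UNIV. gi i k * gi j l * S i j * T k l)"
proof -
  have "inner2 S T = (\<Sum>i\<in>UNIV. \<Sum>k\<in>UNIV. \<Sum>j\<in>UNIV. \<Sum>l\<in>UNIV. gi i k * gi j l * S i j * T k l)"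
    by (simp add: inner2_def tr_def sum_distrib_left mult.assoc)
  also have "\<dots> = (\<Sum>i\<in>UNIV. \<Sum>j\<in>UNIV. \<Sum>k\<in>UNIV. \<Sum>l\<in>UNIV. gi i k * gi j l * S i j * T k l)"
    by (rule sum.cong[OF refl], rule sum.swap)
  finally show ?thesis .
qed

lemma inner3_alt: "inner3 S T = (\<Sum>i\<in>UNIV. \<Sum>j\<in>UNIV. \<Sum>k\<in>UNIV. \<Sum>l\<in>UNIV. \<Sum>m\<in>UNIV. \<Sum>n\<in>UNIV.
    gi i l * gi j m * gi k n * S i j k * T l m n)"
proof -
  let ?t = "\<lambda>i j k l m n. gi i l * gi j m * gi k n * S i j k * T l m n"
  have "inner3 S T = (\<Sum>i\<in>UNIV. \<Sum>l\<in>UNIV. \<Sum>j\<in>UNIV. \<Sum>k\<in>UNIV. \<Sum>m\<in>UNIV. \<Sum>n\<in>UNIV. ?t i j k l m n)"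
    by (simp add: inner3_def tr_def inner2_alt sum_distrib_left mult.assoc)
  also have "\<dots> = (\<Sum>i\<in>UNIV. \<Sum>j\<in>UNIV. \<Sum>l\<in>UNIV. \<Sum>k\<in>UNIV. \<Sum>m\<in>UNIV. \<Sum>n\<in>UNIV. ?t i j k l m n)"
    by (rule sum.cong[OF refl], rule sum.swap)
  also have "\<dots> = (\<Sum>i\<in>UNIV. \<Sum>j\<in>UNIV. \<Sum>k\<in>UNIV. \<Sum>l\<in>UNIV. \<Sum>m\<in>UNIV. \<Sum>n\<in>UNIV. ?t i j k l m n)"
    by (rule sum.cong[OF refl], rule sum.cong[OF refl], rule sum.swap)
  finally show ?thesis .
qed

text \<open>Reconciles the chart's norm of a gradient, which applies the metric to raised
  components, with the norm of the differential.\<close>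

lemma inner1_raise:
  "(\<Sum>i\<in>UNIV. \<Sum>j\<in>UNIV. G i j * (\<Sum>a\<in>UNIV. gi i a * \<alpha> a) * (\<Sum>b\<in>UNIV. gi j b * \<beta> b)) = inner1 \<alpha> \<beta>"
proof -
  define v where "v j = (\<Sum>b\<in>UNIV. gi j b * \<beta> b)" for j
  have "(\<Sum>i\<in>UNIV. G i j * (\<Sum>a\<in>UNIV. gi i a * \<alpha> a)) = \<alpha> j" for j
  proof -
    have "(\<Sum>i\<in>UNIV. G i j * (\<Sum>a\<in>UNIV. gi i a * \<alpha> a)) = (\<Sum>i\<in>UNIV. \<Sum>a\<in>UNIV. G j i * gi i a * \<alpha> a)"
      by (simp add: sum_distrib_left mult.assoc G_sym)
    also have "\<dots> = (\<Sum>a\<in>UNIV. (\<Sum>i\<in>UNIV. G j i * gi i a) * \<alpha> a)"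
      by (subst sum.swap) (simp add: sum_distrib_right)
    finally show ?thesis by (simp only: G_gi sum_delta)
  qed
  then have "(\<Sum>j\<in>UNIV. (\<Sum>i\<in>UNIV. G i j * (\<Sum>a\<in>UNIV. gi i a * \<alpha> a)) * v j) = (\<Sum>j\<in>UNIV. \<alpha> j * v j)"
    by simp
  also have "\<dots> = inner1 \<alpha> \<beta>"
    by (simp add: v_def inner1_def tr_def sum_distrib_left mult.left_commute)
  finally show ?thesis
    unfolding v_def[symmetric] by (subst sum.swap) (simp add: sum_distrib_right)
qed

lemma int_prod_alt: "int_prod \<alpha> H j k = (\<Sum>i\<in>UNIV. (\<Sum>m\<in>UNIV. gi i m * \<alpha> m) * H i j k)"
proof -
  have "int_prod \<alpha> H j k = (\<Sum>i\<in>UNIV. \<Sum>m\<in>UNIV. gi m i * \<alpha> i * H m j k)"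
    by (simp add: int_prod_def tr_def mult.assoc gi_sym)
  then show ?thesis by (subst (asm) sum.swap) (simp add: sum_distrib_right)
qed

end

lemma derivation_jet_deriv: "derivation (jet_deriv d)"
  by (simp add: derivation_def jet_deriv_add jet_deriv_mult)

context chart_time_point
begin

lemma family_deriv_Some: "family_deriv I c (Some i) u = (\<lambda>t p. coord_deriv c i (u t) p)"
  by (simp add: family_deriv_def fun_eq_iff)

lemma family_deriv_None: "family_deriv I c None u = (\<lambda>t p. time_deriv I (\<lambda>s. u s p) t)"
  by (simp add: family_deriv_def fun_eq_iff)

lemma sm_coord_deriv [simp]: "sm u \<Longrightarrow> sm (\<lambda>t p. coord_deriv c i (u t) p)"
  using sm_family_deriv[of u "Some i"] by (simp only: family_deriv_Some)

lemma J_coord_deriv: "sm u \<Longrightarrow> J (\<lambda>t p. coord_deriv c i (u t) p) = jet_deriv (Some i) (J u)"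
  using J_family_deriv[of u "Some i"] by (simp only: family_deriv_Some)

lemma J_time_deriv: "sm u \<Longrightarrow> J (\<lambda>t p. time_deriv I (\<lambda>s. u s p) t) = jet_deriv None (J u)"
  using J_family_deriv[of u None] by (simp only: family_deriv_None)

lemma sm_divide_const [simp]: "sm u \<Longrightarrow> sm (\<lambda>t p. u t p / r)"
  using sm_mult[of u "\<lambda>t p. 1 / r"] by simp

lemma J_numeral_mult: "sm u \<Longrightarrow> J (\<lambda>t p. numeral w * u t p) = numeral w * J u"
  by (simp add: J_mult J_numeral)

lemmas J_simps = J_add J_mult J_diff J_minus J_sum J_0 J_1 J_numeral J_coord_deriv

text \<open>The extension ignores time. This serves the fixed three-form to which the exterior
  derivative of the potential is added.\<close>

lemma sm_static:
  assumes "smooth_fun c f"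
  shows "sm (\<lambda>t. f)"
  unfolding sm_iff
proof (intro ballI)
  fix t p assume "t \<in> I" "p \<in> cdom c"
  then obtain W F where W: "open W" "cmap c p \<in> W" "\<forall>k. Ck_on k W F" "\<forall>y\<in>cmap c ` cdom c \<inter> W. F y = (f \<circ> cinv c) y"
    using smooth_onE[OF assms[unfolded smooth_fun_def], of "cmap c p"] by blast
  have "Ck_on k (snd -` W) (\<lambda>x :: real \<times> (real ^ 'n). F (snd x))" for k
    using W by (intro Ck_on_compose_linear bounded_linear_snd) auto
  then have "ext_on (snd -` W) (\<lambda>x. F (snd x)) (\<lambda>t. f)"
    using W by (auto simp: ext_on_def intro!: open_vimage_snd)
  then show "\<exists>W F. (t, cmap c p) \<in> W \<and> ext_on W F (\<lambda>t. f)"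
    using W(2) by (intro exI[of _ "snd -` W"] exI[of _ "\<lambda>x. F (snd x)"]) auto
qed

end

section \<open>A time-dependent metric in a chart\<close>

locale metric_chart = chart_time_point I c t0 p0
  for I and c :: "('a, 'n::finite) chart" and t0 p0 +
  fixes G :: "real \<Rightarrow> 'n \<Rightarrow> 'n \<Rightarrow> 'a \<Rightarrow> real"
  assumes sm_G [simp]: "sm (\<lambda>t. G t i j)"
    and G_sym: "\<And>t p. t \<in> I \<Longrightarrow> p \<in> cdom c \<Longrightarrow> G t i j p = G t j i p"
    and G_det: "\<And>t p. t \<in> I \<Longrightarrow> p \<in> cdom c \<Longrightarrow> det (\<chi> i j. G t i j p) \<noteq> 0"
begin

text \<open>\<open>matrix_inv\<close> is a chosen two-sided inverse; nondegeneracy ensures that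
  there is one to choose.\<close>

lemma matrix_inv_G:
  assumes "t \<in> I" "p \<in> cdom c"
  shows "(\<chi> i j. G t i j p) ** matrix_inv (\<chi> i j. G t i j p) = mat 1"
    "matrix_inv (\<chi> i j. G t i j p) ** (\<chi> i j. G t i j p) = mat 1"
proof -
  have "invertible (\<chi> i j. G t i j p)"
    using G_det[OF assms] by (simp add: invertible_det_nz)
  from someI_ex[OF this[unfolded invertible_def]]
  show "(\<chi> i j. G t i j p) ** matrix_inv (\<chi> i j. G t i j p) = mat 1"
    "matrix_inv (\<chi> i j. G t i j p) ** (\<chi> i j. G t i j p) = mat 1"
    unfolding matrix_inv_def by blast+
qed

lemma sum_G_ginv:
  assumes "t \<in> I" "p \<in> cdom c"
  shows "(\<Sum>j\<in>UNIV. G t i j p * ginv (G t) j k p) = (if i = k then 1 else 0)"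
  using arg_cong[OF matrix_inv_G(1)[OF assms], of "\<lambda>B. B $ i $ k"]
  by (simp add: matrix_matrix_mult_def ginv_def mat_def)

lemma ginv_sym:
  assumes "t \<in> I" "p \<in> cdom c"
  shows "ginv (G t) i j p = ginv (G t) j i p"
proof -
  let ?A = "\<chi> i j. G t i j p"
  have tA: "transpose ?A = ?A"
    using G_sym[OF assms] by (simp add: transpose_def vec_eq_iff)
  have "transpose (matrix_inv ?A) ** ?A = mat 1"
    using arg_cong[OF matrix_inv_G(1)[OF assms], of transpose]
    by (simp add: matrix_transpose_mul tA)
  then have "transpose (matrix_inv ?A) ** (?A ** matrix_inv ?A) = matrix_inv ?A"
    by (simp only: matrix_mul_assoc matrix_mul_lid)
  then have "transpose (matrix_inv ?A) = matrix_inv ?A"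
    by (simp only: matrix_inv_G(1)[OF assms] matrix_mul_rid)
  from arg_cong[OF this, of "\<lambda>B. B $ i $ j"] show ?thesis
    by (simp add: ginv_def transpose_def)
qed

lemma sm_det [simp]: "(\<And>i j. sm (\<lambda>t. B t i j)) \<Longrightarrow> sm (\<lambda>t p. det (\<chi> i j. B t i j p))"
  unfolding det_def by (auto intro!: sm_sum sm_mult sm_prod)

lemma sm_ginv [simp]: "sm (\<lambda>t. ginv (G t) i j)"
proof -
  \<comment> \<open>Cramer's rule\<close>
  define B where "B t a b p = (if b = i then if a = j then 1 else 0 else G t a b p)" for t a b p
  have B: "sm (\<lambda>t. B t a b)" for a b
    by (cases "b = i"; cases "a = j") (simp_all add: B_def[abs_def])
  have "sm (\<lambda>t p. det (\<chi> a b. B t a b p) * inverse (det (\<chi> i j. G t i j p)))"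
    by (intro sm_mult sm_det B sm_inverse G_det sm_G)
  then show ?thesis
  proof (rule sm_cong)
    fix t p assume tp: "t \<in> I" "p \<in> cdom c"
    let ?A = "\<chi> i j. G t i j p"
    \<comment> \<open>Column \<open>j\<close> of the inverse, seen as the solution of a linear
      system with a unit vector on the right.\<close>
    define x where "x = (\<chi> a. matrix_inv ?A $ a $ j)"
    have "?A *v x = axis j 1"
      using arg_cong[OF matrix_inv_G(1)[OF tp], of "\<lambda>B. (\<chi> a. B $ a $ j)"]
      by (simp add: x_def matrix_matrix_mult_def matrix_vector_mult_def mat_def axis_def vec_eq_iff)
    then have "x = (\<chi> k. det (\<chi> a b. if b = k then axis j 1 $ a else ?A $ a $ b) / det ?A)"
      by (simp add: cramer[OF G_det[OF tp]])
    then have "x $ i = det (\<chi> a b. if b = i then axis j 1 $ a else ?A $ a $ b) / det ?A"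
      by (metis (no_types, lifting) vec_lambda_beta)
    moreover have "(\<chi> a b. if b = i then axis j 1 $ a else ?A $ a $ b) = (\<chi> a b. B t a b p)"
      by (simp add: B_def axis_def vec_eq_iff)
    ultimately show "det (\<chi> a b. B t a b p) * inverse (det ?A) = ginv (G t) i j p"
      by (simp add: x_def ginv_def divide_inverse)
  qed
qed

lemma sm_Christoffel [simp]: "sm (\<lambda>t. Christoffel c (G t) k i j)"
  unfolding Christoffel_def[abs_def] by (intro sm_divide_const sm_sum sm_mult sm_add sm_diff sm_ginv sm_coord_deriv sm_G)

lemma coord_deriv_G_sym:
  assumes "t \<in> I" "p \<in> cdom c"
  shows "coord_deriv c k (G t i j) p = coord_deriv c k (G t j i) p"
proof -
  have "family_deriv I c (Some k) (\<lambda>t. G t i j) t p = family_deriv I c (Some k) (\<lambda>t. G t j i) t p"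
    by (rule family_deriv_cong[OF sm_G G_sym assms])
  then show ?thesis by (simp add: family_deriv_Some)
qed

lemma Christoffel_sym:
  assumes "t \<in> I" "p \<in> cdom c"
  shows "Christoffel c (G t) l i j p = Christoffel c (G t) l j i p"
  unfolding Christoffel_def coord_deriv_G_sym[OF assms, of _ i j] by (simp add: add.commute)

text \<open>Lowering the upper index gives back the Koszul expression; its versions for
  \<open>i\<close>, \<open>j\<close> and for \<open>j\<close>, \<open>i\<close> add up to twice the
  derivative of the metric.\<close>

lemma metric_compatible:
  assumes tp: "t \<in> I" "p \<in> cdom c"
  shows "coord_deriv c k (G t i j) p =
    (\<Sum>l\<in>UNIV. Christoffel c (G t) l k i p * G t l j p) + (\<Sum>l\<in>UNIV. Christoffel c (G t) l k j p * G t i l p)"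
proof -
  define d where "d k i j = coord_deriv c k (G t i j) p" for k i j
  have d: "d k i j = d k j i" for k i j
    unfolding d_def by (rule coord_deriv_G_sym[OF tp])
  have *: "2 * (\<Sum>l\<in>UNIV. Christoffel c (G t) l k i p * G t j l p) = d k i j + d i k j - d j k i" for k i j
  proof -
    have "2 * (\<Sum>l\<in>UNIV. Christoffel c (G t) l k i p * G t j l p) =
        (\<Sum>l\<in>UNIV. \<Sum>m\<in>UNIV. G t j l p * ginv (G t) l m p * (d k i m + d i k m - d m k i))"
      by (simp add: Christoffel_def d_def sum_distrib_left sum_distrib_right sum_divide_distrib ac_simps)
    also have "\<dots> = (\<Sum>m\<in>UNIV. (\<Sum>l\<in>UNIV. G t j l p * ginv (G t) l m p) * (d k i m + d i k m - d m k i))"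
      by (subst sum.swap) (simp add: sum_distrib_right)
    also have "\<dots> = d k i j + d i k j - d j k i"
      by (simp add: sum_G_ginv[OF tp] if_distrib if_distribR cong: if_cong)
    finally show ?thesis .
  qed
  have "2 * (\<Sum>l\<in>UNIV. Christoffel c (G t) l k i p * G t l j p) = d k i j + d i k j - d j k i"
    using *[of k i j] by (simp add: G_sym[OF tp, of _ j])
  with *[of k j i] d[of j k i] d[of i k j] d[of k i j] d[of j i k] d[of i j k] show ?thesis
    by (simp add: d_def)
qed

text \<open>Each axiom is a property of jets or, through \<open>J_cong\<close>, an identity valid on
  the whole chart and time interval.\<close>

sublocale R: metric_ring "\<lambda>i. jet_deriv (Some i)" "\<lambda>i j. J (\<lambda>t. G t i j)" "\<lambda>i j. J (\<lambda>t. ginv (G t) i j)"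
  "\<lambda>k i j. J (\<lambda>t. Christoffel c (G t) k i j)"
proof
  show "x = 0" if "x + x = 0" for x :: "'n option jet"
    using that by (rule jet_double_0)
  show "derivation (jet_deriv (Some i) :: 'n option jet \<Rightarrow> _)" for i
    by (rule derivation_jet_deriv)
  show "jet_deriv (Some i) (jet_deriv (Some j) x) = jet_deriv (Some j) (jet_deriv (Some i) x)" for i j and x :: "'n option jet"
    by (rule jet_deriv_commute)
  show "J (\<lambda>t. G t i j) = J (\<lambda>t. G t j i)" for i j
    by (rule J_cong) (simp_all add: G_sym)
  show "J (\<lambda>t. ginv (G t) i j) = J (\<lambda>t. ginv (G t) j i)" for i j
    by (rule J_cong) (simp_all add: ginv_sym)
  show "J (\<lambda>t. Christoffel c (G t) k i j) = J (\<lambda>t. Christoffel c (G t) k j i)" for k i j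
    by (rule J_cong) (simp_all add: Christoffel_sym)
  show "(\<Sum>j\<in>UNIV. J (\<lambda>t. G t i j) * J (\<lambda>t. ginv (G t) j k)) = (if i = k then 1 else 0)" for i k
  proof -
    have "(\<Sum>j\<in>UNIV. J (\<lambda>t. G t i j) * J (\<lambda>t. ginv (G t) j k)) = J (\<lambda>t p. \<Sum>j\<in>UNIV. G t i j p * ginv (G t) j k p)"
      by (simp add: J_simps)
    also have "\<dots> = J (\<lambda>t p. if i = k then 1 else 0)"
      by (rule J_cong) (simp_all add: sum_G_ginv)
    finally show ?thesis by (simp add: J_0 J_1)
  qed
  show "jet_deriv (Some k) (J (\<lambda>t. G t i j)) =
      (\<Sum>l\<in>UNIV. J (\<lambda>t. Christoffel c (G t) l k i) * J (\<lambda>t. G t l j)) +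
      (\<Sum>l\<in>UNIV. J (\<lambda>t. Christoffel c (G t) l k j) * J (\<lambda>t. G t i l))" for i j k
  proof -
    have "jet_deriv (Some k) (J (\<lambda>t. G t i j)) = J (\<lambda>t p. coord_deriv c k (G t i j) p)"
      by (simp add: J_coord_deriv)
    also have "\<dots> = J (\<lambda>t p. (\<Sum>l\<in>UNIV. Christoffel c (G t) l k i p * G t l j p) + (\<Sum>l\<in>UNIV. Christoffel c (G t) l k j p * G t i l p))"
      by (rule J_cong) (simp_all add: metric_compatible)
    finally show ?thesis by (simp add: J_simps)
  qed
qed

end

section \<open>Jets of curvature and of the tensor operations\<close>

context metric_chart
begin

lemma sm_trace2 [simp]: "(\<And>i j. sm (\<lambda>t. F t i j)) \<Longrightarrow> sm (\<lambda>t. trace2 (G t) (F t))"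
  by (simp add: trace2_def[abs_def])

lemma J_trace2: "(\<And>i j. sm (\<lambda>t. F t i j)) \<Longrightarrow> J (\<lambda>t. trace2 (G t) (F t)) = R.tr (\<lambda>i j. J (\<lambda>t. F t i j))"
  by (simp add: trace2_def[abs_def] R.tr_def J_simps)

lemma sm_Riem [simp]: "sm (\<lambda>t. Riem c (G t) l i j k)"
  by (simp add: Riem_def[abs_def])

lemma J_Riem: "J (\<lambda>t. Riem c (G t) l i j k) = R.riem l i j k"
  by (simp add: Riem_def[abs_def] R.riem_def J_simps)

lemma sm_Ric [simp]: "sm (\<lambda>t. Ric c (G t) j k)"
  by (simp add: Ric_def[abs_def])

lemma J_Ric: "J (\<lambda>t. Ric c (G t) j k) = R.ric j k"
  by (simp add: Ric_def[abs_def] R.ric_def J_simps J_Riem)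

lemma sm_scal [simp]: "sm (\<lambda>t. scal c (G t))"
  by (simp add: scal_def)

lemma J_scal: "J (\<lambda>t. scal c (G t)) = R.sc"
  by (simp add: scal_def R.sc_def J_trace2 J_Ric)

lemma sm_Hess [simp]: "sm u \<Longrightarrow> sm (\<lambda>t. Hess c (G t) (u t) i j)"
  by (simp add: Hess_def[abs_def])

lemma J_Hess: "sm u \<Longrightarrow> J (\<lambda>t. Hess c (G t) (u t) i j) = R.hess (J u) i j"
  by (simp add: Hess_def[abs_def] R.cov1_def R.low_def J_simps)

lemma sm_laplacian [simp]: "sm u \<Longrightarrow> sm (\<lambda>t. laplacian c (G t) (u t))"
  by (simp add: laplacian_def)

lemma J_laplacian: "sm u \<Longrightarrow> J (\<lambda>t. laplacian c (G t) (u t)) = R.lap (J u)"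
  by (simp add: laplacian_def R.lap_def J_trace2 J_Hess)

lemma sm_grad [simp]: "sm u \<Longrightarrow> sm (\<lambda>t. grad c (G t) (u t) i)"
  by (simp add: grad_def[abs_def])

lemma J_grad: "sm u \<Longrightarrow> J (\<lambda>t. grad c (G t) (u t) i) = (\<Sum>j\<in>UNIV. J (\<lambda>t. ginv (G t) i j) * jet_deriv (Some j) (J u))"
  by (simp add: grad_def[abs_def] J_simps)

lemma sm_grad_normsq [simp]: "sm u \<Longrightarrow> sm (\<lambda>t. grad_normsq c (G t) (u t))"
  by (simp add: grad_normsq_def[abs_def])

lemma J_grad_normsq: "sm u \<Longrightarrow> J (\<lambda>t. grad_normsq c (G t) (u t)) = R.inner1 (\<lambda>i. jet_deriv (Some i) (J u)) (\<lambda>i. jet_deriv (Some i) (J u))"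
  by (simp add: grad_normsq_def[abs_def] J_simps J_grad flip: R.inner1_raise)

lemma sm_inner2 [simp]:
  "(\<And>i j. sm (\<lambda>t. S t i j)) \<Longrightarrow> (\<And>i j. sm (\<lambda>t. T t i j)) \<Longrightarrow> sm (\<lambda>t. inner2 (G t) (S t) (T t))"
  by (simp add: inner2_def[abs_def])

lemma J_inner2:
  "(\<And>i j. sm (\<lambda>t. S t i j)) \<Longrightarrow> (\<And>i j. sm (\<lambda>t. T t i j)) \<Longrightarrow>
   J (\<lambda>t. inner2 (G t) (S t) (T t)) = R.inner2 (\<lambda>i j. J (\<lambda>t. S t i j)) (\<lambda>i j. J (\<lambda>t. T t i j))"
  by (simp add: inner2_def[abs_def] R.inner2_alt J_simps)

lemma sm_inner3 [simp]:
  "(\<And>i j k. sm (\<lambda>t. S t i j k)) \<Longrightarrow> (\<And>i j k. sm (\<lambda>t. T t i j k)) \<Longrightarrow> sm (\<lambda>t. inner3 (G t) (S t) (T t))"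
  by (simp add: inner3_def[abs_def])

lemma J_inner3:
  "(\<And>i j k. sm (\<lambda>t. S t i j k)) \<Longrightarrow> (\<And>i j k. sm (\<lambda>t. T t i j k)) \<Longrightarrow>
   J (\<lambda>t. inner3 (G t) (S t) (T t)) = R.inner3 (\<lambda>i j k. J (\<lambda>t. S t i j k)) (\<lambda>i j k. J (\<lambda>t. T t i j k))"
  by (simp add: inner3_def[abs_def] R.inner3_alt J_simps)

lemma sm_sq3 [simp]: "(\<And>i j k. sm (\<lambda>t. H t i j k)) \<Longrightarrow> sm (\<lambda>t. sq3 (G t) (H t) i j)"
  by (simp add: sq3_def)

lemma J_sq3: "(\<And>i j k. sm (\<lambda>t. H t i j k)) \<Longrightarrow> J (\<lambda>t. sq3 (G t) (H t) i j) = R.sq3 (\<lambda>i j k. J (\<lambda>t. H t i j k)) i j"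
  by (simp add: sq3_def R.sq3_def J_inner2)

lemma sm_cov3 [simp]: "(\<And>i j k. sm (\<lambda>t. H t i j k)) \<Longrightarrow> sm (\<lambda>t. cov3 c (G t) (H t) m i j k)"
  by (simp add: cov3_def[abs_def])

lemma J_cov3: "(\<And>i j k. sm (\<lambda>t. H t i j k)) \<Longrightarrow> J (\<lambda>t. cov3 c (G t) (H t) m i j k) = R.cov3 m (\<lambda>i j k. J (\<lambda>t. H t i j k)) i j k"
  by (simp add: cov3_def[abs_def] R.cov3_def R.low_def J_simps sum.distrib)

lemma sm_codiff [simp]: "(\<And>i j k. sm (\<lambda>t. H t i j k)) \<Longrightarrow> sm (\<lambda>t. codiff c (G t) (H t) j k)"
  by (simp add: codiff_def[abs_def])

lemma J_codiff: "(\<And>i j k. sm (\<lambda>t. H t i j k)) \<Longrightarrow> J (\<lambda>t. codiff c (G t) (H t) j k) = R.codiff (\<lambda>i j k. J (\<lambda>t. H t i j k)) j k"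
  by (simp add: codiff_def[abs_def] R.codiff_def R.tr_def J_simps J_cov3)

lemma sm_interior_prod [simp]:
  "sm u \<Longrightarrow> (\<And>i j k. sm (\<lambda>t. H t i j k)) \<Longrightarrow> sm (\<lambda>t. interior_prod (grad c (G t) (u t)) (H t) j k)"
  by (simp add: interior_prod_def[abs_def])

lemma J_interior_prod:
  "sm u \<Longrightarrow> (\<And>i j k. sm (\<lambda>t. H t i j k)) \<Longrightarrow> J (\<lambda>t. interior_prod (grad c (G t) (u t)) (H t) j k) =
    R.int_prod (\<lambda>i. jet_deriv (Some i) (J u)) (\<lambda>i j k. J (\<lambda>t. H t i j k)) j k"
  by (simp add: interior_prod_def[abs_def] R.int_prod_alt J_simps J_grad)

lemma sm_d_two [simp]: "(\<And>i j. sm (\<lambda>t. b t i j)) \<Longrightarrow> sm (\<lambda>t. d_two c (b t) i j k)"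
  by (simp add: d_two_def[abs_def])

lemma J_d_two: "(\<And>i j. sm (\<lambda>t. b t i j)) \<Longrightarrow> J (\<lambda>t. d_two c (b t) i j k) =
    jet_deriv (Some i) (J (\<lambda>t. b t j k)) - jet_deriv (Some j) (J (\<lambda>t. b t i k)) + jet_deriv (Some k) (J (\<lambda>t. b t i j))"
  by (simp add: d_two_def[abs_def] J_simps)

end

section \<open>The flow in a chart\<close>

locale flow_chart = metric_chart I c t0 p0 G
  for I and c :: "('a, 'n::finite) chart" and t0 p0 G +
  fixes H :: "real \<Rightarrow> 'n \<Rightarrow> 'n \<Rightarrow> 'n \<Rightarrow> 'a \<Rightarrow> real" and \<phi> :: "real \<Rightarrow> 'a \<Rightarrow> real"
    and H0 :: "'n \<Rightarrow> 'n \<Rightarrow> 'n \<Rightarrow> 'a \<Rightarrow> real" and b :: "real \<Rightarrow> 'n \<Rightarrow> 'n \<Rightarrow> 'a \<Rightarrow> real"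
  assumes H0: "\<And>i j k. smooth_fun c (H0 i j k)"
    and sm_b [simp]: "\<And>i j. sm (\<lambda>t. b t i j)"
    and sm_\<phi> [simp]: "sm \<phi>"
    and H_eq: "\<And>t p i j k. t \<in> I \<Longrightarrow> p \<in> cdom c \<Longrightarrow> H t i j k p = H0 i j k p + d_two c (b t) i j k p"
    and H12: "\<And>t p i j k. t \<in> I \<Longrightarrow> p \<in> cdom c \<Longrightarrow> H t i j k p = - H t j i k p"
    and H23: "\<And>t p i j k. t \<in> I \<Longrightarrow> p \<in> cdom c \<Longrightarrow> H t i j k p = - H t i k j p"
    and H_closed: "\<And>t p i j k l. t \<in> I \<Longrightarrow> p \<in> cdom c \<Longrightarrow> d_three c (H t) i j k l p = 0"
    and flow_G: "\<And>t p i j. t \<in> I \<Longrightarrow> p \<in> cdom c \<Longrightarrow>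
      time_deriv I (\<lambda>s. G s i j p) t = - 2 * Ric c (G t) i j p + 1/2 * sq3 (G t) (H t) i j p"
    and flow_b: "\<And>t p i j. t \<in> I \<Longrightarrow> p \<in> cdom c \<Longrightarrow> time_deriv I (\<lambda>s. b s i j p) t = - codiff c (G t) (H t) i j p"
    and flow_\<phi>: "\<And>t p. t \<in> I \<Longrightarrow> p \<in> cdom c \<Longrightarrow> heat_op I c G \<phi> t p = 1/6 * inner3 (G t) (H t) (H t) p"
begin

text \<open>The flow stipulates joint regularity in time and space for the metric and the potential;
  for the three-form it has to be derived from its decomposition.\<close>

lemma sm_H [simp]: "sm (\<lambda>t. H t i j k)"
proof (rule sm_cong)
  show "sm (\<lambda>t p. H0 i j k p + d_two c (b t) i j k p)"
    by (intro sm_add sm_d_two sm_b sm_static H0)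
qed (simp add: H_eq)

text \<open>The fixed part has zero time derivative. On the rest, time and space derivatives of jets
  commute, so the equation for \<open>b\<close> may be inserted under the exterior
  derivative.\<close>

lemma T_J_H: "jet_deriv None (J (\<lambda>t. H t i j k)) =
   - (jet_deriv (Some i) (J (\<lambda>t. codiff c (G t) (H t) j k)) - jet_deriv (Some j) (J (\<lambda>t. codiff c (G t) (H t) i k))
      + jet_deriv (Some k) (J (\<lambda>t. codiff c (G t) (H t) i j)))"
proof -
  have "J (\<lambda>t. H t i j k) = J (\<lambda>t p. H0 i j k p + d_two c (b t) i j k p)"
    by (rule J_cong) (simp_all add: H_eq)
  also have "\<dots> = J (\<lambda>t. H0 i j k) + J (\<lambda>t. d_two c (b t) i j k)"
    by (simp add: J_add sm_static H0)
  finally have "jet_deriv None (J (\<lambda>t. H t i j k)) = jet_deriv None (J (\<lambda>t. H0 i j k)) + jet_deriv None (J (\<lambda>t. d_two c (b t) i j k))"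
    by (simp add: jet_deriv_add)
  moreover have "jet_deriv None (J (\<lambda>t. H0 i j k)) = 0"
  proof -
    have "jet_deriv None (J (\<lambda>t. H0 i j k)) = J (\<lambda>t p. time_deriv I (\<lambda>s. H0 i j k p) t)"
      by (simp add: J_time_deriv sm_static H0)
    also have "\<dots> = J (\<lambda>t p. 0)"
    proof (rule J_cong)
      show "sm (\<lambda>t p. time_deriv I (\<lambda>s. H0 i j k p) t)"
        using sm_family_deriv[OF sm_static[OF H0], of None] by (simp add: family_deriv_None)
      show "time_deriv I (\<lambda>s. H0 i j k p) t = 0" if "t \<in> I" for t p
        unfolding time_deriv_def by (rule vector_derivative_within[OF at_within_I[OF that]]) (rule has_vector_derivative_const)
    qed
    finally show ?thesis by (simp add: J_0)
  qed
  moreover have "jet_deriv None (J (\<lambda>t. b t i j)) = - J (\<lambda>t. codiff c (G t) (H t) i j)" for i j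
  proof -
    have "jet_deriv None (J (\<lambda>t. b t i j)) = J (\<lambda>t p. time_deriv I (\<lambda>s. b s i j p) t)"
      by (simp add: J_time_deriv)
    also have "\<dots> = J (\<lambda>t p. - codiff c (G t) (H t) i j p)"
      by (rule J_cong) (use sm_family_deriv[OF sm_b, of None] in \<open>simp_all add: family_deriv_None flow_b\<close>)
    finally show ?thesis by (simp add: J_minus)
  qed
  ultimately show ?thesis
    by (simp add: J_d_two derivation_simps[OF derivation_jet_deriv] jet_deriv_commute[of None "Some _"])
qed

text \<open>The factors 1/2 and 1/6 of the flow equations are cleared on the level of functions,
  before jets are taken.\<close>

sublocale R: flow_ring "\<lambda>i. jet_deriv (Some i)" "\<lambda>i j. J (\<lambda>t. G t i j)" "\<lambda>i j. J (\<lambda>t. ginv (G t) i j)"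
  "\<lambda>k i j. J (\<lambda>t. Christoffel c (G t) k i j)" "\<lambda>i j k. J (\<lambda>t. H t i j k)" "jet_deriv None" "J \<phi>"
proof
  show "R.skew3 (\<lambda>i j k. J (\<lambda>t. H t i j k))"
    unfolding R.skew3_def
  proof (intro allI conjI)
    fix i j k
    have "J (\<lambda>t. H t i j k) = J (\<lambda>t p. - H t j i k p)"
      by (rule J_cong) (simp_all flip: H12)
    then show "J (\<lambda>t. H t i j k) = - J (\<lambda>t. H t j i k)" by (simp add: J_minus)
    have "J (\<lambda>t. H t i j k) = J (\<lambda>t p. - H t i k j p)"
      by (rule J_cong) (simp_all flip: H23)
    then show "J (\<lambda>t. H t i j k) = - J (\<lambda>t. H t i k j)" by (simp add: J_minus)
  qed
  show "R.closed3 (\<lambda>i j k. J (\<lambda>t. H t i j k))"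
    unfolding R.closed3_def
  proof (intro allI)
    fix i j k l
    have "J (\<lambda>t. d_three c (H t) i j k l) = J (\<lambda>t p. 0)"
      by (rule J_cong) (simp add: d_three_def[abs_def], simp add: H_closed)
    then show "jet_deriv (Some i) (J (\<lambda>t. H t j k l)) - jet_deriv (Some j) (J (\<lambda>t. H t i k l)) +
        jet_deriv (Some k) (J (\<lambda>t. H t i j l)) - jet_deriv (Some l) (J (\<lambda>t. H t i j k)) = 0"
      by (simp add: d_three_def[abs_def] J_simps)
  qed
  show "derivation (jet_deriv None :: 'n option jet \<Rightarrow> _)"
    by (rule derivation_jet_deriv)
  show "jet_deriv None (jet_deriv (Some i) x) = jet_deriv (Some i) (jet_deriv None x)" for i and x :: "'n option jet"
    by (rule jet_deriv_commute)
  show "2 * jet_deriv None (J (\<lambda>t. G t i j)) = R.sq3 (\<lambda>i j k. J (\<lambda>t. H t i j k)) i j - 4 * R.ric i j" for i j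
  proof -
    have sm_dG: "sm (\<lambda>t p. time_deriv I (\<lambda>s. G s i j p) t)"
      using sm_family_deriv[OF sm_G, of None] by (simp add: family_deriv_None)
    have "2 * jet_deriv None (J (\<lambda>t. G t i j)) = J (\<lambda>t p. 2 * time_deriv I (\<lambda>s. G s i j p) t)"
      by (simp add: J_numeral_mult sm_dG J_time_deriv)
    also have "\<dots> = J (\<lambda>t p. sq3 (G t) (H t) i j p - 4 * Ric c (G t) i j p)"
      by (rule J_cong) (simp_all add: sm_dG flow_G)
    finally show ?thesis by (simp add: J_diff J_numeral_mult J_sq3 J_Ric)
  qed
  show "jet_deriv None (J (\<lambda>t. H t i j k)) =
       - (jet_deriv (Some i) (R.codiff (\<lambda>i j k. J (\<lambda>t. H t i j k)) j k) -
          jet_deriv (Some j) (R.codiff (\<lambda>i j k. J (\<lambda>t. H t i j k)) i k) +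
          jet_deriv (Some k) (R.codiff (\<lambda>i j k. J (\<lambda>t. H t i j k)) i j))" for i j k
    unfolding T_J_H by (simp add: J_codiff)
  have sm_d\<phi>: "sm (\<lambda>t p. time_deriv I (\<lambda>s. \<phi> s p) t)"
    using sm_family_deriv[OF sm_\<phi>, of None] by (simp add: family_deriv_None)
  have "6 * (jet_deriv None (J \<phi>) - R.lap (J \<phi>)) = J (\<lambda>t p. 6 * (time_deriv I (\<lambda>s. \<phi> s p) t - laplacian c (G t) (\<phi> t) p))"
    by (simp add: J_numeral_mult sm_d\<phi> J_diff J_time_deriv J_laplacian)
  also have "\<dots> = J (\<lambda>t p. inner3 (G t) (H t) (H t) p)"
    by (rule J_cong) (simp_all add: sm_d\<phi> flow_\<phi>[unfolded heat_op_def])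
  finally show "6 * (jet_deriv None (J \<phi>) - R.lap (J \<phi>)) = R.inner3 (\<lambda>i j k. J (\<lambda>t. H t i j k)) (\<lambda>i j k. J (\<lambda>t. H t i j k))"
    by (simp add: J_inner3)
qed

lemma sm_gen_Ric [simp]: "sm (\<lambda>t. gen_Ric c (G t) (H t) (\<phi> t) i j)"
  by (simp add: gen_Ric_def[abs_def])

lemma sm_gen_scal [simp]: "sm (\<lambda>t. gen_scal c (G t) (H t) (\<phi> t))"
  by (simp add: gen_scal_def[abs_def])

lemma J_gen_Ric4: "R.gen_Ric4 i j = 4 * J (\<lambda>t. gen_Ric c (G t) (H t) (\<phi> t) i j)"
proof -
  have "4 * J (\<lambda>t. gen_Ric c (G t) (H t) (\<phi> t) i j) = J (\<lambda>t p. 4 * gen_Ric c (G t) (H t) (\<phi> t) i j p)"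
    by (simp add: J_numeral_mult)
  also have "\<dots> = J (\<lambda>t p. 4 * Ric c (G t) i j p - sq3 (G t) (H t) i j p + 4 * Hess c (G t) (\<phi> t) i j p
      - 2 * (codiff c (G t) (H t) i j p + interior_prod (grad c (G t) (\<phi> t)) (H t) i j p))"
    by (rule arg_cong[of _ _ J]) (simp add: gen_Ric_def fun_eq_iff algebra_simps)
  finally show ?thesis
    by (simp add: R.gen_Ric4_def J_diff J_add J_numeral_mult J_Ric J_sq3 J_Hess J_codiff J_interior_prod)
qed

lemma J_gen_scal12: "R.gen_scal12 = 12 * J (\<lambda>t. gen_scal c (G t) (H t) (\<phi> t))"
proof -
  have "12 * J (\<lambda>t. gen_scal c (G t) (H t) (\<phi> t)) = J (\<lambda>t p. 12 * gen_scal c (G t) (H t) (\<phi> t) p)"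
    by (simp add: J_numeral_mult)
  also have "\<dots> = J (\<lambda>t p. 12 * scal c (G t) p - inner3 (G t) (H t) (H t) p + 24 * laplacian c (G t) (\<phi> t) p
      - 12 * grad_normsq c (G t) (\<phi> t) p)"
    by (rule arg_cong[of _ _ J]) (simp add: gen_scal_def fun_eq_iff algebra_simps)
  finally show ?thesis
    by (simp add: R.gen_scal12_def J_diff J_add J_numeral_mult J_scal J_inner3 J_laplacian J_grad_normsq)
qed

theorem heat_gen_scal:
  "heat_op I c G (\<lambda>t. gen_scal c (G t) (H t) (\<phi> t)) t0 p0 =
    2 * inner2 (G t0) (gen_Ric c (G t0) (H t0) (\<phi> t0)) (gen_Ric c (G t0) (H t0) (\<phi> t0)) p0"
proof -
  let ?S = "\<lambda>t. gen_scal c (G t) (H t) (\<phi> t)" and ?R = "\<lambda>t. gen_Ric c (G t) (H t) (\<phi> t)"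
  have sm_dS: "sm (\<lambda>t p. time_deriv I (\<lambda>s. ?S s p) t)"
    using sm_family_deriv[OF sm_gen_scal, of None] by (simp add: family_deriv_None)
  have l: "R.lap R.gen_scal12 = 12 * R.lap (J ?S)" "jet_deriv None R.gen_scal12 = 12 * jet_deriv None (J ?S)"
    unfolding J_gen_scal12 by (simp_all add: R.lap_linear R.T_simps)
  have i: "R.inner2 R.gen_Ric4 R.gen_Ric4 = 16 * R.inner2 (\<lambda>i j. J (\<lambda>t. ?R t i j)) (\<lambda>i j. J (\<lambda>t. ?R t i j))"
    unfolding J_gen_Ric4[abs_def] by (simp add: R.inner2_linear)
  have "2 * (12 * jet_deriv None (J ?S) - 12 * R.lap (J ?S)) =
      3 * (16 * R.inner2 (\<lambda>i j. J (\<lambda>t. ?R t i j)) (\<lambda>i j. J (\<lambda>t. ?R t i j)))"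
    using R.heat_gen_scal12 unfolding l i .
  then have "J (\<lambda>t p. 2 * (12 * time_deriv I (\<lambda>s. ?S s p) t - 12 * laplacian c (G t) (?S t) p)) =
      J (\<lambda>t p. 3 * (16 * inner2 (G t) (?R t) (?R t) p))"
    by (simp add: J_numeral_mult J_diff sm_dS J_time_deriv J_laplacian J_inner2)
  \<comment> \<open>The coefficients of order zero are the values at the base point, real numbers in
    which the common factor 24 can be cancelled.\<close>
  from arg_cong[OF this, of jet_val] show ?thesis
    by (simp add: jet_val_J sm_dS heat_op_def)
qed

end

section \<open>From the chart identity to the manifold\<close>

theorem proposition1p1:
  fixes M :: "'a topology"
    and A :: "('a, 'n::finite) chart set"
    and I :: "real set"
    and g :: "real \<Rightarrow> 'a tensor2"
    and H :: "real \<Rightarrow> 'a tensor3"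
    and \<phi> :: "real \<Rightarrow> 'a \<Rightarrow> real"
  assumes "smooth_manifold M A"
    and "is_interval I" and "interior I \<noteq> {}"
    and "generalized_Ricci_flow M A I g H"
    and "dilaton_flow M A I g H \<phi>"
  shows "\<forall>t\<in>I. \<forall>c\<in>A. \<forall>p\<in>cdom c.
    heat_op I c (\<lambda>s. comp2 M A c (g s)) (\<lambda>s. R_Hphi M A c (g s) (H s) (\<phi> s)) t p =
      2 * inner2 (comp2 M A c (g t)) (Rc_Hphi M A c (g t) (H t) (\<phi> t))
                                     (Rc_Hphi M A c (g t) (H t) (\<phi> t)) p"
proof (intro ballI)
  fix t0 c p0
  assume t0: "t0 \<in> I" and c: "c \<in> A" and p0: "p0 \<in> cdom c"
  interpret manifold_chart M A c
    by unfold_locales (fact assms(1) c)+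
  note flow = assms(4)[unfolded generalized_Ricci_flow_def]
  from flow obtain H0 b where H0: "closed_three_form M A H0"
    and b: "\<forall>c\<in>A. \<forall>i j. smooth_family I c (\<lambda>t. comp2 M A c (b t) i j)"
    and H_eq': "\<forall>c\<in>A. \<forall>p\<in>cdom c. \<forall>t\<in>I. \<forall>i j k.
        comp3 M A c (H t) i j k p = comp3 M A c H0 i j k p + d_two c (comp2 M A c (b t)) i j k p"
    and flow_b': "\<forall>c\<in>A. \<forall>p\<in>cdom c. \<forall>t\<in>I. \<forall>i j. time_deriv I (\<lambda>s. comp2 M A c (b s) i j p) t =
        - codiff c (comp2 M A c (g t)) (comp3 M A c (H t)) i j p"
    by (elim conjE exE) (rule that; assumption)
  have g: "Riemannian_metric M A (g t)" and H: "closed_three_form M A (H t)" if "t \<in> I" for t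
    using conjunct1[OF flow] conjunct1[OF conjunct2[OF conjunct2[OF flow]]] that by simp_all
  have sm_g: "smooth_family I c (\<lambda>t. comp2 M A c (g t) i j)"
    and sm_b: "smooth_family I c (\<lambda>t. comp2 M A c (b t) i j)" for i j
    using conjunct1[OF conjunct2[OF flow]] b c by simp_all
  have flow_g: "time_deriv I (\<lambda>s. comp2 M A c (g s) i j p) t =
        - 2 * Ric c (comp2 M A c (g t)) i j p + 1/2 * sq3 (comp2 M A c (g t)) (comp3 M A c (H t)) i j p"
    and H_eq: "comp3 M A c (H t) i j k p = comp3 M A c H0 i j k p + d_two c (comp2 M A c (b t)) i j k p"
    and flow_b: "time_deriv I (\<lambda>s. comp2 M A c (b s) i j p) t =
        - codiff c (comp2 M A c (g t)) (comp3 M A c (H t)) i j p"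
    if "t \<in> I" "p \<in> cdom c" for t p i j k
    using conjunct1[OF conjunct2[OF conjunct2[OF conjunct2[OF flow]]]] H_eq' flow_b' c that by simp_all
  \<comment> \<open>The base point is fixed, yet all hypotheses range over the interval and the
    chart, because jets involve derivatives of every order there.\<close>
  interpret flow_chart I c t0 p0 "\<lambda>t. comp2 M A c (g t)" "\<lambda>t. comp3 M A c (H t)" \<phi> "comp3 M A c H0" "\<lambda>t. comp2 M A c (b t)"
  proof
    show "smooth_fun c (comp3 M A c H0 i j k)" for i j k
      using H0 c by (simp add: closed_three_form_def three_form_def)
    show "d_three c (comp3 M A c (H t)) i j k l p = 0" if "t \<in> I" "p \<in> cdom c" for t p i j k l
      using H[OF that(1)] that(2) c by (simp add: closed_three_form_def)
    show "comp3 M A c (H t) i j k p = - comp3 M A c (H t) j i k p"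
      "comp3 M A c (H t) i j k p = - comp3 M A c (H t) i k j p" if "t \<in> I" "p \<in> cdom c" for t p i j k
      using H[OF that(1)] three_form_comp_skew[OF _ that(2)] unfolding closed_three_form_def by blast+
    show "heat_op I c (\<lambda>t. comp2 M A c (g t)) \<phi> t p = 1/6 * inner3 (comp2 M A c (g t)) (comp3 M A c (H t)) (comp3 M A c (H t)) p"
      if "t \<in> I" "p \<in> cdom c" for t p
      using assms(5) c that unfolding dilaton_flow_def by blast
    show "smooth_family I c \<phi>"
      using assms(5) c unfolding dilaton_flow_def by blast
  qed (fact assms(2,3) chart_open chart_inj t0 p0 sm_g sm_b H_eq flow_g flow_b metric_comp_sym[OF g] metric_comp_det[OF g])+
  show "heat_op I c (\<lambda>s. comp2 M A c (g s)) (\<lambda>s. R_Hphi M A c (g s) (H s) (\<phi> s)) t0 p0 =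
      2 * inner2 (comp2 M A c (g t0)) (Rc_Hphi M A c (g t0) (H t0) (\<phi> t0)) (Rc_Hphi M A c (g t0) (H t0) (\<phi> t0)) p0"
    unfolding R_Hphi_def Rc_Hphi_def by (rule heat_gen_scal)
qed

end
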